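(* Let $a,b$ be positive integers. Consider the $(a:b)$ Hamiltonicity Maker-PhantomBreaker game on $E(K_n)$. (a) If $b>a$, then there exist a constant $c=c(a,b)>0$ and an integer $n_0$ such that for all $n\ge n_0$ Maker has a randomized strategy which, against every strategy of PhantomBreaker, wins with probability at least $c$. (b) If $b\le a$, then Maker has a randomized strategy that wins asymptotically almost surely; that is, for every $n$ large enough there is a randomized strategy for Maker and a number $p_n$ with $p_n\to 1$ as $n\to\infty$ such that, against every strategy of PhantomBreaker, this strategy wins with probability at least $p_n$.
   Context: Maker-PhantomBreaker game. The board is the edge set $E(K_n)$ of the complete graph on $n$ vertices, and there is a family of winning sets (edge sets of certain subgraphs of $K_n$). Initially all edges are unclaimed. Two players, Maker and PhantomBreaker, alternate turns, Maker going first. In an $(a:b)$ game, in each round Maker first makes $a$ moves, one after another, each consisting of attempting to claim one edge of $K_n$; then PhantomBreaker claims $b$ unclaimed edges (all remaining unclaimed edges if fewer than $b$ remain). If the edge Maker attempts to claim is unclaimed, it becomes hers. If it has already been claimed by PhantomBreaker, then that move of Maker is lost (she gets no replacement move) and she learns that this edge belongs to PhantomBreaker. Information: PhantomBreaker has complete information about the game so far (he sees all previous moves of Maker, including failed attempts, but not the outcomes of Maker's future random choices). Maker sees none of PhantomBreaker's moves; her only information about them is the success or failure of her own previous attempts. Maker wins if at some point she has claimed all edges of some winning set; otherwise PhantomBreaker wins. Both players may use randomized strategies, where each decision of PhantomBreaker may depend only on all previous moves of both players (including Maker's failed attempts) and his own randomness, and each decision of Maker may depend only on her own previous attempts, their success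 or failure, and her own randomness. Hamiltonicity game: the winning sets are the edge sets of all Hamilton cycles of $K_n$. *)

theory Defs
  imports "HOL-Probability.Probability"
begin

text \<open>
  A play is the chronological list of all moves. The flag of an attempt records whether the
  element was not in PhantomBreaker's possession, i.e. whether Maker owns it after the attempt.
\<close>

datatype 'e move = Attempt 'e bool | Claim "'e set"

type_synonym 'e play = "'e move list"

definition maker_elems :: "'e play \<Rightarrow> 'e set" where
  "maker_elems h = {e. Attempt e True \<in> set h}"

definition breaker_elems :: "'e play \<Rightarrow> 'e set" where
  "breaker_elems h = \<Union>{F. Claim F \<in> set h}"

definition unclaimed :: "'e set \<Rightarrow> 'e play \<Rightarrow> 'e set" where
  "unclaimed X h = X - maker_elems h - breaker_elems h"

definition maker_view :: "'e play \<Rightarrow> ('e \<times> bool) list" where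
  "maker_view h = [(e, s). Attempt e s \<leftarrow> h]"

text \<open>
  Deterministic strategies. Maker chooses an attempt from her own previous attempts and their
  outcomes only; PhantomBreaker chooses the set he claims in a turn from the whole play so far.
\<close>

type_synonym 'e maker_strategy = "('e \<times> bool) list \<Rightarrow> 'e"
type_synonym 'e breaker_strategy = "'e play \<Rightarrow> 'e set"

definition legal_maker :: "'e set \<Rightarrow> 'e maker_strategy \<Rightarrow> bool" where
  "legal_maker X \<sigma> \<longleftrightarrow> (\<forall>v. \<sigma> v \<in> X)"

text \<open>
  Legality is also demanded on play records that cannot arise. This is no restriction: a strategy
  can always be completed legally there, without influence on the actual play.
\<close>

definition legal_breaker :: "'e set \<Rightarrow> nat \<Rightarrow> 'e breaker_strategy \<Rightarrow> bool" where
  "legal_breaker X b \<tau> \<longleftrightarrow>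
     (\<forall>h. \<tau> h \<subseteq> unclaimed X h \<and> card (\<tau> h) = min b (card (unclaimed X h)))"

text \<open>Attempting an element that Maker already owns changes nothing for either player's possessions.\<close>

definition maker_move :: "'e maker_strategy \<Rightarrow> 'e play \<Rightarrow> 'e play" where
  "maker_move \<sigma> h = (let e = \<sigma> (maker_view h) in h @ [Attempt e (e \<notin> breaker_elems h)])"

definition breaker_turn :: "'e breaker_strategy \<Rightarrow> 'e play \<Rightarrow> 'e play" where
  "breaker_turn \<tau> h = h @ [Claim (\<tau> h)]"

definition game_round :: "nat \<Rightarrow> 'e maker_strategy \<Rightarrow> 'e breaker_strategy \<Rightarrow> 'e play \<Rightarrow> 'e play" where
  "game_round a \<sigma> \<tau> h = breaker_turn \<tau> ((maker_move \<sigma> ^^ a) h)"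

definition play_after :: "nat \<Rightarrow> 'e maker_strategy \<Rightarrow> 'e breaker_strategy \<Rightarrow> nat \<Rightarrow> 'e play" where
  "play_after a \<sigma> \<tau> r = (game_round a \<sigma> \<tau> ^^ r) []"

text \<open>
  Maker never loses an element, so it suffices to look at the ends of rounds. The bias
  \<open>b\<close> of PhantomBreaker enters only through the legality of his strategy.
\<close>

definition maker_wins ::
    "'e set set \<Rightarrow> nat \<Rightarrow> 'e maker_strategy \<Rightarrow> 'e breaker_strategy \<Rightarrow> bool" where
  "maker_wins \<W> a \<sigma> \<tau> \<longleftrightarrow> (\<exists>r. \<exists>W\<in>\<W>. W \<subseteq> maker_elems (play_after a \<sigma> \<tau> r))"

text \<open>
  A randomized strategy is a probability distribution over legal deterministic strategies (the
  player's private randomness); the two players randomize independently. On a finite board every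
  decision is among finitely many options, so discrete distributions lose no generality.
\<close>

definition randomized_maker :: "'e set \<Rightarrow> 'e maker_strategy pmf \<Rightarrow> bool" where
  "randomized_maker X \<mu> \<longleftrightarrow> (\<forall>\<sigma>\<in>set_pmf \<mu>. legal_maker X \<sigma>)"

definition randomized_breaker :: "'e set \<Rightarrow> nat \<Rightarrow> 'e breaker_strategy pmf \<Rightarrow> bool" where
  "randomized_breaker X b \<nu> \<longleftrightarrow> (\<forall>\<tau>\<in>set_pmf \<nu>. legal_breaker X b \<tau>)"

definition win_prob ::
    "'e set set \<Rightarrow> nat \<Rightarrow> 'e maker_strategy pmf \<Rightarrow> 'e breaker_strategy pmf \<Rightarrow> real" where
  "win_prob \<W> a \<mu> \<nu> = measure_pmf.prob (pair_pmf \<mu> \<nu>) {(\<sigma>, \<tau>). maker_wins \<W> a \<sigma> \<tau>}"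

text \<open>\<open>maker_achieves X \<W> a b p\<close>: in the \<open>(a:b)\<close> game on board \<open>X\<close> with winning sets \<open>\<W>\<close>, some
  randomized strategy of Maker wins with probability at least \<open>p\<close> against every strategy of
  PhantomBreaker.\<close>

definition maker_achieves :: "'e set \<Rightarrow> 'e set set \<Rightarrow> nat \<Rightarrow> nat \<Rightarrow> real \<Rightarrow> bool" where
  "maker_achieves X \<W> a b p \<longleftrightarrow>
     (\<exists>\<mu>. randomized_maker X \<mu> \<and> (\<forall>\<nu>. randomized_breaker X b \<nu> \<longrightarrow> win_prob \<W> a \<mu> \<nu> \<ge> p))"

definition complete_edges :: "nat \<Rightarrow> nat set set" where
  "complete_edges n = {e. e \<subseteq> {..<n} \<and> card e = 2}"

definition hamilton_cycles :: "nat \<Rightarrow> nat set set set" where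
  "hamilton_cycles n = {{{vs ! i, vs ! (Suc i mod n)} | i. i < n} | vs.
     n \<ge> 3 \<and> length vs = n \<and> distinct vs \<and> set vs = {..<n}}"

end

theory Submission
  imports Defs "HOL-Real_Asymp.Real_Asymp"
begin

text \<open>
  Maker keeps a cyclic order of all vertices together with the set of those edges of this virtual
  Hamilton cycle that she does not own yet; at the beginning this is the whole cycle. A 2-opt move at
  two missing edges, that is, the successful attempt to join an end of one to the corresponding end
  of the other, leaves one missing edge less. She makes such moves at random places until only
  few edges are missing. Until then a random pair of ends is blocked with small probability only
  (\<open>O(1/n)\<close> while a constant fraction of the edges is missing), so this takes about \<open>n\<close> attempts.

  The remaining missing edges are closed one after the other. Closing \<open>{u, h}\<close> by a double rotation
  needs an edge from \<open>u\<close> to \<open>x\<^sub>j\<close>, an edge from \<open>h\<close> to \<open>x\<^sub>l\<close>, and an edge between the neighbours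
  of \<open>x\<^sub>j\<close> and \<open>x\<^sub>l\<close>. PhantomBreaker sees the first two and can respond, but \<open>s\<close> edges of
  each kind offer \<open>s\<^sup>2\<close> ways to finish, of which he blocks only \<open>O(s)\<close>. Hence a constant expected
  number of attempts per missing edge suffices, provided that the ends of the missing edges do
  not have high degree in PhantomBreaker's graph.

  If \<open>b \<le> a\<close>, he cannot exhaust all edges at a vertex before the random moves are over. Hence
  Maker can respond to a failed attempt at \<open>u\<close> by attempting random edges at \<open>u\<close> until one succeeds
  (a rotation). Every end is picked at a random time, so a high degree end survives with small
  probability only. If \<open>b > a\<close>, Maker hopes for the event that no random move fails and that, in each of
  a bounded number of windows, all of the boundedly many ends of high degree get joined; this has
  probability bounded away from \<open>0\<close>.
\<close>

section \<open>Cyclic lists\<close>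

text \<open>PhantomBreaker adapts to all he has seen, so Maker's choices are not independent of his
  graph. Every probabilistic estimate is therefore a potential: a bound for the probability
  \<open>lose\<close> of not finishing within the remaining attempts whose average over Maker's next
  random choice does not exceed its present value, whatever he replies. Induction on the remaining
  attempts is then enough; Markov and union bounds are built into the potentials.

  The number m of edges left for the closing phase is dictated by the failed picks. Above about m
  missing edges, a pick fails with probability O(n / m^2). If b \<le> a, a failure is repaired in
  O(n / m) expected attempts; over n picks this uniform estimate spends O(n^3 / m^3) extra attempts,
  small against a reserve of order m when m is well above n^(3/4). If b > a, a failure is counted as
  a loss, and the estimate for the event that all picks succeed stays bounded below only for m
  linear in n. In both cases the closing phase is given a number of attempts linear in n, so small
  that PhantomBreaker cannot raise a degree by more than n / 16 meanwhile.\<close>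

fun path_edges :: "'a list \<Rightarrow> 'a set list" where
  "path_edges (x # y # zs) = {x, y} # path_edges (y # zs)"
| "path_edges _ = []"

definition cycle_edges :: "'a list \<Rightarrow> 'a set list" where
  "cycle_edges ys = {last ys, hd ys} # path_edges ys"

lemma path_edges_append:
  "A \<noteq> [] \<Longrightarrow> B \<noteq> [] \<Longrightarrow> path_edges (A @ B) = path_edges A @ {last A, hd B} # path_edges B"
proof (induction A rule: path_edges.induct)
  case ("2_2" v) then show ?case by (cases B) auto
qed auto

lemma path_edges_rev: "path_edges (rev A) = rev (path_edges A)"
proof (induction A rule: path_edges.induct)
  case (1 x y zs)
  have "path_edges (rev (x # y # zs)) = path_edges (rev (y # zs) @ [x])" by simp
  also have "\<dots> = path_edges (rev (y # zs)) @ {last (rev (y # zs)), x} # []"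
    by (subst path_edges_append) auto
  finally show ?case using 1 by (simp add: insert_commute last_rev)
qed auto

lemma length_path_edges [simp]: "length (path_edges ys) = length ys - 1"
  by (induction ys rule: path_edges.induct) auto

lemma nth_path_edges: "Suc j < length ys \<Longrightarrow> path_edges ys ! j = {ys ! j, ys ! Suc j}"
proof (induction ys arbitrary: j rule: path_edges.induct)
  case (1 x y zs) then show ?case by (cases j) auto
qed auto

lemma set_path_edges: "set (path_edges ys) = (\<lambda>j. {ys ! j, ys ! Suc j}) ` {j. Suc j < length ys}"
proof -
  have "set (path_edges ys) = (\<lambda>j. path_edges ys ! j) ` {j. j < length (path_edges ys)}"
    by (auto simp: set_conv_nth)
  also have "{j. j < length (path_edges ys)} = {j. Suc j < length ys}" by auto
  also have "(\<lambda>j. path_edges ys ! j) ` {j. Suc j < length ys} = (\<lambda>j. {ys ! j, ys ! Suc j}) ` {j. Suc j < length ys}"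
    by (rule image_cong) (auto simp: nth_path_edges)
  finally show ?thesis .
qed

lemma path_edges_subset: "e \<in> set (path_edges ys) \<Longrightarrow> e \<subseteq> set ys"
  by (auto simp: set_path_edges)

lemma distinct_path_edges: "distinct ys \<Longrightarrow> distinct (path_edges ys)"
proof (induction ys rule: path_edges.induct)
  case (1 x y zs)
  then show ?case using path_edges_subset[of "{x,y}" "y # zs"] by auto
qed auto

text \<open>For two vertices the closing edge would coincide with the path edge; from length 3 on it
  is new.\<close>

lemma distinct_cycle_edges:
  assumes "distinct ys" "length ys \<ge> 3"
  shows "distinct (cycle_edges ys)"
proof -
  obtain x y z zs where ys: "ys = x # y # z # zs"
    using assms(2) by (metis Suc_le_length_iff numeral_3_eq_3)
  have "{last ys, x} \<notin> set (path_edges (y # z # zs))"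
    using path_edges_subset[of "{last ys, x}" "y # z # zs"] assms ys by auto
  moreover have "last ys \<in> set (z # zs)" using ys by auto
  then have "last ys \<noteq> y" using assms(1) ys by auto
  moreover have "last ys \<noteq> x" using \<open>last ys \<in> set (z # zs)\<close> assms(1) ys by auto
  ultimately show ?thesis
    using distinct_path_edges[OF assms(1)] ys by (auto simp: cycle_edges_def doubleton_eq_iff)
qed

lemma cycle_edges_append:
  assumes "A \<noteq> []" "B \<noteq> []"
  shows "cycle_edges (A @ B) = {last B, hd A} # path_edges A @ {last A, hd B} # path_edges B"
  using assms by (simp add: cycle_edges_def path_edges_append)

lemma set_cycle_edges_rev: "set (cycle_edges (rev ys)) = set (cycle_edges ys)"
  by (cases "ys = []") (auto simp: cycle_edges_def path_edges_rev last_rev hd_rev insert_commute)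

lemma set_cycle_edges_rotate:
  "A \<noteq> [] \<Longrightarrow> B \<noteq> [] \<Longrightarrow> set (cycle_edges (B @ A)) = set (cycle_edges (A @ B))"
  by (auto simp: cycle_edges_append)

lemma cycle_edge_card2:
  assumes "distinct ys" "length ys \<ge> 2" "e \<in> set (cycle_edges ys)"
  shows "e \<subseteq> set ys \<and> card e = 2"
proof -
  have "last ys \<noteq> hd ys"
    using assms(1,2) by (cases ys) (auto split: if_splits)
  moreover have "ys \<noteq> []" using assms(2) by auto
  then have "last ys \<in> set ys" "hd ys \<in> set ys" by auto
  ultimately show ?thesis using assms
    by (auto simp: cycle_edges_def set_path_edges card_insert_if nth_eq_iff_index_eq
        dest: path_edges_subset) 
qed

text \<open>Inner vertices lie in two path edges, the two ends in one. For a single vertex both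
  corrections hit that vertex and the sum is 0.\<close>

lemma sum_path_edges:
  fixes f :: "'a \<Rightarrow> 'b::comm_ring_1"
  shows "distinct ys \<Longrightarrow> ys \<noteq> [] \<Longrightarrow>
    (\<Sum>e\<in>set (path_edges ys). \<Sum>x\<in>e. f x) = 2 * (\<Sum>x\<in>set ys. f x) - f (hd ys) - f (last ys)"
proof (induction ys rule: path_edges.induct)
  case (1 x y zs)
  have "{x, y} \<notin> set (path_edges (y # zs))" using path_edges_subset[of "{x,y}" "y # zs"] 1 by auto
  then show ?case using 1 by (auto simp: algebra_simps)
qed (auto simp: algebra_simps)

lemma sum_cycle_edges:
  fixes f :: "'a \<Rightarrow> 'b::comm_ring_1"
  assumes "distinct ys" "length ys \<ge> 3"
  shows "(\<Sum>e\<in>set (cycle_edges ys). \<Sum>x\<in>e. f x) = 2 * (\<Sum>x\<in>set ys. f x)"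
proof -
  have ne: "ys \<noteq> []" using assms by auto
  have "last ys \<noteq> hd ys" using assms by (cases ys) (auto split: if_splits)
  moreover have "{last ys, hd ys} \<notin> set (path_edges ys)"
    using distinct_cycle_edges[OF assms] by (simp add: cycle_edges_def)
  ultimately show ?thesis using sum_path_edges[OF assms(1) ne, of f]
    by (simp add: cycle_edges_def)
qed

section \<open>Opening the cycle at a prescribed edge\<close>

definition cut_at :: "'a list \<Rightarrow> 'a \<Rightarrow> 'a \<Rightarrow> 'a list" where
  "cut_at ys u h = (SOME zs. distinct zs \<and> set zs = set ys \<and>
     set (cycle_edges zs) = set (cycle_edges ys) \<and> last zs = u \<and> hd zs = h)"

text \<open>A rotation turns the prescribed edge into the closing edge and a reversal orients it;
  neither changes the edge set. So the vertex to be treated may always be assumed to stand last, and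
  its partner in the missing edge first.\<close>

lemma cut_at:
  assumes "distinct ys" "length ys \<ge> 3" "{u, h} \<in> set (cycle_edges ys)"
  shows "distinct (cut_at ys u h)" "set (cut_at ys u h) = set ys"
    "set (cycle_edges (cut_at ys u h)) = set (cycle_edges ys)"
    "last (cut_at ys u h) = u" "hd (cut_at ys u h) = h"
proof -
  let ?P = "\<lambda>zs. distinct zs \<and> set zs = set ys \<and>
     set (cycle_edges zs) = set (cycle_edges ys) \<and> last zs = u \<and> hd zs = h"
  have flip: "\<exists>zs. ?P zs" if "distinct zs" "set zs = set ys" "{last zs, hd zs} = {u, h}"
    "set (cycle_edges zs) = set (cycle_edges ys)" for zs
  proof -
    have ne: "zs \<noteq> []" using that(2) assms(2) by auto
    have "last zs = u \<and> hd zs = h \<or> last zs = h \<and> hd zs = u" using that(3) by (auto simp: doubleton_eq_iff)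
    then show ?thesis
    proof
      assume "last zs = h \<and> hd zs = u"
      then have "?P (rev zs)" using that ne by (simp add: last_rev hd_rev set_cycle_edges_rev)
      then show ?thesis by blast
    qed (use that in blast)
  qed
  have "\<exists>zs. ?P zs"
  proof (cases "{u, h} = {last ys, hd ys}")
    case True then show ?thesis using flip[of ys] assms by simp
  next
    case False
    then obtain j where j: "Suc j < length ys" "{u, h} = {ys ! j, ys ! Suc j}"
      using assms(3) by (auto simp: cycle_edges_def set_path_edges)
    let ?A = "take (Suc j) ys" and ?B = "drop (Suc j) ys"
    have "?A \<noteq> []" "?B \<noteq> []" using j by auto
    moreover have "last ?A = ys ! j" using j by (simp add: take_Suc_conv_app_nth)
    moreover have "hd ?B = ys ! Suc j" using j by (simp add: hd_drop_conv_nth)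
    moreover have "set (?B @ ?A) = set ys"
      by (metis append_take_drop_id set_append sup_commute)
    moreover have "distinct (?B @ ?A)" using assms(1)
      by (metis append_take_drop_id distinct_append inf_commute)
    ultimately show ?thesis
      using flip[of "?B @ ?A"] j set_cycle_edges_rotate[of ?A ?B] by simp
  qed
  then have "?P (cut_at ys u h)" unfolding cut_at_def by (rule someI_ex)
  then show "distinct (cut_at ys u h)" "set (cut_at ys u h) = set ys"
    "set (cycle_edges (cut_at ys u h)) = set (cycle_edges ys)"
    "last (cut_at ys u h) = u" "hd (cut_at ys u h) = h" by auto
qed

lemma cycle_edges_hamilton:
  assumes "distinct ys" "set ys = {..<n}" "n \<ge> 3"
  shows "set (cycle_edges ys) \<in> hamilton_cycles n"
proof -
  have len: "length ys = n" using assms distinct_card by fastforce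
  then have lh: "last ys = ys ! (n - 1)" "hd ys = ys ! 0"
    using assms(3) by (simp_all add: last_conv_nth hd_conv_nth flip: length_greater_0_conv)
  have "set (cycle_edges ys) = {{ys ! i, ys ! (Suc i mod n)} | i. i < n}" (is "_ = ?R")
  proof -
    have "?R = (\<lambda>i. {ys ! i, ys ! (Suc i mod n)}) ` {..<n}" by auto
    also have "{..<n} = insert (n - 1) {j. Suc j < n}" using assms(3) by auto
    also have "(\<lambda>i. {ys ! i, ys ! (Suc i mod n)}) ` \<dots> =
       insert {ys ! (n-1), ys ! 0} ((\<lambda>j. {ys ! j, ys ! Suc j}) ` {j. Suc j < n})"
      using assms(3) by auto
    also have "\<dots> = set (cycle_edges ys)"
      using len by (simp add: cycle_edges_def set_path_edges lh)
    finally show ?thesis by simp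
  qed
  then show ?thesis using len assms by (auto simp: hamilton_cycles_def)
qed

section \<open>2-opt moves and double rotations\<close>

definition two_opt :: "nat \<Rightarrow> 'a list \<Rightarrow> 'a list" where
  "two_opt j zs = rev (take (Suc j) zs) @ drop (Suc j) zs"

definition three_opt :: "nat \<Rightarrow> nat \<Rightarrow> 'a list \<Rightarrow> 'a list" where
  "three_opt l j zs = rev (take l zs) @ drop l (take (Suc j) zs) @ rev (drop (Suc j) zs)"

text \<open>\<open>E\<close> consists of the edges inside the reversed prefix and inside the suffix.
  The non-memberships, needed for counting missing edges later, follow from distinctness of the two
  edge lists.\<close>

lemma two_opt:
  assumes "Suc j < length zs" "distinct zs"
  shows "distinct (two_opt j zs)" "set (two_opt j zs) = set zs"
    "\<exists>E. set (cycle_edges zs) = {{last zs, hd zs}, {zs ! j, zs ! Suc j}} \<union> E \<and>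
         set (cycle_edges (two_opt j zs)) = {{last zs, zs ! j}, {hd zs, zs ! Suc j}} \<union> E \<and>
         (length zs \<ge> 3 \<longrightarrow> {last zs, hd zs} \<notin> E \<and> {zs ! j, zs ! Suc j} \<notin> E \<and>
            {last zs, zs ! j} \<notin> E \<and> {hd zs, zs ! Suc j} \<notin> E \<and>
            {last zs, hd zs} \<noteq> {zs ! j, zs ! Suc j} \<and> {last zs, zs ! j} \<noteq> {hd zs, zs ! Suc j})"
proof -
  let ?A = "take (Suc j) zs" and ?B = "drop (Suc j) zs"
  have ne: "?A \<noteq> []" "?B \<noteq> []" "zs \<noteq> []" using assms by auto
  have l: "last ?A = zs ! j" "hd ?B = zs ! Suc j" "hd ?A = hd zs" "last ?B = last zs"
    using assms by (simp_all add: take_Suc_conv_app_nth hd_drop_conv_nth hd_append)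
      (cases zs; simp)
  have d: "distinct (?A @ ?B)" using assms(2) by simp
  then show d': "distinct (two_opt j zs)" unfolding two_opt_def distinct_append by simp
  show s': "set (two_opt j zs) = set zs" unfolding two_opt_def
    by (metis append_take_drop_id set_append set_rev)
  have 1: "cycle_edges zs = {last zs, hd zs} # path_edges ?A @ {zs ! j, zs ! Suc j} # path_edges ?B"
    using cycle_edges_append[OF ne(1,2)] l by simp
  have 2: "cycle_edges (two_opt j zs) = {last zs, zs ! j} # rev (path_edges ?A) @ {hd zs, zs ! Suc j} # path_edges ?B"
    unfolding two_opt_def using cycle_edges_append[of "rev ?A" ?B] ne l
    by (simp add: path_edges_rev hd_rev last_rev)
  have 3: "length (two_opt j zs) = length zs" by (simp add: two_opt_def)
  show "\<exists>E. set (cycle_edges zs) = {{last zs, hd zs}, {zs ! j, zs ! Suc j}} \<union> E \<and>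
         set (cycle_edges (two_opt j zs)) = {{last zs, zs ! j}, {hd zs, zs ! Suc j}} \<union> E \<and>
         (length zs \<ge> 3 \<longrightarrow> {last zs, hd zs} \<notin> E \<and> {zs ! j, zs ! Suc j} \<notin> E \<and>
            {last zs, zs ! j} \<notin> E \<and> {hd zs, zs ! Suc j} \<notin> E \<and>
            {last zs, hd zs} \<noteq> {zs ! j, zs ! Suc j} \<and> {last zs, zs ! j} \<noteq> {hd zs, zs ! Suc j})"
  proof (intro exI conjI impI)
    let ?E = "set (path_edges ?A) \<union> set (path_edges ?B)"
    show "set (cycle_edges zs) = {{last zs, hd zs}, {zs ! j, zs ! Suc j}} \<union> ?E" unfolding 1 by auto
    show "set (cycle_edges (two_opt j zs)) = {{last zs, zs ! j}, {hd zs, zs ! Suc j}} \<union> ?E" unfolding 2 by auto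
    assume len: "3 \<le> length zs"
    note D = distinct_cycle_edges[OF assms(2) len, unfolded 1]
      distinct_cycle_edges[OF d', unfolded 3, OF len, unfolded 2]
    show "{last zs, hd zs} \<notin> ?E" "{zs ! j, zs ! Suc j} \<notin> ?E" "{last zs, zs ! j} \<notin> ?E"
      "{hd zs, zs ! Suc j} \<notin> ?E" "{last zs, hd zs} \<noteq> {zs ! j, zs ! Suc j}"
      "{last zs, zs ! j} \<noteq> {hd zs, zs ! Suc j}" using D by auto
  qed
qed

text \<open>Reversing both outer parts of \<open>P @ Q @ S\<close> performs a rotation at each end
  of the path. The edges from \<open>last zs\<close> to \<open>zs ! j\<close> and from
  \<open>hd zs\<close> to \<open>zs ! l\<close> become the junctions, and the edge between the new
  end vertices \<open>zs ! (l - 1)\<close> and \<open>zs ! Suc j\<close> closes the cycle.\<close>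

lemma three_opt:
  assumes "0 < l" "l \<le> j" "Suc j < length zs" "distinct zs" "length zs \<ge> 3"
  shows "distinct (three_opt l j zs)" "set (three_opt l j zs) = set zs"
    "\<exists>E. set (cycle_edges zs) = {{last zs, hd zs}, {zs ! (l - 1), zs ! l}, {zs ! j, zs ! Suc j}} \<union> E \<and>
         set (cycle_edges (three_opt l j zs)) =
           {{last zs, zs ! j}, {hd zs, zs ! l}, {zs ! (l - 1), zs ! Suc j}} \<union> E \<and>
         {last zs, hd zs} \<notin> E \<and> {zs ! (l - 1), zs ! l} \<notin> E \<and> {zs ! j, zs ! Suc j} \<notin> E"
proof -
  obtain P Q S where PQS: "P = take l zs" "Q = drop l (take (Suc j) zs)" "S = drop (Suc j) zs" by blast
  have ne: "P \<noteq> []" "Q \<noteq> []" "S \<noteq> []" using assms unfolding PQS by auto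
  have "take l (take (Suc j) zs) = P" unfolding PQS using assms(2) by (simp add: min_def)
  then have "take (Suc j) zs = P @ Q"
    unfolding PQS using append_take_drop_id[of l "take (Suc j) zs"] by simp
  then have split: "zs = P @ Q @ S"
    unfolding PQS(3) using append_take_drop_id[of "Suc j" zs] by simp
  have "last P = zs ! (l - 1)" using assms unfolding PQS
    by (cases l) (simp_all add: take_Suc_conv_app_nth)
  moreover have "last (take (Suc j) zs) = zs ! j" using assms(3) by (simp add: take_Suc_conv_app_nth)
  ultimately have l: "hd P = hd zs" "last P = zs ! (l - 1)" "hd Q = zs ! l" "last Q = zs ! j"
    "hd S = zs ! Suc j" "last S = last zs"
    using assms unfolding PQS by (simp_all add: hd_drop_conv_nth hd_take)
  have t: "three_opt l j zs = rev P @ Q @ rev S" unfolding three_opt_def PQS by simp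
  have "distinct (P @ Q @ S)" using assms(4) split by metis
  then show d': "distinct (three_opt l j zs)" unfolding t by auto
  have "set zs = set (P @ Q @ S)" using split by metis
  then show s': "set (three_opt l j zs) = set zs" unfolding t by auto
  have "cycle_edges zs = cycle_edges (P @ Q @ S)" using split by metis
  then have 1: "cycle_edges zs = {last zs, hd zs} # path_edges P @ {zs ! (l - 1), zs ! l} #
      path_edges Q @ {zs ! j, zs ! Suc j} # path_edges S"
    using ne by (simp add: cycle_edges_append path_edges_append l del: One_nat_def)
  have 2: "cycle_edges (three_opt l j zs) = {zs ! Suc j, zs ! (l - 1)} # rev (path_edges P) @ {hd zs, zs ! l} #
      path_edges Q @ {zs ! j, last zs} # rev (path_edges S)"
    unfolding t using ne
    by (simp add: cycle_edges_append path_edges_append path_edges_rev hd_rev last_rev l del: One_nat_def)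
  note D = distinct_cycle_edges[OF assms(4,5), unfolded 1]
  let ?E = "set (path_edges P) \<union> set (path_edges Q) \<union> set (path_edges S)"
  have "set (cycle_edges zs) = {{last zs, hd zs}, {zs ! (l - 1), zs ! l}, {zs ! j, zs ! Suc j}} \<union> ?E"
    unfolding 1 by auto
  moreover have "set (cycle_edges (three_opt l j zs)) =
           {{last zs, zs ! j}, {hd zs, zs ! l}, {zs ! (l - 1), zs ! Suc j}} \<union> ?E"
    unfolding 2 by (auto simp: insert_commute)
  moreover have "{last zs, hd zs} \<notin> ?E \<and> {zs ! (l - 1), zs ! l} \<notin> ?E \<and> {zs ! j, zs ! Suc j} \<notin> ?E"
    using D by auto
  ultimately show "\<exists>E. set (cycle_edges zs) = {{last zs, hd zs}, {zs ! (l - 1), zs ! l}, {zs ! j, zs ! Suc j}} \<union> E \<and>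
         set (cycle_edges (three_opt l j zs)) =
           {{last zs, zs ! j}, {hd zs, zs ! l}, {zs ! (l - 1), zs ! Suc j}} \<union> E \<and>
         {last zs, hd zs} \<notin> E \<and> {zs ! (l - 1), zs ! l} \<notin> E \<and> {zs ! j, zs ! Suc j} \<notin> E" by blast
qed

section \<open>Randomized strategies with internal memory\<close>

lemma measure_bind_pmf:
  "measure_pmf.prob (bind_pmf M N) A = measure_pmf.expectation M (\<lambda>x. measure_pmf.prob (N x) A)"
proof -
  have "ennreal (measure_pmf.prob (bind_pmf M N) A) = (\<integral>\<^sup>+x. ennreal (measure_pmf.prob (N x) A) \<partial>M)"
    by (simp add: measure_pmf.emeasure_eq_measure flip: measure_pmf.emeasure_eq_measure)
  also have "\<dots> = ennreal (measure_pmf.expectation M (\<lambda>x. measure_pmf.prob (N x) A))"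
    by (intro nn_integral_eq_integral measure_pmf.integrable_const_bound[where B=1]) auto
  finally show ?thesis by (simp add: integral_nonneg)
qed

text \<open>A behaviour draws an attempt together with the update of the memory \<open>'s\<close> depending on its
  success. Unfolding it for \<open>T\<close> attempts gives a random decision tree, that is, a random
  deterministic strategy.\<close>

type_synonym ('e, 's) behaviour = "'s \<Rightarrow> ('e \<times> (bool \<Rightarrow> 's)) pmf"

definition decide :: "'e \<Rightarrow> 'e maker_strategy \<Rightarrow> 'e maker_strategy \<Rightarrow> 'e maker_strategy" where
  "decide e \<sigma>1 \<sigma>0 v = (case v of [] \<Rightarrow> e | x # v' \<Rightarrow> if snd x then \<sigma>1 v' else \<sigma>0 v')"

text \<open>The subtrees for success and failure are drawn independently. A play enters just one of
  them, so only its marginal affects the outcome. Beyond depth \<open>T\<close> the tree repeats the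
  default attempt \<open>d\<close>.\<close>

fun unfold_behaviour :: "('e, 's) behaviour \<Rightarrow> 'e \<Rightarrow> nat \<Rightarrow> 's \<Rightarrow> 'e maker_strategy pmf" where
  "unfold_behaviour \<beta> d 0 s = return_pmf (\<lambda>_. d)"
| "unfold_behaviour \<beta> d (Suc T) s =
     bind_pmf (\<beta> s) (\<lambda>(e, f).
       map_pmf (\<lambda>(\<sigma>1, \<sigma>0). decide e \<sigma>1 \<sigma>0)
         (pair_pmf (unfold_behaviour \<beta> d T (f True)) (unfold_behaviour \<beta> d T (f False))))"

lemma legal_unfold:
  assumes "d \<in> X" "\<And>s e f. (e, f) \<in> set_pmf (\<beta> s) \<Longrightarrow> e \<in> X"
  shows "\<sigma> \<in> set_pmf (unfold_behaviour \<beta> d T s) \<Longrightarrow> legal_maker X \<sigma>"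
proof (induction T arbitrary: s \<sigma>)
  case 0 then show ?case using assms(1) by (simp add: legal_maker_def)
next
  case (Suc T)
  then obtain e f \<sigma>1 \<sigma>0 where *: "(e, f) \<in> set_pmf (\<beta> s)" "\<sigma> = decide e \<sigma>1 \<sigma>0"
    "\<sigma>1 \<in> set_pmf (unfold_behaviour \<beta> d T (f True))"
    "\<sigma>0 \<in> set_pmf (unfold_behaviour \<beta> d T (f False))"
    by auto
  then show ?case using Suc.IH assms(2)[OF *(1)]
    by (fastforce simp: legal_maker_def decide_def split: list.split)
qed

section \<open>The game played attempt by attempt\<close>

definition attempt :: "nat \<Rightarrow> 'e breaker_strategy \<Rightarrow> 'e \<Rightarrow> 'e play \<Rightarrow> 'e play" where
  "attempt a \<tau> e h = (let h' = h @ [Attempt e (e \<notin> breaker_elems h)] in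
     if length (maker_view h') mod a = 0 then breaker_turn \<tau> h' else h')"

definition follow :: "nat \<Rightarrow> 'e maker_strategy \<Rightarrow> 'e breaker_strategy \<Rightarrow> 'e play \<Rightarrow> 'e play" where
  "follow a \<sigma> \<tau> h = attempt a \<tau> (\<sigma> (maker_view h)) h"

text \<open>With \<open>attempt\<close>, which inserts PhantomBreaker's turn after every
  \<open>a\<close>-th attempt, rounds disappear. \<open>run\<close> replaces the strategy by the one
  that remains after the first outcome, in step with the recursion of decision trees.\<close>

fun run :: "nat \<Rightarrow> 'e breaker_strategy \<Rightarrow> nat \<Rightarrow> 'e maker_strategy \<Rightarrow> 'e play \<Rightarrow> 'e play" where
  "run a \<tau> 0 \<sigma> h = h"
| "run a \<tau> (Suc T) \<sigma> h =
     run a \<tau> T (\<lambda>v. \<sigma> ((\<sigma> [], \<sigma> [] \<notin> breaker_elems h) # v)) (attempt a \<tau> (\<sigma> []) h)"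

lemma maker_view_append: "maker_view (h @ h') = maker_view h @ maker_view h'"
  by (simp add: maker_view_def)

lemma maker_view_simps [simp]:
  "maker_view [] = []" "maker_view (Attempt e s # h) = (e, s) # maker_view h"
  "maker_view (Claim F # h) = maker_view h"
  by (simp_all add: maker_view_def)

lemma maker_view_attempt:
  "maker_view (attempt a \<tau> e h) = maker_view h @ [(e, e \<notin> breaker_elems h)]"
  by (simp add: attempt_def Let_def breaker_turn_def maker_view_append)

lemma run_eq_funpow:
  "run a \<tau> T (\<lambda>v. \<sigma> (maker_view h @ v)) h = (follow a \<sigma> \<tau> ^^ T) h"
proof (induction T arbitrary: h)
  case (Suc T)
  have "run a \<tau> (Suc T) (\<lambda>v. \<sigma> (maker_view h @ v)) h =
    run a \<tau> T (\<lambda>v. \<sigma> (maker_view (attempt a \<tau> (\<sigma> (maker_view h)) h) @ v)) (attempt a \<tau> (\<sigma> (maker_view h)) h)"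
    by (simp add: maker_view_attempt)
  also have "\<dots> = (follow a \<sigma> \<tau> ^^ Suc T) h"
    unfolding Suc.IH by (simp add: funpow_swap1 follow_def)
  finally show ?case .
qed simp

lemma maker_view_maker_move: "length (maker_view (maker_move \<sigma> h)) = Suc (length (maker_view h))"
  by (simp add: maker_move_def Let_def maker_view_append)

lemma attempts_within_round:
  assumes "i < a" "length (maker_view h) mod a = 0"
  shows "(follow a \<sigma> \<tau> ^^ i) h = (maker_move \<sigma> ^^ i) h \<and>
    length (maker_view ((maker_move \<sigma> ^^ i) h)) = length (maker_view h) + i"
  using assms(1)
proof (induction i)
  case (Suc i)
  let ?h = "(maker_move \<sigma> ^^ i) h"
  have IH: "(follow a \<sigma> \<tau> ^^ i) h = ?h"
    "length (maker_view ?h) = length (maker_view h) + i" using Suc by auto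
  have "Suc (length (maker_view h) + i) mod a = Suc i mod a"
    using assms(2) by (metis add_Suc_right mod_add_left_eq add_0)
  then have "Suc (length (maker_view h) + i) mod a \<noteq> 0" using Suc.prems by simp
  then have "follow a \<sigma> \<tau> ?h = maker_move \<sigma> ?h"
    by (simp add: follow_def attempt_def Let_def maker_view_append maker_move_def IH(2))
  then show ?case using IH by (simp add: maker_view_maker_move)
qed simp

lemma attempts_round:
  assumes "a > 0" "length (maker_view h) mod a = 0"
  shows "(follow a \<sigma> \<tau> ^^ a) h = game_round a \<sigma> \<tau> h \<and>
    length (maker_view (game_round a \<sigma> \<tau> h)) = length (maker_view h) + a"
proof -
  obtain i where a: "a = Suc i" using assms(1) gr0_conv_Suc by blast
  let ?h = "(maker_move \<sigma> ^^ i) h"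
  have IH: "(follow a \<sigma> \<tau> ^^ i) h = ?h"
    "length (maker_view ?h) = length (maker_view h) + i"
    using attempts_within_round[of i a h \<sigma> \<tau>] assms a by auto
  have "Suc (length (maker_view h) + i) mod a = 0"
    using assms(2) unfolding a by (metis add_Suc_right mod_add_self2)
  then have "follow a \<sigma> \<tau> ?h = breaker_turn \<tau> (maker_move \<sigma> ?h)"
    by (simp add: follow_def attempt_def Let_def maker_view_append maker_move_def IH(2))
  then show ?thesis using IH
    by (simp add: a game_round_def breaker_turn_def maker_view_append maker_view_maker_move)
qed

lemma attempts_play_after:
  assumes "a > 0"
  shows "(follow a \<sigma> \<tau> ^^ (a * r)) [] = play_after a \<sigma> \<tau> r \<and>
    length (maker_view (play_after a \<sigma> \<tau> r)) mod a = 0"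
proof (induction r)
  case (Suc r)
  have "a * Suc r = a + a * r" by simp
  then show ?case
    using Suc attempts_round[OF assms, of "play_after a \<sigma> \<tau> r" \<sigma> \<tau>]
    by (simp only: funpow_add o_apply) (simp add: play_after_def)
qed (simp add: play_after_def)

lemma maker_elems_attempt:
  "maker_elems (attempt a \<tau> e h) = maker_elems h \<union> (if e \<in> breaker_elems h then {} else {e})"
  by (auto simp: attempt_def Let_def breaker_turn_def maker_elems_def)

lemma maker_elems_funpow_mono:
  "i \<le> j \<Longrightarrow> maker_elems ((follow a \<sigma> \<tau> ^^ i) h)
     \<subseteq> maker_elems ((follow a \<sigma> \<tau> ^^ j) h)"
  by (rule lift_Suc_mono_le[where f = "\<lambda>i. maker_elems ((follow a \<sigma> \<tau> ^^ i) h)"])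
    (auto simp: follow_def maker_elems_attempt)

lemma breaker_elems_append: "breaker_elems (h @ h') = breaker_elems h \<union> breaker_elems h'"
  by (auto simp: breaker_elems_def)

lemma breaker_elems_attempt:
  "breaker_elems (attempt a \<tau> e h) = breaker_elems h \<union>
     (if Suc (length (maker_view h)) mod a = 0 then \<tau> (h @ [Attempt e (e \<notin> breaker_elems h)]) else {})"
  by (auto simp: attempt_def Let_def breaker_turn_def breaker_elems_append maker_view_append)
    (auto simp: breaker_elems_def)

definition achieved :: "'e set set \<Rightarrow> 'e play \<Rightarrow> bool" where
  "achieved \<W> h \<longleftrightarrow> (\<exists>W\<in>\<W>. W \<subseteq> maker_elems h)"

lemma achieved_run: "achieved \<W> h \<Longrightarrow> achieved \<W> (run a \<tau> T \<sigma> h)"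
proof (induction T arbitrary: \<sigma> h)
  case (Suc T)
  have "achieved \<W> (attempt a \<tau> (\<sigma> []) h)"
    using Suc.prems by (auto simp: achieved_def maker_elems_attempt)
  then show ?case using Suc.IH by simp
qed simp

text \<open>Wins are registered at ends of rounds only. Maker loses nothing by playing on, and after
  \<open>a * T\<close> attempts a round ends.\<close>

lemma achieved_run_maker_wins:
  assumes "a > 0" "achieved \<W> (run a \<tau> T \<sigma> [])"
  shows "maker_wins \<W> a \<sigma> \<tau>"
proof -
  have r: "run a \<tau> T \<sigma> [] = (follow a \<sigma> \<tau> ^^ T) []"
    using run_eq_funpow[of a \<tau> T \<sigma> "[]"] by simp
  have "T \<le> a * T" using assms(1) by simp
  then have "maker_elems (run a \<tau> T \<sigma> []) \<subseteq> maker_elems (play_after a \<sigma> \<tau> T)"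
    unfolding r using maker_elems_funpow_mono[where i = T and j = "a * T" and a = a and \<sigma> = \<sigma> and \<tau> = \<tau> and h = "[]"]
      attempts_play_after[OF assms(1), where \<sigma> = \<sigma> and \<tau> = \<tau> and r = T] by simp
  then show ?thesis using assms(2) unfolding achieved_def maker_wins_def by (meson order_trans)
qed

section \<open>Success probability and its one-step analysis\<close>

definition success_prob where
  "success_prob \<W> a \<tau> \<beta> d T h s =
     measure_pmf.prob (unfold_behaviour \<beta> d T s) {\<sigma>. achieved \<W> (run a \<tau> T \<sigma> h)}"

lemma success_prob_nonneg: "0 \<le> success_prob \<W> a \<tau> \<beta> d T h s"
  by (simp add: success_prob_def)

lemma success_prob_achieved: "achieved \<W> h \<Longrightarrow> success_prob \<W> a \<tau> \<beta> d T h s = 1"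
  by (simp add: success_prob_def achieved_run)

text \<open>Against a deterministic PhantomBreaker the play decides whether the attempt
  \<open>e\<close> succeeds; the subtree of \<open>decide\<close> for the other outcome integrates
  out.\<close>

lemma success_prob_Suc:
  fixes \<beta> :: "('e, 's) behaviour"
  shows "success_prob \<W> a \<tau> \<beta> d (Suc T) h s = measure_pmf.expectation (\<beta> s)
     (\<lambda>(e, f). success_prob \<W> a \<tau> \<beta> d T (attempt a \<tau> e h) (f (e \<notin> breaker_elems h)))"
proof -
  have *: "measure_pmf.prob (map_pmf (\<lambda>(\<sigma>1, \<sigma>0). decide e \<sigma>1 \<sigma>0) (pair_pmf p1 p0))
      {\<sigma>. achieved \<W> (run a \<tau> (Suc T) \<sigma> h)} =
    measure_pmf.prob (if e \<in> breaker_elems h then p0 else p1)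
      {\<sigma>. achieved \<W> (run a \<tau> T \<sigma> (attempt a \<tau> e h))}" for e and p1 p0 :: "'e maker_strategy pmf"
  proof (cases "e \<in> breaker_elems h")
    case True
    have "measure_pmf.prob (map_pmf (\<lambda>(\<sigma>1, \<sigma>0). decide e \<sigma>1 \<sigma>0) (pair_pmf p1 p0))
        {\<sigma>. achieved \<W> (run a \<tau> (Suc T) \<sigma> h)} =
      measure_pmf.prob (map_pmf snd (pair_pmf p1 p0)) {\<sigma>. achieved \<W> (run a \<tau> T \<sigma> (attempt a \<tau> e h))}"
      using True by (simp add: measure_map_pmf decide_def vimage_def case_prod_unfold)
    then show ?thesis using True by (simp add: map_snd_pair_pmf)
  next
    case False
    have "measure_pmf.prob (map_pmf (\<lambda>(\<sigma>1, \<sigma>0). decide e \<sigma>1 \<sigma>0) (pair_pmf p1 p0))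
        {\<sigma>. achieved \<W> (run a \<tau> (Suc T) \<sigma> h)} =
      measure_pmf.prob (map_pmf fst (pair_pmf p1 p0)) {\<sigma>. achieved \<W> (run a \<tau> T \<sigma> (attempt a \<tau> e h))}"
      using False by (simp add: measure_map_pmf decide_def vimage_def case_prod_unfold)
    then show ?thesis using False by (simp add: map_fst_pair_pmf)
  qed
  show ?thesis unfolding success_prob_def unfold_behaviour.simps measure_bind_pmf
  proof (intro Bochner_Integration.integral_cong refl)
    fix p :: "'e \<times> (bool \<Rightarrow> 's)"
    obtain e f where p: "p = (e, f)" by (cases p)
    show "measure_pmf.prob (case p of (e, f) \<Rightarrow> map_pmf (\<lambda>(\<sigma>1, \<sigma>0). decide e \<sigma>1 \<sigma>0)
        (pair_pmf (unfold_behaviour \<beta> d T (f True)) (unfold_behaviour \<beta> d T (f False))))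
        {\<sigma>. achieved \<W> (run a \<tau> (Suc T) \<sigma> h)} =
      (case p of (e, f) \<Rightarrow> measure_pmf.prob (unfold_behaviour \<beta> d T (f (e \<notin> breaker_elems h)))
        {\<sigma>. achieved \<W> (run a \<tau> T \<sigma> (attempt a \<tau> e h))})"
      unfolding p prod.case * by (cases "e \<in> breaker_elems h") simp_all
  qed
qed

lemma success_prob_average:
  assumes "\<beta> s = map_pmf (\<lambda>i. (e i, f i)) (pmf_of_set I)" "finite I" "I \<noteq> {}"
  shows "success_prob \<W> a \<tau> \<beta> d (Suc T) h s =
    (\<Sum>i\<in>I. success_prob \<W> a \<tau> \<beta> d T (attempt a \<tau> (e i) h) (f i (e i \<notin> breaker_elems h))) / card I"
  unfolding success_prob_Suc assms(1) using assms(2,3) by (simp add: integral_pmf_of_set)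

text \<open>The players randomize independently, so the winning probability is an average over
  PhantomBreaker's deterministic strategies, and a bound against each of these suffices.\<close>

lemma maker_achievesI:
  assumes "a > 0" "d \<in> X" "\<And>s e f. (e, f) \<in> set_pmf (\<beta> s) \<Longrightarrow> e \<in> X"
    "\<And>\<tau>. legal_breaker X b \<tau> \<Longrightarrow> success_prob \<W> a \<tau> \<beta> d T [] s \<ge> p"
  shows "maker_achieves X \<W> a b p"
  unfolding maker_achieves_def
proof (intro exI conjI allI impI)
  let ?\<mu> = "unfold_behaviour \<beta> d T s"
  show "randomized_maker X ?\<mu>"
    unfolding randomized_maker_def using legal_unfold[of d X \<beta>] assms(2,3) by blast
  fix \<nu> assume \<nu>: "randomized_breaker X b \<nu>"
  have "pair_pmf ?\<mu> \<nu> = bind_pmf \<nu> (\<lambda>\<tau>. map_pmf (\<lambda>\<sigma>. (\<sigma>, \<tau>)) ?\<mu>)"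
    unfolding pair_pmf_def map_pmf_def by (rule bind_commute_pmf)
  then have "win_prob \<W> a ?\<mu> \<nu> =
      measure_pmf.expectation \<nu> (\<lambda>\<tau>. measure_pmf.prob ?\<mu> {\<sigma>. maker_wins \<W> a \<sigma> \<tau>})"
    unfolding win_prob_def by (simp add: measure_bind_pmf measure_map_pmf vimage_def)
  also have "\<dots> \<ge> measure_pmf.expectation \<nu> (\<lambda>\<tau>. p)"
  proof (rule integral_mono_AE)
    show "integrable \<nu> (\<lambda>\<tau>. measure_pmf.prob ?\<mu> {\<sigma>. maker_wins \<W> a \<sigma> \<tau>})"
      by (rule measure_pmf.integrable_const_bound[where B=1]) auto
    show "AE \<tau> in \<nu>. p \<le> measure_pmf.prob ?\<mu> {\<sigma>. maker_wins \<W> a \<sigma> \<tau>}"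
    proof (rule AE_pmfI)
      fix \<tau> assume "\<tau> \<in> set_pmf \<nu>"
      then have "p \<le> success_prob \<W> a \<tau> \<beta> d T [] s"
        using \<nu> assms(4) by (auto simp: randomized_breaker_def)
      also have "\<dots> \<le> measure_pmf.prob ?\<mu> {\<sigma>. maker_wins \<W> a \<sigma> \<tau>}"
        unfolding success_prob_def
        by (rule measure_pmf.finite_measure_mono) (auto intro: achieved_run_maker_wins[OF assms(1)])
      finally show "p \<le> measure_pmf.prob ?\<mu> {\<sigma>. maker_wins \<W> a \<sigma> \<tau>}" .
    qed
  qed simp
  finally show "win_prob \<W> a ?\<mu> \<nu> \<ge> p" by simp
qed

text \<open>After \<open>t\<close> attempts PhantomBreaker has had \<open>t div a\<close> turns of
  at most \<open>b\<close> edges, and at most one turn follows a single attempt.\<close>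

lemma breaker_elems_attempt_bounds:
  assumes "legal_breaker X b \<tau>" "finite X" "a > 0"
    "breaker_elems h \<subseteq> X" "card (breaker_elems h) \<le> b * (length (maker_view h) div a)"
  shows "breaker_elems h \<subseteq> breaker_elems (attempt a \<tau> e h)"
    "breaker_elems (attempt a \<tau> e h) \<subseteq> X"
    "card (breaker_elems (attempt a \<tau> e h) - breaker_elems h) \<le> b"
    "card (breaker_elems (attempt a \<tau> e h)) \<le> b * (length (maker_view (attempt a \<tau> e h)) div a)"
proof -
  let ?F = "\<tau> (h @ [Attempt e (e \<notin> breaker_elems h)])" and ?t = "length (maker_view h)"
  have F: "?F \<subseteq> X" "card ?F \<le> b"
    using assms(1) by (auto simp: legal_breaker_def unclaimed_def)
  then have finF: "finite ?F" using assms(2) finite_subset by blast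
  show "breaker_elems h \<subseteq> breaker_elems (attempt a \<tau> e h)" "breaker_elems (attempt a \<tau> e h) \<subseteq> X"
    using F assms(4) by (auto simp: breaker_elems_attempt)
  have "card (?F - breaker_elems h) \<le> b" using F finF card_mono[of ?F "?F - breaker_elems h"] by simp
  then show "card (breaker_elems (attempt a \<tau> e h) - breaker_elems h) \<le> b"
    by (simp add: breaker_elems_attempt Un_Diff)
  have t: "length (maker_view (attempt a \<tau> e h)) = Suc ?t" by (simp add: maker_view_attempt)
  show "card (breaker_elems (attempt a \<tau> e h)) \<le> b * (length (maker_view (attempt a \<tau> e h)) div a)"
  proof (cases "Suc ?t mod a = 0")
    case True
    then have "Suc ?t div a = Suc (?t div a)" using assms(3) by (simp add: div_Suc)
    moreover have "card (breaker_elems h \<union> ?F) \<le> card (breaker_elems h) + card ?F"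
      by (rule card_Un_le)
    ultimately show ?thesis using True F assms(5) t by (simp add: breaker_elems_attempt)
  next
    case False
    then have "Suc ?t div a = ?t div a" by (simp add: div_Suc)
    then show ?thesis using False assms(5) t by (simp add: breaker_elems_attempt)
  qed
qed

section \<open>Degrees in PhantomBreaker's graph\<close>

definition deg :: "'a set set \<Rightarrow> 'a \<Rightarrow> nat" where
  "deg B v = card {e \<in> B. v \<in> e}"

lemma deg_mono: "finite B' \<Longrightarrow> B \<subseteq> B' \<Longrightarrow> deg B v \<le> deg B' v"
  unfolding deg_def by (rule card_mono) auto

lemma deg_le_card: "finite B \<Longrightarrow> deg B v \<le> card B"
  unfolding deg_def by (rule card_mono) auto

lemma deg_extend:
  assumes "finite B'" "B \<subseteq> B'"
  shows "deg B' v = deg B v + deg (B' - B) v"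
proof -
  have "{e \<in> B'. v \<in> e} = {e \<in> B. v \<in> e} \<union> {e \<in> B' - B. v \<in> e}" using assms(2) by auto
  then show ?thesis unfolding deg_def
    using assms by (simp add: card_Un_disjoint finite_subset disjoint_iff)
qed

lemma finite_complete_edges [simp]: "finite (complete_edges n)"
  by (rule finite_subset[of _ "Pow {..<n}"]) (auto simp: complete_edges_def)

lemma sum_deg:
  assumes "B \<subseteq> complete_edges n"
  shows "(\<Sum>v<n. deg B v) = 2 * card B"
proof -
  have fin: "finite B" by (rule finite_subset[OF assms finite_complete_edges])
  have "(\<Sum>v<n. deg B v) = (\<Sum>v<n. \<Sum>e\<in>B. if v \<in> e then 1 else 0)"
    by (simp only: deg_def card_eq_sum sum.inter_filter[OF fin])
  also have "\<dots> = (\<Sum>e\<in>B. \<Sum>v<n. if v \<in> e then 1 else 0)" by (rule sum.swap)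
  also have "\<dots> = (\<Sum>e\<in>B. 2)"
  proof (rule sum.cong)
    fix e assume "e \<in> B"
    then have e: "e \<subseteq> {..<n}" "card e = 2" using assms by (auto simp: complete_edges_def)
    have "(\<Sum>v<n. if v \<in> e then 1 else 0) = card {v \<in> {..<n}. v \<in> e}"
      by (simp only: card_eq_sum sum.inter_filter[OF finite_lessThan])
    also have "{v \<in> {..<n}. v \<in> e} = e" using e by auto
    finally show "(\<Sum>v<n. if v \<in> e then 1 else 0) = (2::nat)" using e by simp
  qed simp
  finally show ?thesis by simp
qed

lemma card_blocked_le_deg:
  assumes "inj_on f A" "finite B"
  shows "card {j \<in> A. {u, f j} \<in> B} \<le> deg B u"
  unfolding deg_def
proof (rule card_inj_on_le[where f = "\<lambda>j. {u, f j}"])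
  show "inj_on (\<lambda>j. {u, f j}) {j \<in> A. {u, f j} \<in> B}"
    using assms(1) by (auto simp: inj_on_def doubleton_eq_iff)
qed (use assms in auto)

text \<open>A vertex between two missing edges counts twice: it is an end of each of them and can be
  picked for either.\<close>

definition wdeg :: "'a set set \<Rightarrow> 'a set set \<Rightarrow> real" where
  "wdeg B Ms = (\<Sum>e\<in>Ms. \<Sum>x\<in>e. real (deg B x))"

lemma wdeg_nonneg [simp]: "wdeg B Ms \<ge> 0"
  by (simp add: wdeg_def sum_nonneg)

lemma wdeg_extend:
  assumes "finite B'" "B \<subseteq> B'"
  shows "wdeg B' Ms = wdeg B Ms + wdeg (B' - B) Ms"
  by (simp add: wdeg_def deg_extend[OF assms] sum.distrib)

lemma wdeg_ge_deg:
  assumes "finite Ms" "e \<in> Ms" "finite e" "x \<in> e"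
  shows "real (deg B x) \<le> wdeg B Ms"
proof -
  have "real (deg B x) \<le> (\<Sum>x\<in>e. real (deg B x))"
    using assms by (intro member_le_sum) auto
  also have "\<dots> \<le> wdeg B Ms" unfolding wdeg_def
    using assms by (intro member_le_sum[of e Ms "\<lambda>e. \<Sum>x\<in>e. real (deg B x)"]) (auto intro: sum_nonneg)
  finally show ?thesis .
qed

section \<open>Maker's strategy\<close>

text \<open>Maker maintains a cyclic order \<open>ys\<close> of the vertices and a set \<open>Ms\<close> of edges of this virtual
  cycle such that she owns all other edges of the cycle.
  In \<open>Pick c ys Ms\<close> she still has to close \<open>c\<close> missing edges by joining ends of two random missing edges.
  In \<open>Pend c zs Ms\<close> such an attempt has failed, and she attempts random edges at the vertex
  \<open>last zs\<close> of the failed attempt until she succeeds.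
  In \<open>Fix zs Ms J L\<close> she closes the missing edge \<open>{last zs, hd zs}\<close>; she owns the edges joining
  \<open>last zs\<close> to the positions in \<open>J\<close> and \<open>hd zs\<close> to the positions in \<open>L\<close>.\<close>

datatype memory =
    Pick nat "nat list" "nat set set"
  | Pend nat "nat list" "nat set set"
  | Fix "nat list" "nat set set" "nat set" "nat set"

definition arcs :: "'a set set \<Rightarrow> ('a \<times> 'a) set" where
  "arcs Ms = {(u, h). {u, h} \<in> Ms}"

definition flip_missing :: "'a list \<Rightarrow> nat \<Rightarrow> 'a set set \<Rightarrow> 'a set set" where
  "flip_missing zs j Ms =
     insert {hd zs, zs ! Suc j} (Ms - {{last zs, hd zs}, {zs ! j, zs ! Suc j}})"

text \<open>With no missing edge the state is a dummy, since Maker has already won.\<close>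

definition start_fix :: "nat list \<Rightarrow> nat set set \<Rightarrow> memory" where
  "start_fix ys Ms = (if Ms = {} then Fix ys Ms {} {} else
     let p = (SOME p. p \<in> arcs Ms) in Fix (cut_at ys (fst p) (snd p)) Ms {} {})"

definition resume :: "nat \<Rightarrow> nat list \<Rightarrow> nat set set \<Rightarrow> memory" where
  "resume c ys Ms = (if c = 0 then start_fix ys Ms else Pick c ys Ms)"

definition missing_pos :: "'a list \<Rightarrow> 'a set set \<Rightarrow> nat set" where
  "missing_pos zs Ms = {j. Suc j < length zs \<and> {zs ! j, zs ! Suc j} \<in> Ms}"

lemma finite_missing_pos [simp]: "finite (missing_pos zs Ms)"
  by (rule finite_subset[of _ "{..<length zs}"]) (auto simp: missing_pos_def)

definition pick_choices :: "'a list \<Rightarrow> 'a set set \<Rightarrow> (('a \<times> 'a) \<times> nat) set" where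
  "pick_choices ys Ms = (SIGMA p:arcs Ms. missing_pos (cut_at ys (fst p) (snd p)) Ms)"

text \<open>A behaviour must name an edge of the board in every memory state, also in states that
  never occur. For the pairs that do occur \<open>clip_eq\<close> removes the wrapper.\<close>

definition clip :: "nat \<Rightarrow> nat set \<Rightarrow> nat set" where
  "clip n e = (if e \<in> complete_edges n then e else {0, 1})"

text \<open>\<open>c\<close> counts the successful picks still to be made. A rotation from
  \<open>Pend\<close> keeps it, as it repairs an end without being one of these picks.\<close>

definition attempt_flip :: "nat \<Rightarrow> nat \<Rightarrow> nat \<Rightarrow> nat list \<Rightarrow> nat set set \<Rightarrow> nat \<Rightarrow> bool \<Rightarrow> memory" where
  "attempt_flip n c c' zs Ms j ok =
     (if ok then resume c' (two_opt j zs) (flip_missing zs j Ms) else Pend c zs Ms)"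

text \<open>In \<open>Pend\<close>, \<open>last zs\<close> has position \<open>n - 1\<close> and its
  path neighbour position \<open>n - 2\<close>, hence the range. In \<open>Fix\<close>,
  \<open>J\<close> lies in the upper and \<open>L\<close> in the lower half of the positions: then
  each pair has the order \<open>l \<le> j\<close> required by \<open>three_opt\<close>, and
  different pairs lead to different closing edges.\<close>

fun hamilton_step :: "nat \<Rightarrow> nat \<Rightarrow> (nat set, memory) behaviour" where
  "hamilton_step n s (Pick c ys Ms) =
     map_pmf (\<lambda>i. (clip n {fst (fst i), cut_at ys (fst (fst i)) (snd (fst i)) ! snd i},
         attempt_flip n c (c - 1) (cut_at ys (fst (fst i)) (snd (fst i))) Ms (snd i)))
       (pmf_of_set (pick_choices ys Ms))"
| "hamilton_step n s (Pend c zs Ms) =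
     map_pmf (\<lambda>j. (clip n {last zs, zs ! j}, attempt_flip n c c zs Ms j)) (pmf_of_set {..<n - 2})"
| "hamilton_step n s (Fix zs Ms J L) =
     (if card J < s then
        map_pmf (\<lambda>j. (clip n {last zs, zs ! j}, \<lambda>ok. Fix zs Ms (if ok then insert j J else J) L))
          (pmf_of_set {n div 2..<n - 1})
      else if card L < s then
        map_pmf (\<lambda>l. (clip n {hd zs, zs ! l}, \<lambda>ok. Fix zs Ms J (if ok then insert l L else L)))
          (pmf_of_set {1..<n div 2})
      else
        map_pmf (\<lambda>i. (clip n {zs ! (snd i - 1), zs ! Suc (fst i)},
            \<lambda>ok. if ok then start_fix (three_opt (snd i) (fst i) zs)
                (Ms - {{last zs, hd zs}, {zs ! (snd i - 1), zs ! snd i}, {zs ! fst i, zs ! Suc (fst i)}})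
              else Fix zs Ms {} {}))
          (pmf_of_set (J \<times> L)))"

lemma hamilton_step_legal:
  "n \<ge> 2 \<Longrightarrow> (e, f) \<in> set_pmf (hamilton_step n s st) \<Longrightarrow> e \<in> complete_edges n"
  by (cases st) (auto simp: clip_def complete_edges_def split: if_splits)

section \<open>The invariant of the virtual cycle and the count of random choices\<close>

definition valid :: "nat \<Rightarrow> nat set play \<Rightarrow> nat list \<Rightarrow> nat set set \<Rightarrow> bool" where
  "valid n h zs Ms \<longleftrightarrow> distinct zs \<and> set zs = {..<n} \<and> Ms \<subseteq> set (cycle_edges zs) \<and>
     set (cycle_edges zs) - Ms \<subseteq> maker_elems h"

lemma valid_length: "valid n h zs Ms \<Longrightarrow> length zs = n"
  unfolding valid_def using distinct_card by fastforce

lemma valid_finite: "valid n h zs Ms \<Longrightarrow> finite Ms"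
  unfolding valid_def using finite_subset by blast

lemma valid_mono: "valid n h zs Ms \<Longrightarrow> maker_elems h \<subseteq> maker_elems h' \<Longrightarrow> valid n h' zs Ms"
  by (auto simp: valid_def)

lemma valid_card2:
  assumes "valid n h zs Ms" "n \<ge> 3" "e \<in> Ms"
  shows "e \<subseteq> {..<n}" "card e = 2" "finite e" "e \<in> complete_edges n"
proof -
  have "e \<subseteq> set zs \<and> card e = 2" using assms valid_length[OF assms(1)]
    by (intro cycle_edge_card2) (auto simp: valid_def)
  then show "e \<subseteq> {..<n}" "card e = 2" "finite e" "e \<in> complete_edges n"
    using assms(1) finite_subset[of e] by (auto simp: valid_def complete_edges_def)
qed

text \<open>Each vertex lies on two cycle edges, so \<open>wdeg\<close> is at most twice the degree
  sum, which is itself \<open>2 * card B\<close>.\<close>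

lemma wdeg_le_card:
  assumes "valid n h zs Ms" "n \<ge> 3" "B \<subseteq> complete_edges n"
  shows "wdeg B Ms \<le> 4 * real (card B)"
proof -
  have len: "length zs = n" by (rule valid_length[OF assms(1)])
  have "wdeg B Ms \<le> (\<Sum>e\<in>set (cycle_edges zs). \<Sum>x\<in>e. real (deg B x))"
    unfolding wdeg_def using assms(1) by (intro sum_mono2) (auto simp: valid_def sum_nonneg)
  also have "\<dots> = 2 * (\<Sum>x<n. real (deg B x))"
    using assms len by (subst sum_cycle_edges) (auto simp: valid_def)
  also have "(\<Sum>x<n. real (deg B x)) = real (\<Sum>x<n. deg B x)" by simp
  also have "\<dots> = 2 * real (card B)" unfolding sum_deg[OF assms(3)] by simp
  finally show ?thesis by simp
qed

lemma valid_cut_at: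
  assumes "valid n h ys Ms" "n \<ge> 3" "p \<in> arcs Ms"
  shows "valid n h (cut_at ys (fst p) (snd p)) Ms"
    "last (cut_at ys (fst p) (snd p)) = fst p" "hd (cut_at ys (fst p) (snd p)) = snd p"
    "{fst p, snd p} \<in> Ms"
proof -
  have p: "{fst p, snd p} \<in> Ms" using assms(3) by (auto simp: arcs_def)
  have len: "length ys = n" by (rule valid_length[OF assms(1)])
  have "{fst p, snd p} \<in> set (cycle_edges ys)" using assms(1) p by (auto simp: valid_def)
  note c = cut_at[OF _ _ this]
  show "valid n h (cut_at ys (fst p) (snd p)) Ms"
    "last (cut_at ys (fst p) (snd p)) = fst p" "hd (cut_at ys (fst p) (snd p)) = snd p"
    "{fst p, snd p} \<in> Ms"
    using c assms len p by (auto simp: valid_def)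
qed

text \<open>Orienting a missing edge amounts to choosing its tail: \<open>(u, h)\<close> corresponds
  to the incidence of \<open>u\<close> with \<open>{u, h}\<close>.\<close>

lemma arcs_sum:
  fixes f :: "'a \<Rightarrow> 'b::comm_monoid_add"
  assumes "finite Ms" "\<And>e. e \<in> Ms \<Longrightarrow> card e = 2"
  shows "(\<Sum>p\<in>arcs Ms. f (fst p)) = (\<Sum>e\<in>Ms. \<Sum>x\<in>e. f x)" "finite (arcs Ms)"
proof -
  have fin: "\<forall>e\<in>Ms. finite e" using assms(2) by (metis card.infinite zero_neq_numeral)
  have other: "e = {x, the_elem (e - {x})}" if ex: "e \<in> Ms" "x \<in> e" for e x
  proof -
    obtain v w where vw: "e = {v, w}" "v \<noteq> w" using assms(2)[OF ex(1)] unfolding card_2_iff by blast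
    then consider "x = v" | "x = w" using ex(2) by blast
    then show ?thesis by cases (use vw in \<open>simp_all add: insert_Diff_if insert_commute\<close>)
  qed
  have bij: "bij_betw (\<lambda>p. ({fst p, snd p}, fst p)) (arcs Ms) (SIGMA e:Ms. e)"
    unfolding bij_betw_def
  proof
    show "inj_on (\<lambda>p. ({fst p, snd p}, fst p)) (arcs Ms)"
      by (rule inj_onI) (auto simp: prod_eq_iff doubleton_eq_iff)
    show "(\<lambda>p. ({fst p, snd p}, fst p)) ` arcs Ms = (SIGMA e:Ms. e)" (is "?l = ?r")
    proof
      show "?l \<subseteq> ?r" by (auto simp: arcs_def)
      show "?r \<subseteq> ?l"
      proof (clarify)
        fix e x assume ex: "e \<in> Ms" "x \<in> e"
        have "(x, the_elem (e - {x})) \<in> arcs Ms" using other[OF ex] ex(1) by (simp add: arcs_def)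
        then show "(e, x) \<in> ?l" using other[OF ex] by (intro image_eqI[of _ _ "(x, the_elem (e - {x}))"]) simp_all
      qed
    qed
  qed
  have "finite (SIGMA e:Ms. e)" using assms(1) fin by blast
  then show "finite (arcs Ms)" using bij_betw_finite[OF bij] by simp
  have "(\<Sum>e\<in>Ms. \<Sum>x\<in>e. f x) = (\<Sum>q\<in>(SIGMA e:Ms. e). f (snd q))"
    using assms(1) fin by (simp add: sum.Sigma case_prod_unfold)
  also have "\<dots> = (\<Sum>p\<in>arcs Ms. f (fst p))"
    using sum.reindex_bij_betw[OF bij, of "\<lambda>q. f (snd q)"] by simp
  finally show "(\<Sum>p\<in>arcs Ms. f (fst p)) = (\<Sum>e\<in>Ms. \<Sum>x\<in>e. f x)" by simp
qed

lemma card_arcs: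
  assumes "finite Ms" "\<And>e. e \<in> Ms \<Longrightarrow> card e = 2"
  shows "card (arcs Ms) = 2 * card Ms"
  using arcs_sum(1)[OF assms, of "\<lambda>_. 1::nat"] assms(2) by simp

lemma card_missing_pos:
  assumes "valid n h zs Ms" "n \<ge> 3" "{last zs, hd zs} \<in> Ms"
  shows "card (missing_pos zs Ms) = card Ms - 1"
proof -
  have len: "length zs = n" by (rule valid_length[OF assms(1)])
  have dist: "distinct (cycle_edges zs)" using assms len by (intro distinct_cycle_edges) (auto simp: valid_def)
  have "bij_betw (\<lambda>j. {zs ! j, zs ! Suc j}) (missing_pos zs Ms) (Ms - {{last zs, hd zs}})"
    unfolding bij_betw_def
  proof
    have "distinct (path_edges zs)" using dist by (simp add: cycle_edges_def)
    then show "inj_on (\<lambda>j. {zs ! j, zs ! Suc j}) (missing_pos zs Ms)"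
      unfolding inj_on_def missing_pos_def
      by (auto simp: nth_eq_iff_index_eq simp flip: nth_path_edges)
    show "(\<lambda>j. {zs ! j, zs ! Suc j}) ` missing_pos zs Ms = Ms - {{last zs, hd zs}}"
      using dist assms(1) by (auto simp: missing_pos_def cycle_edges_def set_path_edges valid_def)
  qed
  then have "card (missing_pos zs Ms) = card (Ms - {{last zs, hd zs}})" by (rule bij_betw_same_card)
  then show ?thesis using assms valid_finite[OF assms(1)] by simp
qed

text \<open>The number of possible second edges is the same for every arc. Hence a uniform choice
  has each end of a missing edge as its tail with the same probability 1 / (2 k), where k =
  \<open>card Ms\<close>.\<close>

lemma pick_choices_facts:
  assumes "valid n h ys Ms" "n \<ge> 3"
  shows "finite (pick_choices ys Ms)" "card (pick_choices ys Ms) = 2 * card Ms * (card Ms - 1)"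
    "(\<Sum>i\<in>pick_choices ys Ms. f (fst (fst i))) = real (card Ms - 1) * (\<Sum>e\<in>Ms. \<Sum>x\<in>e. f x)"
proof -
  note fM = valid_finite[OF assms(1)]
  note A = arcs_sum[OF fM valid_card2(2)[OF assms]] card_arcs[OF fM valid_card2(2)[OF assms]]
  have P: "card (missing_pos (cut_at ys (fst p) (snd p)) Ms) = card Ms - 1" if "p \<in> arcs Ms" for p
    using card_missing_pos[of n h "cut_at ys (fst p) (snd p)" Ms] valid_cut_at[OF assms that] assms(2)
    by auto
  show "finite (pick_choices ys Ms)" unfolding pick_choices_def using A P by auto
  show "card (pick_choices ys Ms) = 2 * card Ms * (card Ms - 1)"
    unfolding pick_choices_def using A P by (subst card_SigmaI) auto
  have "(\<Sum>i\<in>pick_choices ys Ms. f (fst (fst i))) =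
     (\<Sum>p\<in>arcs Ms. \<Sum>j\<in>missing_pos (cut_at ys (fst p) (snd p)) Ms. f (fst p))"
    unfolding pick_choices_def using A P by (subst sum.Sigma) (auto simp: case_prod_unfold)
  also have "\<dots> = (\<Sum>p\<in>arcs Ms. real (card Ms - 1) * f (fst p))"
    using P by (intro sum.cong) auto
  also have "\<dots> = real (card Ms - 1) * (\<Sum>p\<in>arcs Ms. f (fst p))"
    by (rule sum_distrib_left[symmetric])
  also have "(\<Sum>p\<in>arcs Ms. f (fst p)) = (\<Sum>e\<in>Ms. \<Sum>x\<in>e. f x)" by (rule A(1))
  finally show "(\<Sum>i\<in>pick_choices ys Ms. f (fst (fst i))) = real (card Ms - 1) * (\<Sum>e\<in>Ms. \<Sum>x\<in>e. f x)" .
qed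

text \<open>For a fixed tail \<open>u\<close>, different positions give different edges at
  \<open>u\<close>, so at most \<open>deg B u\<close> positions are blocked.\<close>

lemma card_pick_blocked:
  assumes "valid n h ys Ms" "n \<ge> 3" "finite B"
  shows "real (card {i \<in> pick_choices ys Ms. {fst (fst i), cut_at ys (fst (fst i)) (snd (fst i)) ! snd i} \<in> B})
    \<le> wdeg B Ms"
proof -
  note fM = valid_finite[OF assms(1)]
  note A = arcs_sum[OF fM valid_card2(2)[OF assms(1,2)]]
  let ?z = "\<lambda>p. cut_at ys (fst p) (snd p)"
  have "{i \<in> pick_choices ys Ms. {fst (fst i), ?z (fst i) ! snd i} \<in> B} =
    (SIGMA p:arcs Ms. {j \<in> missing_pos (?z p) Ms. {fst p, ?z p ! j} \<in> B})"
    by (auto simp: pick_choices_def)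
  also have "card \<dots> = (\<Sum>p\<in>arcs Ms. card {j \<in> missing_pos (?z p) Ms. {fst p, ?z p ! j} \<in> B})"
    using A by (intro card_SigmaI) auto
  also have "\<dots> \<le> (\<Sum>p\<in>arcs Ms. deg B (fst p))"
  proof (intro sum_mono card_blocked_le_deg assms)
    fix p assume "p \<in> arcs Ms"
    then have "distinct (?z p)" using valid_cut_at[OF assms(1,2)] by (auto simp: valid_def)
    then show "inj_on ((!) (?z p)) (missing_pos (?z p) Ms)"
      by (auto simp: inj_on_def missing_pos_def nth_eq_iff_index_eq)
  qed
  finally have "real (card {i \<in> pick_choices ys Ms. {fst (fst i), ?z (fst i) ! snd i} \<in> B})
    \<le> real (\<Sum>p\<in>arcs Ms. deg B (fst p))" by linarith
  also have "\<dots> = wdeg B Ms"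
    using A(1)[of "\<lambda>x. real (deg B x)"] by (simp add: wdeg_def)
  finally show ?thesis .
qed

text \<open>At a missing position two missing edges merge, and \<open>last zs\<close> and
  \<open>zs ! j\<close> cease to be ends. At any other position the end \<open>last zs\<close> is
  exchanged for \<open>zs ! Suc j\<close>. For \<open>j = 0\<close> the attempted edge is the
  missing edge itself: the order stays, and the edge after it is listed as missing even if owned,
  which \<open>valid\<close> permits.\<close>

lemma flip_missing:
  assumes "valid n h zs Ms" "n \<ge> 3" "{last zs, hd zs} \<in> Ms" "Suc j < n"
    "maker_elems h \<subseteq> maker_elems h'" "{last zs, zs ! j} \<in> maker_elems h'"
  shows "valid n h' (two_opt j zs) (flip_missing zs j Ms)"
    "{zs ! j, zs ! Suc j} \<in> Ms \<Longrightarrow> card (flip_missing zs j Ms) = card Ms - 1"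
    "card (flip_missing zs j Ms) \<le> card Ms" "card Ms \<le> Suc (card (flip_missing zs j Ms))"
    "{zs ! j, zs ! Suc j} \<in> Ms \<Longrightarrow>
       (\<Sum>e\<in>flip_missing zs j Ms. \<Sum>x\<in>e. f x) = (\<Sum>e\<in>Ms. \<Sum>x\<in>e. f x) - f (last zs) - f (zs ! j)"
    "{zs ! j, zs ! Suc j} \<notin> Ms \<Longrightarrow>
       (\<Sum>e\<in>flip_missing zs j Ms. \<Sum>x\<in>e. f x) = (\<Sum>e\<in>Ms. \<Sum>x\<in>e. f x) - f (last zs) + (f (zs ! Suc j) :: real)"
proof -
  let ?c = "{last zs, hd zs}" and ?e = "{zs ! j, zs ! Suc j}" and ?r = "{hd zs, zs ! Suc j}"
  let ?M = "flip_missing zs j Ms"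
  have len: "length zs = n" by (rule valid_length[OF assms(1)])
  have dz: "distinct zs" using assms(1) by (simp add: valid_def)
  have jz: "Suc j < length zs" using assms(4) len by simp
  obtain E where E: "set (cycle_edges zs) = {?c, ?e} \<union> E"
    "set (cycle_edges (two_opt j zs)) = {{last zs, zs ! j}, ?r} \<union> E"
    "?c \<notin> E" "?e \<notin> E" "{last zs, zs ! j} \<notin> E" "?r \<notin> E" "?c \<noteq> ?e"
    using two_opt(3)[OF jz dz] len assms(2) by blast
  have M: "?M = insert ?r (Ms - {?c, ?e})" by (simp add: flip_missing_def)
  have sub: "Ms - {?c, ?e} \<subseteq> E" using assms(1) E(1) by (auto simp: valid_def)
  have rn: "?r \<notin> Ms - {?c, ?e}" using sub E by blast
  show v: "valid n h' (two_opt j zs) ?M" unfolding valid_def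
  proof (intro conjI)
    show "distinct (two_opt j zs)" "set (two_opt j zs) = {..<n}"
      using two_opt[OF jz dz] assms(1) by (auto simp: valid_def)
    show "?M \<subseteq> set (cycle_edges (two_opt j zs))" unfolding M E(2) using sub by blast
    have "E - Ms \<subseteq> maker_elems h" using assms(1) E(1) by (auto simp: valid_def)
    then show "set (cycle_edges (two_opt j zs)) - ?M \<subseteq> maker_elems h'"
      unfolding M E(2) using assms(5,6) E(3,4) by blast
  qed
  have fM: "finite Ms" by (rule valid_finite[OF assms(1)])
  have cM: "card ?M = Suc (card (Ms - {?c, ?e}))" unfolding M using rn fM by simp
  have cpos: "card Ms > 0" using assms(3) fM by (auto simp: card_gt_0_iff)
  have c1: "card (Ms - {?c}) = card Ms - 1" using assms(3) fM by simp
  have ms: "Ms - {?c, ?e} = Ms - {?c} - {?e}" by blast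
  show "card ?M = card Ms - 1" if "?e \<in> Ms"
  proof -
    have "?e \<in> Ms - {?c}" using that E by auto
    then have "Suc (card (Ms - {?c} - {?e})) = card (Ms - {?c})" using fM by (metis card_Suc_Diff1 finite_Diff)
    then show ?thesis using cM c1 ms by simp
  qed
  then have *: "card ?M = (if ?e \<in> Ms then card Ms - 1 else card Ms)"
    using cM c1 cpos ms by (auto simp: Diff_insert0)
  show "card ?M \<le> card Ms" "card Ms \<le> Suc (card ?M)" using * cpos by auto
  have ne: "last zs \<noteq> hd zs" using valid_card2(2)[OF assms(1-3)] by (auto simp: card_insert_if)
  have ne2: "zs ! j \<noteq> zs ! Suc j" using dz jz by (simp add: nth_eq_iff_index_eq)
  have "?r \<in> ?M" by (simp add: M)
  then have ne3: "hd zs \<noteq> zs ! Suc j" using valid_card2(2)[OF v assms(2)] by (force simp: card_insert_if)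
  let ?g = "\<lambda>e. \<Sum>x\<in>e. f x"
  have s1: "sum ?g ?M = ?g ?r + sum ?g (Ms - {?c, ?e})" unfolding M using rn fM by simp
  have s2: "sum ?g Ms = ?g ?c + sum ?g (Ms - {?c})" using fM assms(3) by (rule sum.remove)
  show "sum ?g ?M = sum ?g Ms - f (last zs) - f (zs ! j)" if "?e \<in> Ms"
  proof -
    have "sum ?g (Ms - {?c}) = ?g ?e + sum ?g (Ms - {?c} - {?e})"
      by (rule sum.remove) (use fM that E in auto)
    then show ?thesis using s1 s2 ne ne2 ne3 ms by simp
  qed
  show "sum ?g ?M = sum ?g Ms - f (last zs) + f (zs ! Suc j)" if "?e \<notin> Ms"
  proof -
    have "Ms - {?c, ?e} = Ms - {?c}" using that by auto
    then show ?thesis using s1 s2 ne ne2 ne3 by simp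
  qed
qed

section \<open>The game against a fixed strategy of PhantomBreaker\<close>

locale hamilton_game =
  fixes n a b :: nat and \<tau> :: "nat set breaker_strategy"
  assumes n3: "n \<ge> 3" and a_pos: "a > 0" and b_pos: "b > 0"
    and legal: "legal_breaker (complete_edges n) b \<tau>"
begin

definition width :: nat where "width = 8 * (b + 1)"

definition lose :: "nat \<Rightarrow> nat set play \<Rightarrow> memory \<Rightarrow> real" where
  "lose T h st = 1 - success_prob (hamilton_cycles n) a \<tau> (hamilton_step n width) {0, 1} T h st"

definition legal_play :: "nat set play \<Rightarrow> bool" where
  "legal_play h \<longleftrightarrow> breaker_elems h \<subseteq> complete_edges n \<and>
     card (breaker_elems h) \<le> b * (length (maker_view h) div a)"

abbreviation B :: "nat set play \<Rightarrow> nat set set" where "B \<equiv> breaker_elems"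

lemma lose_le_1: "lose T h st \<le> 1"
  by (simp add: lose_def success_prob_nonneg)

lemma legal_play_Nil: "legal_play []"
  by (simp add: legal_play_def breaker_elems_def)

lemma legal_play_finite: "legal_play h \<Longrightarrow> finite (B h)"
  unfolding legal_play_def using finite_subset finite_complete_edges by blast

lemma next_play:
  assumes "legal_play h"
  shows "legal_play (attempt a \<tau> e h)" "B h \<subseteq> B (attempt a \<tau> e h)"
    "card (B (attempt a \<tau> e h) - B h) \<le> b"
    "length (maker_view (attempt a \<tau> e h)) = Suc (length (maker_view h))"
    "maker_elems h \<subseteq> maker_elems (attempt a \<tau> e h)"
    "e \<notin> B h \<Longrightarrow> e \<in> maker_elems (attempt a \<tau> e h)"
  using breaker_elems_attempt_bounds[OF legal finite_complete_edges a_pos, of h e] assms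
  by (auto simp: legal_play_def maker_elems_attempt maker_view_attempt)

lemma next_play_card: "legal_play h \<Longrightarrow> card (B (attempt a \<tau> e h)) \<le> card (B h) + b"
proof -
  assume h: "legal_play h"
  have "card (B (attempt a \<tau> e h)) = card (B h) + card (B (attempt a \<tau> e h) - B h)"
    using next_play(2)[OF h, of e] legal_play_finite[OF next_play(1)[OF h, of e]]
    by (metis card_Diff_subset card_mono finite_subset le_add_diff_inverse)
  then show ?thesis using next_play(3)[OF h, of e] by simp
qed

lemma next_play_deg: "legal_play h \<Longrightarrow> deg (B (attempt a \<tau> e h)) v \<le> deg (B h) v + b"
  using deg_extend[OF legal_play_finite[OF next_play(1)] next_play(2), of h e v]
    deg_le_card[of "B (attempt a \<tau> e h) - B h" v] next_play(3)[of h e]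
    legal_play_finite[OF next_play(1), of h e] by simp

lemma next_play_wdeg:
  assumes "legal_play h" "valid n h' zs Ms"
  shows "wdeg (B (attempt a \<tau> e h) - B h) Ms \<le> 4 * real b"
    "wdeg (B (attempt a \<tau> e h)) Ms \<le> wdeg (B h) Ms + 4 * real b"
proof -
  let ?C = "B (attempt a \<tau> e h) - B h"
  have "?C \<subseteq> complete_edges n" using next_play(1)[OF assms(1), of e] by (auto simp: legal_play_def)
  then have "wdeg ?C Ms \<le> 4 * real (card ?C)" by (rule wdeg_le_card[OF assms(2) n3])
  also have "\<dots> \<le> 4 * real b" using next_play(3)[OF assms(1), of e] by simp
  finally show "wdeg ?C Ms \<le> 4 * real b" .
  then show "wdeg (B (attempt a \<tau> e h)) Ms \<le> wdeg (B h) Ms + 4 * real b"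
    using wdeg_extend[OF legal_play_finite[OF next_play(1)[OF assms(1)]] next_play(2)[OF assms(1)], of e Ms]
    by simp
qed

lemma lose_done: "valid n h zs {} \<Longrightarrow> lose T h st = 0"
  using cycle_edges_hamilton[of zs n] n3 unfolding lose_def valid_def
  by (subst success_prob_achieved) (auto simp: achieved_def)

lemma lose_average:
  assumes "hamilton_step n width st = map_pmf (\<lambda>i. (e i, f i)) (pmf_of_set I)" "finite I" "I \<noteq> {}"
    "\<And>i. i \<in> I \<Longrightarrow> lose T (attempt a \<tau> (e i) h) (f i (e i \<notin> B h)) \<le> g i"
    "(\<Sum>i\<in>I. g i) \<le> real (card I) * x"
  shows "lose (Suc T) h st \<le> x"
proof -
  have pos: "real (card I) > 0" using assms(2,3) by (simp add: card_gt_0_iff)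
  have "lose (Suc T) h st = (\<Sum>i\<in>I. lose T (attempt a \<tau> (e i) h) (f i (e i \<notin> B h))) / card I"
    unfolding lose_def success_prob_average[where \<beta> = "hamilton_step n width" and s = st and e = e and f = f and I = I, OF assms(1-3)] using pos
    by (simp add: sum_subtractf diff_divide_distrib)
  also have "\<dots> \<le> (\<Sum>i\<in>I. g i) / card I" using pos assms(4) by (intro divide_right_mono sum_mono) auto
  also have "\<dots> \<le> x" using pos assms(5) by (simp add: field_simps)
  finally show ?thesis .
qed

lemma clip_eq: "x < n \<Longrightarrow> y < n \<Longrightarrow> x \<noteq> y \<Longrightarrow> clip n {x, y} = {x, y}"
  by (simp add: clip_def complete_edges_def)

lemma valid_nth:
  assumes "valid n h zs Ms"
  shows "i < n \<Longrightarrow> zs ! i < n" "i < n \<Longrightarrow> j < n \<Longrightarrow> zs ! i = zs ! j \<longleftrightarrow> i = j"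
    "last zs = zs ! (n - 1)" "hd zs = zs ! 0" "inj_on ((!) zs) {..<n}"
proof -
  have len: "length zs = n" by (rule valid_length[OF assms])
  have d: "distinct zs" "set zs = {..<n}" using assms by (auto simp: valid_def)
  show "i < n \<Longrightarrow> zs ! i < n" using d len nth_mem[of i zs] by auto
  show "i < n \<Longrightarrow> j < n \<Longrightarrow> zs ! i = zs ! j \<longleftrightarrow> i = j" using d len by (simp add: nth_eq_iff_index_eq)
  show "inj_on ((!) zs) {..<n}" using d len by (auto simp: inj_on_def nth_eq_iff_index_eq)
  have "zs \<noteq> []" using len n3 by auto
  then show "last zs = zs ! (n - 1)" "hd zs = zs ! 0" using len by (simp_all add: last_conv_nth hd_conv_nth)
qed

lemma sum_deg_inj:
  assumes "inj_on f J" "f ` J \<subseteq> {..<n}" "C \<subseteq> complete_edges n"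
  shows "(\<Sum>j\<in>J. deg C (f j)) \<le> 2 * card C"
proof -
  have "(\<Sum>j\<in>J. deg C (f j)) = (\<Sum>v\<in>f ` J. deg C v)" using assms(1) by (simp add: sum.reindex)
  also have "\<dots> \<le> (\<Sum>v<n. deg C v)" using assms(2) by (intro sum_mono2) auto
  finally show ?thesis using sum_deg[OF assms(3)] by simp
qed

section \<open>Closing the last missing edges\<close>

definition blocked_pairs :: "nat set set \<Rightarrow> nat list \<Rightarrow> nat set \<Rightarrow> nat set \<Rightarrow> nat" where
  "blocked_pairs C zs J L = card {p \<in> J \<times> L. {zs ! (snd p - 1), zs ! Suc (fst p)} \<in> C}"

text \<open>The closing edge of a pair starts at \<open>zs ! Suc j\<close>, so a random
  \<open>l\<close> creates on average at most \<open>end_deg C zs J / (n div 2 - 1)\<close> blocked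
  pairs. \<open>remaining_cost\<close> charges these in advance, doubled because only every second
  attempt at \<open>hd zs\<close> is guaranteed to succeed on average.\<close>

definition end_deg :: "nat set set \<Rightarrow> nat list \<Rightarrow> nat set \<Rightarrow> nat" where
  "end_deg C zs J = (\<Sum>j\<in>J. deg C (zs ! Suc j))"

definition good_fix :: "nat set play \<Rightarrow> nat list \<Rightarrow> nat set set \<Rightarrow> nat set \<Rightarrow> nat set \<Rightarrow> bool" where
  "good_fix h zs Ms J L \<longleftrightarrow> valid n h zs Ms \<and> {last zs, hd zs} \<in> Ms \<and>
     J \<subseteq> {n div 2..<n - 1} \<and> card J \<le> width \<and> (\<forall>j\<in>J. {last zs, zs ! j} \<in> maker_elems h) \<and>
     L \<subseteq> {1..<n div 2} \<and> card L \<le> width \<and> (\<forall>l\<in>L. {hd zs, zs ! l} \<in> maker_elems h) \<and>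
     (card J < width \<longrightarrow> L = {})"

lemma good_fix_finite: "good_fix h zs Ms J L \<Longrightarrow> finite J \<and> finite L"
  unfolding good_fix_def by (meson finite_atLeastLessThan finite_subset)

text \<open>The constants solve \<open>4 * width * pace + 1 = fix_cost\<close>: the expected number of attempts until a
  missing edge is closed is at most \<open>fix_cost\<close>, and a random pair in \<open>J \<times> L\<close> is blocked with
  probability at most one half.\<close>

definition fix_cost :: real where "fix_cost = 2 * (4 * real width + 1)"
definition pair_cost :: real where "pair_cost = fix_cost / (real width)\<^sup>2"
definition pace :: real where "pace = 1 + pair_cost * (real b + 1)"

lemma width_pos: "real width \<ge> 16" using b_pos by (simp add: width_def)

text \<open>The \<open>2 * width\<close> joining edges take at most two attempts each on average,
  counted with weight \<open>pace\<close>; the closing attempt adds 1. As \<open>pace\<close>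
  contains \<open>fix_cost\<close> through \<open>pair_cost\<close>, this is a linear equation for
  \<open>fix_cost\<close>.\<close>

lemma cost_eq: "4 * real width * pace + 1 = fix_cost"
proof -
  have w: "real width = 8 * (real b + 1)" by (simp add: width_def)
  have "4 * real width * pair_cost * (real b + 1) = 4 * (real b + 1) * fix_cost / real width"
    using width_pos by (simp add: pair_cost_def power2_eq_square)
  \<comment> \<open>This is where the factor 8 in \<open>width\<close> comes from: the part of the
    cost due to blocked pairs becomes exactly half of \<open>fix_cost\<close>.\<close>
  also have "4 * (real b + 1) = real width / 2" using w by simp
  also have "real width / 2 * fix_cost / real width = fix_cost / 2" using width_pos by simp
  finally show ?thesis by (simp add: pace_def algebra_simps fix_cost_def)
qed

lemma pair_cost_pos: "pair_cost > 0"
  using width_pos by (auto simp: pair_cost_def fix_cost_def intro!: divide_pos_pos)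

lemma pace_pos: "pace > 0"
  using pair_cost_pos by (auto simp: pace_def intro!: add_pos_nonneg)

lemma fix_cost_pos: "fix_cost > 0" using width_pos by (simp add: fix_cost_def)

text \<open>An upper bound for the expected number of attempts still needed.\<close>

definition remaining_cost :: "nat set set \<Rightarrow> nat list \<Rightarrow> nat set set \<Rightarrow> nat set \<Rightarrow> nat set \<Rightarrow> real" where
  "remaining_cost C zs Ms J L = (real (card Ms) - 1) * fix_cost
     + 2 * pace * (2 * real width - real (card J) - real (card L)) + 1
     + pair_cost * (real (blocked_pairs C zs J L)
         + 2 * (real width - real (card L)) / (real (n div 2) - 1) * real (end_deg C zs J))"

lemma remaining_cost_fresh: "remaining_cost C zs Ms {} {} = real (card Ms) * fix_cost"
  using cost_eq by (simp add: remaining_cost_def blocked_pairs_def end_deg_def algebra_simps)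

definition large_board :: bool where
  "large_board \<longleftrightarrow> n \<ge> 400 * width * b + 100"

lemma large_board_half:
  assumes large_board
  shows "real (n div 2) \<le> real n / 2" "real (n div 2) \<ge> real n / 2 - 1 / 2"
    "real (n - 1 - n div 2) \<ge> real n / 2 - 1" "n - 1 - n div 2 > 0" "n div 2 > 1"
    "real n \<ge> 400 * real width * real b + 100" "real width \<le> real n / 400"
    "real (n div 2) - 1 \<ge> 8 * real width * real b"
proof -
  have n: "n \<ge> 400 * width * b + 100" using assms by (simp add: large_board_def)
  then have "real n \<ge> real (400 * width * b + 100)" by (simp only: of_nat_le_iff)
  then show r: "real n \<ge> 400 * real width * real b + 100" by simp
  show q: "real (n div 2) \<le> real n / 2" "real (n div 2) \<ge> real n / 2 - 1 / 2" by linarith+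
  show "real (n - 1 - n div 2) \<ge> real n / 2 - 1" "n - 1 - n div 2 > 0" "n div 2 > 1"
    using n q by linarith+
  have "real width * 1 \<le> real width * real b" using b_pos by (intro mult_left_mono) auto
  then show "real width \<le> real n / 400" using r by simp
  show "real (n div 2) - 1 \<ge> 8 * real width * real b" using r q by linarith
qed

text \<open>The positions \<open>l - 1\<close> and \<open>Suc j\<close> lie in different halves, so
  pairs are determined by their closing edges and a newly claimed edge blocks at most one
  pair.\<close>

lemma blocked_pairs_extend:
  assumes "good_fix h zs Ms J L" "finite C'" "C \<subseteq> C'"
  shows "blocked_pairs C' zs J L \<le> blocked_pairs C zs J L + card (C' - C)"
proof -
  let ?f = "\<lambda>p. {zs ! (snd p - 1), zs ! Suc (fst p)}"
  have fin: "finite (J \<times> L)" using good_fix_finite[OF assms(1)] by auto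
  have v: "valid n h zs Ms" using assms(1) by (simp add: good_fix_def)
  have r: "fst p \<ge> n div 2 \<and> Suc (fst p) < n \<and> snd p > 0 \<and> snd p < n div 2" if "p \<in> J \<times> L" for p
    using that assms(1) unfolding good_fix_def by (cases p) force
  have inj: "inj_on ?f (J \<times> L)"
  proof (rule inj_onI)
    fix p p' assume p: "p \<in> J \<times> L" "p' \<in> J \<times> L" "?f p = ?f p'"
    have lt: "snd p - 1 < n" "snd p' - 1 < n" "Suc (fst p) < n" "Suc (fst p') < n"
      using r[OF p(1)] r[OF p(2)] by auto
    have "zs ! (snd p - 1) \<noteq> zs ! Suc (fst p')"
      using valid_nth(2)[OF v lt(1,4)] r[OF p(1)] r[OF p(2)] by auto
    then have "zs ! (snd p - 1) = zs ! (snd p' - 1)" "zs ! Suc (fst p) = zs ! Suc (fst p')"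
      using p(3) by (auto simp: doubleton_eq_iff)
    then have "snd p - 1 = snd p' - 1" "Suc (fst p) = Suc (fst p')"
      using valid_nth(2)[OF v lt(1,2)] valid_nth(2)[OF v lt(3,4)] by auto
    then show "p = p'" using r[OF p(1)] r[OF p(2)] by (auto simp: prod_eq_iff)
  qed
  have "{p \<in> J \<times> L. ?f p \<in> C'} \<subseteq> {p \<in> J \<times> L. ?f p \<in> C} \<union> {p \<in> J \<times> L. ?f p \<in> C' - C}" by auto
  then have "card {p \<in> J \<times> L. ?f p \<in> C'} \<le> card ({p \<in> J \<times> L. ?f p \<in> C} \<union> {p \<in> J \<times> L. ?f p \<in> C' - C})"
    using fin by (intro card_mono) auto
  also have "\<dots> \<le> card {p \<in> J \<times> L. ?f p \<in> C} + card {p \<in> J \<times> L. ?f p \<in> C' - C}"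
    by (rule card_Un_le)
  also have "card {p \<in> J \<times> L. ?f p \<in> C' - C} \<le> card (C' - C)"
    by (rule card_inj_on_le[where f = ?f]) (use inj assms(2) in \<open>auto simp: inj_on_def\<close>)
  finally show ?thesis by (simp add: blocked_pairs_def)
qed

text \<open>A turn adds at most \<open>b\<close> blocked pairs and \<open>2 * b\<close> to
  \<open>end_deg\<close>. On a large board the coefficient of the latter is so small that it
  contributes at most 1 / 2.\<close>

lemma remaining_cost_extend:
  assumes "good_fix h zs Ms J L" large_board "C' \<subseteq> complete_edges n" "C \<subseteq> C'" "card (C' - C) \<le> b"
  shows "remaining_cost C' zs Ms J L \<le> remaining_cost C zs Ms J L + pair_cost * (real b + 1 / 2)"
proof -
  note hb = large_board_half[OF assms(2)]
  have finC: "finite C'" using assms(3) by (rule finite_subset) simp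
  have v: "valid n h zs Ms" and J: "J \<subseteq> {n div 2..<n - 1}" using assms(1) by (auto simp: good_fix_def)
  have b1: "real (blocked_pairs C' zs J L) \<le> real (blocked_pairs C zs J L) + real b"
    using blocked_pairs_extend[OF assms(1) finC assms(4)] assms(5) by linarith
  have "end_deg C' zs J = end_deg C zs J + end_deg (C' - C) zs J"
    by (simp add: end_deg_def deg_extend[OF finC assms(4)] sum.distrib)
  moreover have "end_deg (C' - C) zs J \<le> 2 * card (C' - C)"
    unfolding end_deg_def
  proof (rule sum_deg_inj)
    have "Suc j < n" if "j \<in> J" for j
    proof -
      have "j \<in> {n div 2..<n - 1}" using J that by blast
      then show ?thesis by auto
    qed
    then show "inj_on (\<lambda>j. zs ! Suc j) J" "(\<lambda>j. zs ! Suc j) ` J \<subseteq> {..<n}"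
      using valid_nth[OF v] by (auto simp: inj_on_def)
  qed (use assms in auto)
  ultimately have b2: "real (end_deg C' zs J) \<le> real (end_deg C zs J) + 2 * real b"
    using assms(5) by linarith
  define f where "f = 2 * (real width - real (card L)) / (real (n div 2) - 1)"
  have q: "real (n div 2) - 1 > 0" using hb(5) by linarith
  have cL: "real (card L) \<le> real width" using assms(1) by (auto simp: good_fix_def)
  have f0: "f \<ge> 0" unfolding f_def using q cL by (intro divide_nonneg_pos) auto
  have f1: "f * (2 * real b) \<le> 1 / 2"
  proof -
    have "f * (2 * real b) \<le> 2 * real width / (real (n div 2) - 1) * (2 * real b)"
      unfolding f_def using q by (intro mult_right_mono divide_right_mono) auto
    also have "\<dots> = (4 * real width * real b) / (real (n div 2) - 1)" by simp
    also have "\<dots> \<le> 1 / 2" using hb(8) q by (simp add: divide_simps)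
    finally show ?thesis .
  qed
  have "f * real (end_deg C' zs J) \<le> f * (real (end_deg C zs J) + 2 * real b)"
    using b2 f0 by (rule mult_left_mono)
  also have "\<dots> \<le> f * real (end_deg C zs J) + 1 / 2" using f1 by (simp add: algebra_simps)
  finally have "real (blocked_pairs C' zs J L) + f * real (end_deg C' zs J) \<le>
    real (blocked_pairs C zs J L) + f * real (end_deg C zs J) + (real b + 1 / 2)" using b1 by linarith
  from mult_left_mono[OF this less_imp_le[OF pair_cost_pos]]
  show ?thesis unfolding remaining_cost_def f_def[symmetric] by (simp add: algebra_simps)
qed

end

lemma sum_card_swap:
  assumes "finite I" "finite J"
  shows "(\<Sum>i\<in>I. card {j \<in> J. P i j}) = (\<Sum>j\<in>J. card {i \<in> I. P i j})"
proof -
  have "(\<Sum>i\<in>I. card {j \<in> J. P i j}) = (\<Sum>i\<in>I. \<Sum>j\<in>J. if P i j then 1 else 0)"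
    by (simp only: card_eq_sum sum.inter_filter[OF assms(2)])
  also have "\<dots> = (\<Sum>j\<in>J. \<Sum>i\<in>I. if P i j then 1 else 0)" by (rule sum.swap)
  finally show ?thesis by (simp only: card_eq_sum sum.inter_filter[OF assms(1)])
qed

lemma card_filter_split: "finite I \<Longrightarrow> card I = card {x \<in> I. P x} + card {x \<in> I. \<not> P x}"
  by (subst card_Un_disjoint[symmetric]) (auto intro: arg_cong[where f = card])

context hamilton_game begin

lemma remaining_cost_nonneg:
  assumes "good_fix h zs Ms J L" large_board
  shows "remaining_cost C zs Ms J L \<ge> 0"
proof -
  have "finite Ms" "Ms \<noteq> {}" using assms(1) valid_finite by (auto simp: good_fix_def)
  then have "real (card Ms) \<ge> 1" by (simp add: Suc_le_eq card_gt_0_iff)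
  moreover have "real (card J) \<le> real width" "real (card L) \<le> real width"
    using assms(1) by (auto simp: good_fix_def)
  moreover have "real (n div 2) - 1 > 0" using large_board_half(5)[OF assms(2)] by linarith
  ultimately show ?thesis unfolding remaining_cost_def
    using pace_pos pair_cost_pos fix_cost_pos
    by (intro add_nonneg_nonneg mult_nonneg_nonneg divide_nonneg_pos) auto
qed

text \<open>Markov's inequality in recursive form: of a budget of \<open>D\<close> attempts
  \<open>D - T\<close> are spent, and the bound is the spent plus the expected further attempts,
  divided by \<open>D\<close>. An attempt preserves it if the cost drops by 1 on average.\<close>

lemma lose_average_cost:
  assumes "hamilton_step n width st = map_pmf (\<lambda>i. (e i, f i)) (pmf_of_set I)" "finite I" "I \<noteq> {}"
    "\<And>i. i \<in> I \<Longrightarrow> lose T (attempt a \<tau> (e i) h) (f i (e i \<notin> B h)) \<le> (D - real T + G i) / D"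
    "(\<Sum>i\<in>I. G i) \<le> real (card I) * (R - 1)" "D > 0"
  shows "lose (Suc T) h st \<le> (D - real (Suc T) + R) / D"
proof (rule lose_average[where g = "\<lambda>i. (D - real T + G i) / D", OF assms(1-4)])
  have "(\<Sum>i\<in>I. (D - real T + G i) / D) = (real (card I) * (D - real T) + (\<Sum>i\<in>I. G i)) / D"
    by (simp add: sum.distrib flip: sum_divide_distrib)
  also have "\<dots> \<le> (real (card I) * (D - real T) + real (card I) * (R - 1)) / D"
    using assms(5,6) by (intro divide_right_mono) auto
  also have "\<dots> = real (card I) * ((D - real (Suc T) + R) / D)" by (simp add: field_simps)
  finally show "(\<Sum>i\<in>I. (D - real T + G i) / D) \<le> real (card I) * ((D - real (Suc T) + R) / D)" .
qed

text \<open>The terms with \<open>b * T\<close> make the bounds hereditary: in the \<open>T\<close>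
  attempts left PhantomBreaker claims at most that many edges.\<close>

definition sparse :: "nat \<Rightarrow> nat set play \<Rightarrow> nat set set \<Rightarrow> bool" where
  "sparse T h Ms \<longleftrightarrow> (\<forall>e\<in>Ms. \<forall>x\<in>e. real (deg (B h) x) + real b * real T \<le> real n / 8) \<and>
     card (B h) + b * T \<le> 4 * b * n"

lemma sparse_next:
  assumes "sparse (Suc T) h Ms" "legal_play h" "Ms' \<subseteq> Ms"
  shows "sparse T (attempt a \<tau> e h) Ms'"
  unfolding sparse_def
proof (intro conjI ballI)
  show "card (B (attempt a \<tau> e h)) + b * T \<le> 4 * b * n"
    using assms(1) next_play_card[OF assms(2), of e] by (simp add: sparse_def)
  fix e' x assume "e' \<in> Ms'" "x \<in> e'"
  then have "real (deg (B h) x) + real b * real (Suc T) \<le> real n / 8"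
    using assms(1,3) unfolding sparse_def by blast
  then show "real (deg (B (attempt a \<tau> e h)) x) + real b * real T \<le> real n / 8"
    using next_play_deg[OF assms(2), of e x] by (simp add: algebra_simps)
qed

lemma good_fix_mono:
  "good_fix h zs Ms J L \<Longrightarrow> maker_elems h \<subseteq> maker_elems h' \<Longrightarrow> good_fix h' zs Ms J L"
  unfolding good_fix_def using valid_mono by blast

lemma start_fix_cases:
  assumes "valid n h ys Ms" "Ms \<noteq> {}"
  obtains zs where "start_fix ys Ms = Fix zs Ms {} {}" "good_fix h zs Ms {} {}"
proof -
  let ?p = "SOME p. p \<in> arcs Ms"
  obtain e where e: "e \<in> Ms" using assms(2) by blast
  obtain x y where "e = {x, y}" using valid_card2(2)[OF assms(1) n3 e] by (auto simp: card_2_iff)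
  then have "(x, y) \<in> arcs Ms" using e by (simp add: arcs_def)
  then have p: "?p \<in> arcs Ms" by (rule someI)
  note c = valid_cut_at[OF assms(1) n3 p]
  have "good_fix h (cut_at ys (fst ?p) (snd ?p)) Ms {} {}"
    unfolding good_fix_def using c by auto
  moreover have "start_fix ys Ms = Fix (cut_at ys (fst ?p) (snd ?p)) Ms {} {}"
    using assms(2) by (simp add: start_fix_def Let_def)
  ultimately show ?thesis using that by blast
qed

lemma three_opt_valid:
  assumes "valid n h zs Ms" "0 < l" "l \<le> j" "Suc j < n"
    "{last zs, zs ! j} \<in> maker_elems h" "{hd zs, zs ! l} \<in> maker_elems h"
    "{zs ! (l - 1), zs ! Suc j} \<in> maker_elems h"
  shows "valid n h (three_opt l j zs) (Ms - {{last zs, hd zs}, {zs ! (l - 1), zs ! l}, {zs ! j, zs ! Suc j}})"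
proof -
  have len: "length zs = n" by (rule valid_length[OF assms(1)])
  have d: "distinct zs" "set zs = {..<n}" using assms(1) by (auto simp: valid_def)
  have "Suc j < length zs" "length zs \<ge> 3" using assms(4) len n3 by auto
  note t = three_opt[OF assms(2,3) this(1) d(1) this(2)]
  obtain E where E: "set (cycle_edges zs) = {{last zs, hd zs}, {zs ! (l - 1), zs ! l}, {zs ! j, zs ! Suc j}} \<union> E"
     "set (cycle_edges (three_opt l j zs)) =
           {{last zs, zs ! j}, {hd zs, zs ! l}, {zs ! (l - 1), zs ! Suc j}} \<union> E"
     "{last zs, hd zs} \<notin> E" "{zs ! (l - 1), zs ! l} \<notin> E" "{zs ! j, zs ! Suc j} \<notin> E"
    using t(3) by blast
  show ?thesis unfolding valid_def
  proof (intro conjI)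
    show "distinct (three_opt l j zs)" "set (three_opt l j zs) = {..<n}" using t d by auto
    let ?M = "Ms - {{last zs, hd zs}, {zs ! (l - 1), zs ! l}, {zs ! j, zs ! Suc j}}"
    show "?M \<subseteq> set (cycle_edges (three_opt l j zs))"
      using assms(1) unfolding valid_def E(1,2) by blast
    have "E - Ms \<subseteq> maker_elems h" using assms(1) unfolding valid_def E(1) by blast
    then show "set (cycle_edges (three_opt l j zs)) - ?M \<subseteq> maker_elems h"
      unfolding E(2) using assms(5-7) E(3-5) by blast
  qed
qed

lemma sum_if_card:
  assumes "finite I"
  shows "(\<Sum>i\<in>I. if P i then c else 0) = real (card {i \<in> I. P i}) * (c :: real)"
  using assms by (simp add: sum.If_cases Int_def)

text \<open>PhantomBreaker's reply may raise the cost by \<open>\<delta>\<close>. An attempt at an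
  end adds a new edge with probability at least one half and then lowers the cost by
  \<open>2 * pace\<close>, where \<open>pace\<close> is 1 plus \<open>\<delta>\<close> plus
  \<open>pair_cost / 2\<close>.\<close>

lemma fix_stage:
  assumes lb: large_board and D: "D > 0"
  shows "good_fix h zs Ms J L \<Longrightarrow> legal_play h \<Longrightarrow> sparse T h Ms \<Longrightarrow> real T \<le> D \<Longrightarrow>
    lose T h (Fix zs Ms J L) \<le> (D - real T + remaining_cost (B h) zs Ms J L) / D"
proof (induction T arbitrary: h zs Ms J L)
  case 0
  have "1 \<le> (D - real 0 + remaining_cost (B h) zs Ms J L) / D"
    using remaining_cost_nonneg[OF 0(1) lb] D by simp
  then show ?case using lose_le_1[of 0 h "Fix zs Ms J L"] by linarith
next
  case (Suc T)
  note gf = Suc.prems(1) and lp = Suc.prems(2) and sp = Suc.prems(3)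
  define q where "q = n div 2"
  define R where "R = remaining_cost (B h) zs Ms J L"
  define \<delta> where "\<delta> = pair_cost * (real b + 1 / 2)"
  note hb = large_board_half[OF lb]
  have v: "valid n h zs Ms" and cM: "{last zs, hd zs} \<in> Ms" and J: "J \<subseteq> {q..<n - 1}"
    and cJ: "card J \<le> width" and J1: "\<And>j. j \<in> J \<Longrightarrow> {last zs, zs ! j} \<in> maker_elems h"
    and L: "L \<subseteq> {1..<q}" and cL: "card L \<le> width" and L1: "\<And>l. l \<in> L \<Longrightarrow> {hd zs, zs ! l} \<in> maker_elems h"
    and JL: "card J < width \<Longrightarrow> L = {}"
    using gf by (auto simp: good_fix_def q_def)
  have fJL: "finite J" "finite L" using good_fix_finite[OF gf] by auto
  have fB: "finite (B h)" by (rule legal_play_finite[OF lp])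
  have Bc: "B h \<subseteq> complete_edges n" using lp by (simp add: legal_play_def)
  have cB: "real (card (B h)) \<le> 4 * real b * real n"
  proof -
    have "card (B h) \<le> 4 * b * n" using sp by (simp add: sparse_def)
    then have "real (card (B h)) \<le> real (4 * b * n)" by (simp only: of_nat_le_iff)
    then show ?thesis by simp
  qed
  have dslot: "real (deg (B h) x) \<le> real n / 8" if "x \<in> {last zs, hd zs}" for x
  proof -
    have "real (deg (B h) x) + real b * real (Suc T) \<le> real n / 8"
      using sp cM that unfolding sparse_def by blast
    moreover have "0 \<le> real b * real (Suc T)" by simp
    ultimately show ?thesis by linarith
  qed
  have ext: "remaining_cost (B (attempt a \<tau> e h)) zs' Ms' J' L' \<le> remaining_cost (B h) zs' Ms' J' L' + \<delta>"
    if "good_fix (attempt a \<tau> e h) zs' Ms' J' L'" for e zs' Ms' J' L'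
    unfolding \<delta>_def using next_play[OF lp, of e] that lb
    by (intro remaining_cost_extend) (auto simp: legal_play_def)
  have IH: "lose T (attempt a \<tau> e h) (Fix zs' Ms' J' L') \<le> (D - real T + remaining_cost (B (attempt a \<tau> e h)) zs' Ms' J' L') / D"
    if "good_fix (attempt a \<tau> e h) zs' Ms' J' L'" "Ms' \<subseteq> Ms" for e zs' Ms' J' L'
    using that Suc.prems(4) next_play(1)[OF lp] sparse_next[OF sp lp that(2)]
    by (intro Suc.IH) auto
  have \<delta>pos: "\<delta> > 0" unfolding \<delta>_def using pair_cost_pos by (intro mult_pos_pos add_nonneg_pos) auto
  have stay: "lose T (attempt a \<tau> e h) (Fix zs Ms J L) \<le> (D - real T + (R + \<delta>)) / D" for e
  proof -
    have g: "good_fix (attempt a \<tau> e h) zs Ms J L" by (rule good_fix_mono[OF gf next_play(5)[OF lp]])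
    have "lose T (attempt a \<tau> e h) (Fix zs Ms J L) \<le> (D - real T + remaining_cost (B (attempt a \<tau> e h)) zs Ms J L) / D"
      by (rule IH[OF g]) simp
    also have "\<dots> \<le> (D - real T + (R + \<delta>)) / D"
      using ext[OF g] D unfolding R_def by (intro divide_right_mono) auto
    finally show ?thesis .
  qed
  have qn: "q \<le> n - 1" "1 < q" "q < n" using hb(4,5) by (auto simp: q_def)
  have ne: "last zs \<noteq> zs ! j" if "j < n - 1" for j
    using valid_nth(2)[OF v, of "n - 1" j] valid_nth(3)[OF v] that by auto
  have ne0: "hd zs \<noteq> zs ! l" if "0 < l" "l < n" for l
    using valid_nth(2)[OF v, of 0 l] valid_nth(4)[OF v] that by auto
  have lasth: "last zs < n" "hd zs < n" using valid_nth[OF v] n3 by auto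
  define dfac where "dfac = 2 / (real q - 1)"
  have dfac0: "dfac \<ge> 0" using qn by (simp add: dfac_def)
  have q1: "real q - 1 > 0" using qn by linarith
  consider (J) "card J < width" | (L) "card J = width" "card L < width" | (C) "card J = width" "card L = width"
    using cJ cL by linarith
  then show ?case
  proof cases
    case J
    have L0: "L = {}" by (rule JL[OF J])
    let ?I = "{q..<n - 1}"
    let ?e = "\<lambda>j. clip n {last zs, zs ! j}"
    let ?good = "\<lambda>j. j \<notin> J \<and> {last zs, zs ! j} \<notin> B h"
    \<comment> \<open>The last term is the blocking to be expected at the new vertex
      \<open>zs ! Suc j\<close>. The average degree is bounded in terms of \<open>b\<close>, and the
      coefficient makes this at most \<open>pair_cost / 2\<close> on average.\<close>
    let ?G = "\<lambda>j. R + \<delta> - (if ?good j then 2 * pace else 0) + pair_cost * (real width * dfac) * real (deg (B h) (zs ! Suc j))"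
    show ?thesis unfolding R_def[symmetric]
    proof (rule lose_average_cost[where e = ?e and f = "\<lambda>j ok. Fix zs Ms (if ok then insert j J else J) L" and I = ?I and G = ?G])
      show "hamilton_step n width (Fix zs Ms J L) = map_pmf (\<lambda>j. (?e j, \<lambda>ok. Fix zs Ms (if ok then insert j J else J) L)) (pmf_of_set ?I)"
        using J by (simp add: q_def)
      show "?I \<noteq> {}" using hb(4) by (simp add: q_def)
      fix j assume j: "j \<in> ?I"
      have e: "?e j = {last zs, zs ! j}"
        using j lasth ne[of j] valid_nth(1)[OF v, of j] by (intro clip_eq) auto
      have nn: "0 \<le> pair_cost * (real width * dfac) * real (deg (B h) (zs ! Suc j))"
        using pair_cost_pos dfac0 by (intro mult_nonneg_nonneg) auto
      show "lose T (attempt a \<tau> (?e j) h) (Fix zs Ms (if ?e j \<notin> B h then insert j J else J) L) \<le> (D - real T + ?G j) / D"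
      proof (cases "?good j")
        case False
        then have "(if ?e j \<notin> B h then insert j J else J) = J" unfolding e by auto
        moreover have "(D - real T + (R + \<delta>)) / D \<le> (D - real T + ?G j) / D"
          using False nn D by (intro divide_right_mono) auto
        ultimately show ?thesis using stay[of "?e j"] by simp
      next
        case True
        let ?h = "attempt a \<tau> (?e j) h"
        have g: "good_fix ?h zs Ms (insert j J) L"
          unfolding good_fix_def
        proof (intro conjI)
          show "valid n ?h zs Ms" by (rule valid_mono[OF v next_play(5)[OF lp]])
          show "card (insert j J) \<le> width" using J fJL True by simp
          show "\<forall>j'\<in>insert j J. {last zs, zs ! j'} \<in> maker_elems ?h"
            using J1 next_play(5,6)[OF lp, of "?e j"] True e by auto
        qed (use cM J j L0 \<open>J \<subseteq> {q..<n - 1}\<close> in \<open>auto simp: q_def\<close>)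
        have "lose T ?h (Fix zs Ms (insert j J) L) \<le> (D - real T + remaining_cost (B ?h) zs Ms (insert j J) L) / D"
          by (rule IH[OF g]) simp
        also have "\<dots> \<le> (D - real T + (remaining_cost (B h) zs Ms (insert j J) L + \<delta>)) / D"
          using ext[OF g] D by (intro divide_right_mono) auto
        also have "remaining_cost (B h) zs Ms (insert j J) L = R - 2 * pace +
          pair_cost * (real width * dfac) * real (deg (B h) (zs ! Suc j))"
          unfolding R_def remaining_cost_def L0 dfac_def q_def using fJL True
          by (simp add: blocked_pairs_def end_deg_def algebra_simps)
        finally show ?thesis using True e by (simp add: algebra_simps)
      qed
    next
      let ?N = "real (card ?I)"
      have "0 \<le> 400 * real width * real b" by simp
      then have "real n \<ge> 100" using hb(6) by linarith
      then have N: "?N \<ge> 3 / 8 * real n" using hb(3) by (simp add: q_def)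
      have bad: "card {j \<in> ?I. \<not> ?good j} \<le> card J + deg (B h) (last zs)"
      proof -
        have "card {j \<in> ?I. \<not> ?good j} \<le> card (J \<union> {j \<in> ?I. {last zs, zs ! j} \<in> B h})"
          using fJL by (intro card_mono) auto
        also have "\<dots> \<le> card J + card {j \<in> ?I. {last zs, zs ! j} \<in> B h}" by (rule card_Un_le)
        also have "card {j \<in> ?I. {last zs, zs ! j} \<in> B h} \<le> deg (B h) (last zs)"
          by (intro card_blocked_le_deg fB inj_on_subset[OF valid_nth(5)[OF v]]) auto
        finally show ?thesis by simp
      qed
      have split: "card ?I = card {j \<in> ?I. ?good j} + card {j \<in> ?I. \<not> ?good j}"
        by (rule card_filter_split) simp
      have good: "real (card {j \<in> ?I. ?good j}) \<ge> ?N / 2"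
      proof -
        have "real (card J) \<le> real n / 400" using cJ hb(7) by linarith
        then show ?thesis using split bad dslot[of "last zs"] N hb(3) hb(6) width_pos
          by simp
      qed
      have sdeg: "(\<Sum>j\<in>?I. real (deg (B h) (zs ! Suc j))) \<le> 8 * real b * real n"
      proof -
        have "(\<Sum>j\<in>?I. deg (B h) (zs ! Suc j)) \<le> 2 * card (B h)"
        proof (rule sum_deg_inj[OF _ _ Bc])
          show "inj_on (\<lambda>j. zs ! Suc j) ?I" using valid_nth(2)[OF v] by (auto simp: inj_on_def)
          show "(\<lambda>j. zs ! Suc j) ` ?I \<subseteq> {..<n}" using valid_nth(1)[OF v] by auto
        qed
        then have "real (\<Sum>j\<in>?I. deg (B h) (zs ! Suc j)) \<le> 2 * real (card (B h))" by linarith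
        then show ?thesis using cB by simp
      qed
      have fac: "(real width * dfac) * (8 * real b * real n) \<le> ?N / 2"
      proof -
        have "real q - 1 \<ge> 3 / 8 * real n" using hb(2,6) width_pos b_pos unfolding q_def
          using mult_nonneg_nonneg[of "real width" "real b"] by linarith
        then have "3 / 8 * real n * (3 / 8 * real n) \<le> (real q - 1) * ?N" using N by (intro mult_mono) auto
        then have "9 / 64 * (real n * real n) \<le> (real q - 1) * ?N" by simp
        moreover have "real n * (400 * real width * real b) \<le> real n * real n"
          using hb(6) by (intro mult_left_mono) auto
        then have "400 * (real width * real b * real n) \<le> real n * real n" by (simp add: mult_ac)
        moreover have "0 \<le> real width * real b * real n" by simp
        ultimately have "32 * (real width * real b * real n) \<le> (real q - 1) * ?N" by linarith
        then show ?thesis using q1 by (simp add: dfac_def field_simps)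
      qed
      have "(\<Sum>j\<in>?I. ?G j) = ?N * (R + \<delta>) - 2 * pace * real (card {j \<in> ?I. ?good j})
          + pair_cost * ((real width * dfac) * (\<Sum>j\<in>?I. real (deg (B h) (zs ! Suc j))))"
        by (simp add: sum.distrib sum_subtractf sum_if_card sum_distrib_left algebra_simps)
      also have "\<dots> \<le> ?N * (R + \<delta>) - 2 * pace * (?N / 2) + pair_cost * (?N / 2)"
      proof (intro add_mono diff_mono mult_left_mono order_refl)
        show "real width * dfac * (\<Sum>j\<in>?I. real (deg (B h) (zs ! Suc j))) \<le> ?N / 2"
          using mult_left_mono[OF sdeg, of "real width * dfac"] dfac0 fac by simp
      qed (use good pace_pos pair_cost_pos in auto)
      \<comment> \<open>By the choice of \<open>pace\<close>, everything cancels except for the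
        attempt itself.\<close>
      also have "\<dots> = ?N * (R - 1)" unfolding \<delta>_def pace_def by (simp add: algebra_simps)
      finally show "(\<Sum>j\<in>?I. ?G j) \<le> ?N * (R - 1)" .
    qed (use D in auto)
  next
    case L
    let ?I = "{1..<q}"
    let ?e = "\<lambda>l. clip n {hd zs, zs ! l}"
    let ?good = "\<lambda>l. l \<notin> L \<and> {hd zs, zs ! l} \<notin> B h"
    let ?bl = "\<lambda>l. card {j \<in> J. {zs ! (l - 1), zs ! Suc j} \<in> B h}"
    let ?E = "real (end_deg (B h) zs J)"
    \<comment> \<open>A success releases \<open>dfac * ?E\<close> of the blocking charged in
      advance. With probability at least one half this pays for the new blocked pairs
      \<open>?bl l\<close>, whose average is at most \<open>?E / (q - 1)\<close>.\<close>
    let ?G = "\<lambda>l. R + \<delta> - (if ?good l then 2 * pace + pair_cost * dfac * ?E else 0) + pair_cost * real (?bl l)"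
    show ?thesis unfolding R_def[symmetric]
    proof (rule lose_average_cost[where e = ?e and f = "\<lambda>l ok. Fix zs Ms J (if ok then insert l L else L)" and I = ?I and G = ?G])
      show "hamilton_step n width (Fix zs Ms J L) = map_pmf (\<lambda>l. (?e l, \<lambda>ok. Fix zs Ms J (if ok then insert l L else L))) (pmf_of_set ?I)"
        using L by (simp add: q_def)
      show "?I \<noteq> {}" using qn by simp
      fix l assume l: "l \<in> ?I"
      have e: "?e l = {hd zs, zs ! l}"
        using l lasth ne0[of l] valid_nth(1)[OF v, of l] qn by (intro clip_eq) auto
      have nn: "0 \<le> pair_cost * real (?bl l)" using pair_cost_pos by simp
      show "lose T (attempt a \<tau> (?e l) h) (Fix zs Ms J (if ?e l \<notin> B h then insert l L else L)) \<le> (D - real T + ?G l) / D"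
      proof (cases "?good l")
        case False
        then have "(if ?e l \<notin> B h then insert l L else L) = L" unfolding e by auto
        moreover have "(D - real T + (R + \<delta>)) / D \<le> (D - real T + ?G l) / D"
          using False nn D by (intro divide_right_mono) auto
        ultimately show ?thesis using stay[of "?e l"] by simp
      next
        case True
        let ?h = "attempt a \<tau> (?e l) h"
        have g: "good_fix ?h zs Ms J (insert l L)"
          unfolding good_fix_def
        proof (intro conjI)
          show "valid n ?h zs Ms" by (rule valid_mono[OF v next_play(5)[OF lp]])
          show "card (insert l L) \<le> width" using L fJL True by simp
          show "\<forall>j'\<in>J. {last zs, zs ! j'} \<in> maker_elems ?h"
            using J1 next_play(5)[OF lp, of "?e l"] by auto
          show "\<forall>j'\<in>insert l L. {hd zs, zs ! j'} \<in> maker_elems ?h"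
            using L1 next_play(5,6)[OF lp, of "?e l"] True e by auto
        qed (use cM L l J \<open>L \<subseteq> {1..<q}\<close> in \<open>auto simp: q_def\<close>)
        have bp: "blocked_pairs (B h) zs J (insert l L) = blocked_pairs (B h) zs J L + ?bl l"
        proof -
          let ?P = "\<lambda>p. {zs ! (snd p - 1), zs ! Suc (fst p)} \<in> B h"
          have "{p \<in> J \<times> insert l L. ?P p} = {p \<in> J \<times> L. ?P p} \<union> (\<lambda>j. (j, l)) ` {j \<in> J. {zs ! (l - 1), zs ! Suc j} \<in> B h}"
            by auto
          moreover have "card ((\<lambda>j. (j, l)) ` {j \<in> J. {zs ! (l - 1), zs ! Suc j} \<in> B h}) = ?bl l"
            by (intro card_image) (auto simp: inj_on_def)
          moreover have "{p \<in> J \<times> L. ?P p} \<inter> (\<lambda>j. (j, l)) ` {j \<in> J. {zs ! (l - 1), zs ! Suc j} \<in> B h} = {}"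
            using True by auto
          moreover have "finite {p \<in> J \<times> L. ?P p}" "finite ((\<lambda>j. (j, l)) ` {j \<in> J. {zs ! (l - 1), zs ! Suc j} \<in> B h})"
            using fJL by auto
          ultimately show ?thesis unfolding blocked_pairs_def by (simp only: card_Un_disjoint)
        qed
        have "lose T ?h (Fix zs Ms J (insert l L)) \<le> (D - real T + remaining_cost (B ?h) zs Ms J (insert l L)) / D"
          by (rule IH[OF g]) simp
        also have "\<dots> \<le> (D - real T + (remaining_cost (B h) zs Ms J (insert l L) + \<delta>)) / D"
          using ext[OF g] D by (intro divide_right_mono) auto
        also have "remaining_cost (B h) zs Ms J (insert l L) = R - (2 * pace + pair_cost * dfac * ?E) + pair_cost * real (?bl l)"
        proof -
          obtain F where F: "2 * (real width - real (card L)) / (real q - 1) = F" by blast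
          have F': "2 * (real width - real (card (insert l L))) / (real q - 1) = F - dfac"
            unfolding dfac_def F[symmetric] using fJL True
            by (simp add: diff_divide_distrib add_divide_distrib algebra_simps)
          have ci: "real (card (insert l L)) = real (card L) + 1" using fJL True by simp
          show ?thesis unfolding R_def remaining_cost_def bp q_def[symmetric] F F' unfolding ci
            by (simp add: algebra_simps)
        qed
        finally show ?thesis using True e by (simp add: algebra_simps)
      qed
    next
      let ?N = "real (card ?I)"
      have N: "?N = real q - 1" using qn by (simp add: of_nat_diff)
      have bad: "card {l \<in> ?I. \<not> ?good l} \<le> card L + deg (B h) (hd zs)"
      proof -
        have "card {l \<in> ?I. \<not> ?good l} \<le> card (L \<union> {l \<in> ?I. {hd zs, zs ! l} \<in> B h})"
          using fJL by (intro card_mono) auto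
        also have "\<dots> \<le> card L + card {l \<in> ?I. {hd zs, zs ! l} \<in> B h}" by (rule card_Un_le)
        also have "card {l \<in> ?I. {hd zs, zs ! l} \<in> B h} \<le> deg (B h) (hd zs)"
          using qn by (intro card_blocked_le_deg fB inj_on_subset[OF valid_nth(5)[OF v]]) auto
        finally show ?thesis by simp
      qed
      have split: "card ?I = card {l \<in> ?I. ?good l} + card {l \<in> ?I. \<not> ?good l}"
        by (rule card_filter_split) simp
      have good: "real (card {l \<in> ?I. ?good l}) \<ge> ?N / 2"
      proof -
        have "?N = real (card {l \<in> ?I. ?good l}) + real (card {l \<in> ?I. \<not> ?good l})"
          using arg_cong[OF split, of real] by (simp only: of_nat_add)
        moreover have "real (card {l \<in> ?I. \<not> ?good l}) \<le> real (card L) + real (deg (B h) (hd zs))"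
          using bad by (simp only: of_nat_add[symmetric] of_nat_le_iff)
        moreover have "real (card L) \<le> real n / 400" using cL hb(7) by linarith
        moreover have "0 \<le> 400 * real width * real b" by simp
        then have "real n \<ge> 100" using hb(6) by linarith
        moreover have "?N \<ge> real n / 2 - 3 / 2" using N hb(2) unfolding q_def by linarith
        ultimately show ?thesis using dslot[of "hd zs"] by simp
      qed
      have sbl: "(\<Sum>l\<in>?I. real (?bl l)) \<le> ?E"
      proof -
        have "(\<Sum>l\<in>?I. ?bl l) = (\<Sum>j\<in>J. card {l \<in> ?I. {zs ! (l - 1), zs ! Suc j} \<in> B h})"
          by (rule sum_card_swap) (use fJL in auto)
        also have "\<dots> \<le> end_deg (B h) zs J" unfolding end_deg_def
        proof (rule sum_mono)
          fix j assume "j \<in> J"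
          have "card {l \<in> ?I. {zs ! Suc j, zs ! (l - 1)} \<in> B h} \<le> deg (B h) (zs ! Suc j)"
          proof (rule card_blocked_le_deg[OF _ fB])
            show "inj_on (\<lambda>l. zs ! (l - 1)) ?I" using valid_nth(2)[OF v] qn by (auto simp: inj_on_def)
          qed
          then show "card {l \<in> ?I. {zs ! (l - 1), zs ! Suc j} \<in> B h} \<le> deg (B h) (zs ! Suc j)"
            by (simp add: insert_commute)
        qed
        finally have "real (\<Sum>l\<in>?I. ?bl l) \<le> ?E" by linarith
        then show ?thesis by simp
      qed
      have "(\<Sum>l\<in>?I. ?G l) = ?N * (R + \<delta>) - (2 * pace + pair_cost * dfac * ?E) * real (card {l \<in> ?I. ?good l})
          + pair_cost * (\<Sum>l\<in>?I. real (?bl l))"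
        by (simp only: sum.distrib sum_subtractf sum_if_card sum_distrib_left[symmetric] finite_atLeastLessThan sum_constant mult.commute distrib_right)
      also have "\<dots> \<le> ?N * (R + \<delta>) - (2 * pace + pair_cost * dfac * ?E) * (?N / 2) + pair_cost * ?E"
        using good pace_pos pair_cost_pos dfac0 sbl
        by (intro add_mono diff_mono mult_left_mono order_refl) auto
      also have "\<dots> = ?N * (R + \<delta>) - pace * ?N" unfolding N dfac_def using q1 by (simp add: field_simps)
      also have "\<dots> = ?N * (R - 1) - ?N * pair_cost / 2" unfolding \<delta>_def pace_def by (simp add: algebra_simps)
      also have "\<dots> \<le> ?N * (R - 1)" using pair_cost_pos by simp
      finally show "(\<Sum>l\<in>?I. ?G l) \<le> ?N * (R - 1)" .
    qed (use D in auto)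
  next
    case C
    let ?I = "J \<times> L"
    let ?e = "\<lambda>i. clip n {zs ! (snd i - 1), zs ! Suc (fst i)}"
    let ?M = "\<lambda>i. Ms - {{last zs, hd zs}, {zs ! (snd i - 1), zs ! snd i}, {zs ! fst i, zs ! Suc (fst i)}}"
    let ?f = "\<lambda>i ok. if ok then start_fix (three_opt (snd i) (fst i) zs) (?M i) else Fix zs Ms {} {}"
    let ?bad = "\<lambda>i. {zs ! (snd i - 1), zs ! Suc (fst i)} \<in> B h"
    let ?k = "real (card Ms)"
    let ?G = "\<lambda>i. (?k - 1) * fix_cost + (if ?bad i then fix_cost else 0)"
    have r: "fst i \<ge> q \<and> Suc (fst i) < n \<and> snd i > 0 \<and> snd i < q" if "i \<in> ?I" for i
      using that J L by (cases i) force
    show ?thesis unfolding R_def[symmetric]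
    proof (rule lose_average_cost[where e = ?e and f = ?f and I = ?I and G = ?G])
      show "hamilton_step n width (Fix zs Ms J L) = map_pmf (\<lambda>i. (?e i, ?f i)) (pmf_of_set ?I)"
        using C by simp
      have "J \<noteq> {}" "L \<noteq> {}" using C width_pos by auto
      then show "?I \<noteq> {}" by auto
      show "finite ?I" using fJL by simp
      fix i assume i: "i \<in> ?I"
      let ?h = "attempt a \<tau> (?e i) h"
      have e: "?e i = {zs ! (snd i - 1), zs ! Suc (fst i)}"
        using r[OF i] qn valid_nth(1)[OF v] valid_nth(2)[OF v, of "snd i - 1" "Suc (fst i)"]
        by (intro clip_eq) auto
      show "lose T ?h (?f i (?e i \<notin> B h)) \<le> (D - real T + ?G i) / D"
      proof (cases "?bad i")
        case True
        \<comment> \<open>A failed closing attempt discards \<open>J\<close> and \<open>L\<close>.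
          The cost of the fresh state is independent of PhantomBreaker's graph, so no
          \<open>\<delta>\<close> is charged here.\<close>
        have g: "good_fix ?h zs Ms {} {}"
          using good_fix_mono[OF gf next_play(5)[OF lp]] by (simp add: good_fix_def)
        have "lose T ?h (Fix zs Ms {} {}) \<le> (D - real T + ?k * fix_cost) / D"
          using IH[OF g] by (simp add: remaining_cost_fresh)
        then show ?thesis using True e by (simp add: algebra_simps)
      next
        case False
        have v': "valid n ?h (three_opt (snd i) (fst i) zs) (?M i)"
        proof (rule three_opt_valid)
          show "valid n ?h zs Ms" by (rule valid_mono[OF v next_play(5)[OF lp]])
          show "{last zs, zs ! fst i} \<in> maker_elems ?h" "{hd zs, zs ! snd i} \<in> maker_elems ?h"
            using i J1 L1 next_play(5)[OF lp, of "?e i"] by (cases i; auto)+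
          show "{zs ! (snd i - 1), zs ! Suc (fst i)} \<in> maker_elems ?h"
            using next_play(6)[OF lp, of "?e i"] False e by simp
        qed (use r[OF i] in auto)
        have fM: "finite Ms" by (rule valid_finite[OF v])
        \<comment> \<open>The two edges given up inside the path may be missing ones as well, so up
          to three missing edges can disappear at once.\<close>
        have "card (?M i) \<le> card (Ms - {{last zs, hd zs}})" using fM by (intro card_mono) auto
        also have "\<dots> = card Ms - 1" using fM cM by simp
        finally have "card (?M i) \<le> card Ms - 1" .
        moreover have "card Ms > 0" using fM cM by (auto simp: card_gt_0_iff)
        ultimately have cM': "real (card (?M i)) \<le> ?k - 1" by linarith
        have G0: "(D - real T + (?k - 1) * fix_cost) / D \<ge> 0"
          using cM' fix_cost_pos Suc.prems(4) D by (intro divide_nonneg_pos add_nonneg_nonneg mult_nonneg_nonneg) auto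
        show ?thesis
        proof (cases "?M i = {}")
          case True
          then have "lose T ?h (?f i (?e i \<notin> B h)) = 0" using lose_done v' by metis
          then show ?thesis using G0 False by simp
        next
          case nonempty: False
          obtain ws where ws: "start_fix (three_opt (snd i) (fst i) zs) (?M i) = Fix ws (?M i) {} {}"
            "good_fix ?h ws (?M i) {} {}"
            by (rule start_fix_cases[OF v' nonempty])
          have "lose T ?h (Fix ws (?M i) {} {}) \<le> (D - real T + real (card (?M i)) * fix_cost) / D"
            using IH[OF ws(2)] by (auto simp: remaining_cost_fresh)
          also have "\<dots> \<le> (D - real T + (?k - 1) * fix_cost) / D"
            using cM' fix_cost_pos D by (intro divide_right_mono add_left_mono mult_right_mono) auto
          finally show ?thesis using False e ws by simp
        qed
      qed
    next
      have cI: "real (card ?I) = (real width)\<^sup>2" using C by (simp add: power2_eq_square card_cartesian_product)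
      have "(\<Sum>i\<in>?I. ?G i) = real (card ?I) * ((?k - 1) * fix_cost) + real (blocked_pairs (B h) zs J L) * fix_cost"
        using fJL by (simp add: sum.distrib sum_if_card blocked_pairs_def)
      also have "\<dots> = real (card ?I) * ((?k - 1) * fix_cost + pair_cost * real (blocked_pairs (B h) zs J L))"
        unfolding cI pair_cost_def using width_pos by (simp add: field_simps)
      also have "\<dots> = real (card ?I) * (R - 1)"
        unfolding R_def remaining_cost_def using C by simp
      finally show "(\<Sum>i\<in>?I. ?G i) \<le> real (card ?I) * (R - 1)" by simp
    qed (use D in auto)
  qed
qed

lemma start_stage:
  assumes large_board "valid n h ys Ms" "legal_play h" "sparse T h Ms" "T > 0"
  shows "lose T h (start_fix ys Ms) \<le> real (card Ms) * fix_cost / real T"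
proof (cases "Ms = {}")
  case True
  then show ?thesis using lose_done assms(2) by simp
next
  case False
  obtain zs where zs: "start_fix ys Ms = Fix zs Ms {} {}" "good_fix h zs Ms {} {}"
    by (rule start_fix_cases[OF assms(2) False])
  show ?thesis
    using fix_stage[OF assms(1) _ zs(2) assms(3,4), of "real T"] assms(5) zs(1)
    by (simp add: remaining_cost_fresh)
qed

end

section \<open>The case of a slow PhantomBreaker\<close>

text \<open>An end survives a pick among k missing edges with probability 1 - 1 / (2 k). The product
  of these factors decays like \<open>sqrt (M / k)\<close>; this is the step from k to k +
  1.\<close>

lemma sqrt_survival:
  fixes k :: real
  assumes "k \<ge> 1" "M \<ge> 0"
  shows "sqrt (M / k) * (1 - 1 / (2 * k)) \<le> sqrt (M / (k + 1))"
proof (rule real_le_rsqrt)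
  have "(2 * k - 1)\<^sup>2 * (k + 1) = 4 * k ^ 3 - 3 * k + 1" by (simp add: power2_eq_square power3_eq_cube algebra_simps)
  also have "\<dots> \<le> 4 * k ^ 3" using assms(1) by simp
  finally have 1: "(2 * k - 1)\<^sup>2 * (k + 1) \<le> 4 * k ^ 3" .
  have "(1 - 1 / (2 * k))\<^sup>2 = (2 * k - 1)\<^sup>2 / (4 * k\<^sup>2)"
    using assms(1) by (simp add: power2_eq_square field_simps)
  also have "\<dots> / k = (2 * k - 1)\<^sup>2 / (4 * k ^ 3)" by (simp add: power2_eq_square power3_eq_cube)
  also have "\<dots> \<le> 1 / (k + 1)" using 1 assms(1) by (simp add: divide_simps)
  finally have 2: "(1 - 1 / (2 * k))\<^sup>2 / k \<le> 1 / (k + 1)" using assms(1) by simp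
  have "(sqrt (M / k) * (1 - 1 / (2 * k)))\<^sup>2 = M * ((1 - 1 / (2 * k))\<^sup>2 / k)"
    using assms by (simp add: power_mult_distrib)
  also have "\<dots> \<le> M * (1 / (k + 1))" using 2 assms(2) by (rule mult_left_mono)
  finally show "(sqrt (M / k) * (1 - 1 / (2 * k)))\<^sup>2 \<le> M / (k + 1)" by simp
qed

text \<open>The first inequality lets the sum of the terms 1 / sqrt k telescope in
  \<open>growth\<close>; the second bounds one increment, which is charged when a pick must be
  repeated.\<close>

lemma sqrt_increment:
  fixes k :: real
  assumes "k \<ge> 1"
  shows "1 / sqrt k \<le> 3 * (sqrt (k + 1) - sqrt k)" "sqrt k * (sqrt (k + 1) - sqrt k) \<le> 1"
proof -
  have d: "(sqrt (k + 1) - sqrt k) * (sqrt (k + 1) + sqrt k) = 1"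
    using assms by (simp add: algebra_simps)
  have s: "sqrt k \<ge> 1" using assms by simp
  have le: "sqrt k \<le> sqrt (k + 1)" by simp
  have "sqrt (k + 1) \<le> sqrt (4 * k)" using assms by (intro real_sqrt_le_mono) auto
  then have "sqrt (k + 1) + sqrt k \<le> 3 * sqrt k" using assms by (simp add: real_sqrt_mult)
  then have "(sqrt (k + 1) - sqrt k) * (sqrt (k + 1) + sqrt k) \<le> (sqrt (k + 1) - sqrt k) * (3 * sqrt k)"
    using le by (intro mult_left_mono) auto
  then show "1 / sqrt k \<le> 3 * (sqrt (k + 1) - sqrt k)" using d s by (simp add: field_simps)
  have "sqrt k * (sqrt (k + 1) - sqrt k) \<le> (sqrt (k + 1) + sqrt k) * (sqrt (k + 1) - sqrt k)"
    using le s by (intro mult_right_mono) auto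
  then show "sqrt k * (sqrt (k + 1) - sqrt k) \<le> 1" using d by (simp add: mult.commute)
qed

locale slow_breaker_game = hamilton_game +
  fixes m T2 :: nat
  assumes slow: "b \<le> a" and large: large_board and m16: "m \<ge> 16" and m_le: "m \<le> n"
    and m_sq: "16 * n \<le> m * m" and T2_pos: "T2 > 0" and T2_le: "16 * b * (T2 + m div 2) \<le> n"
begin

text \<open>The reserve for all attempts that are not successful picks. Since rotations may close
  missing edges by chance, half of \<open>m\<close> ensures that about \<open>m / 2\<close> of them
  remain.\<close>

definition slack0 :: nat where "slack0 = m div 2"
text \<open>Half of the degree that \<open>sparse\<close> permits; the other half is left to the
  claims during the remaining attempts.\<close>

definition dmax :: real where "dmax = real n / 16"
text \<open>At most 4 n of the at least m^2 / 2 choices of a pick are blocked.\<close>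

definition fail_prob :: real where "fail_prob = 8 * real n / (real m)\<^sup>2"
text \<open>With at least m / 4 free positions a rotation takes at most 4 n / m attempts on average.
  Each is charged two units, one for the reserve and one for the growth of the degrees.\<close>

definition pend_cost :: real where "pend_cost = 8 * real n / real m"
text \<open>A failed pick costs two units, a rotation and another pick. The leading factor 2 absorbs
  the repetition, as \<open>fail_prob\<close> is at most 1 / 2.\<close>

definition pick_cost :: real where "pick_cost = 2 * fail_prob * (2 + pend_cost)"
text \<open>The risk of one unit: the first summand lets the risk reach 1 when the reserve is used
  up, the second covers what one attempt can add through claimed edges and the degree of a new
  end.\<close>

definition scale :: real where "scale = 1 / real slack0 + (12 * real b + 3) / dmax"

text \<open>An end of a missing edge is still such an end after the remaining \<open>c\<close> picks with
  probability about \<open>survival c\<close>, since it is picked with probability \<open>1 / (2 * k)\<close> when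
  \<open>k\<close> edges are missing. The term \<open>growth c\<close> accounts for the edges claimed meanwhile.\<close>

definition survival :: "nat \<Rightarrow> real" where
  "survival c = sqrt ((real m + 1) / (real m + real c + 1))"

definition growth :: "nat \<Rightarrow> real" where
  "growth c = 12 * real b / dmax * (sqrt (real m + 1) * (sqrt (real m + real c + 1) - sqrt (real m + 1)))"

text \<open>A union bound over three failures: the reserve runs out, an end of degree above
  \<open>dmax\<close> is left (Markov for the degree sum \<open>x\<close>), or the closing phase
  takes too long.\<close>

definition risk :: "nat \<Rightarrow> nat \<Rightarrow> real \<Rightarrow> real" where
  "risk c sl x = scale * (real slack0 - real sl + pick_cost * real c) + survival c * x / dmax
     + growth c + real m * fix_cost / real T2"

text \<open>Progress is measured by \<open>c\<close> and not by \<open>card Ms\<close>, because a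
  rotation may happen to close a second missing edge. This uses a unit of the reserve, whence the
  lower bound on \<open>card Ms\<close>.\<close>

definition stage1 :: "nat \<Rightarrow> nat set play \<Rightarrow> nat \<Rightarrow> nat \<Rightarrow> nat list \<Rightarrow> nat set set \<Rightarrow> bool" where
  "stage1 T h c sl ys Ms \<longleftrightarrow> legal_play h \<and> valid n h ys Ms \<and> T = T2 + c + sl \<and>
     length (maker_view h) + c + sl = n - m + slack0 \<and> sl \<le> slack0 \<and>
     card Ms \<le> m + c \<and> m + c + sl \<le> card Ms + slack0"

lemma pos: "real n > 0" "real m > 0" "dmax > 0" "real slack0 \<ge> 1" "fail_prob \<ge> 0" "pend_cost \<ge> 0"
  "pick_cost \<ge> 0" "scale > 0" "fail_prob \<le> 1 / 2" "scale * real slack0 \<ge> 1"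
  "(12 * real b + 3) / dmax \<le> scale" "real slack0 \<le> real m / 2"
proof -
  show n: "real n > 0" using n3 by simp
  show m: "real m > 0" using m16 by simp
  then show dm: "dmax > 0" using n by (simp add: dmax_def)
  show s0: "real slack0 \<ge> 1" "real slack0 \<le> real m / 2" using m16 unfolding slack0_def by linarith+
  show f0: "fail_prob \<ge> 0" by (simp add: fail_prob_def)
  show p0: "pend_cost \<ge> 0" by (simp add: pend_cost_def)
  show "pick_cost \<ge> 0" using f0 p0 by (simp add: pick_cost_def)
  have d: "(12 * real b + 3) / dmax > 0" using dm by (intro divide_pos_pos) auto
  then show "scale > 0" "(12 * real b + 3) / dmax \<le> scale" using s0 unfolding scale_def by (auto intro: add_pos_pos)
  have "scale * real slack0 = 1 + (12 * real b + 3) / dmax * real slack0"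
    using s0 by (simp add: scale_def algebra_simps)
  moreover have "(12 * real b + 3) / dmax * real slack0 \<ge> 0" using d s0 by (intro mult_nonneg_nonneg) auto
  ultimately show "scale * real slack0 \<ge> 1" by linarith
  have "real (16 * n) \<le> real (m * m)" using m_sq by (simp only: of_nat_le_iff)
  then show "fail_prob \<le> 1 / 2" using m by (simp add: fail_prob_def power2_eq_square divide_simps)
qed

lemma survival_bounds: "0 \<le> survival c" "survival c \<le> 1" "survival 0 = 1"
  "survival (Suc c) \<le> survival c"
  by (auto simp: survival_def field_simps intro!: real_sqrt_le_mono)

lemma growth_bounds:
  "growth c \<ge> 0" "survival c * (4 * real b) / dmax \<le> growth (Suc c) - growth c"
  "growth (Suc c) \<le> growth c + 12 * real b / dmax"
proof -
  let ?k = "real m + real c + 1"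
  have k: "?k \<ge> 1" by simp
  have e: "growth (Suc c) - growth c = 12 * real b / dmax * (sqrt (real m + 1) * (sqrt (?k + 1) - sqrt ?k))"
    by (simp add: growth_def algebra_simps)
  have f0: "12 * real b / dmax \<ge> 0" using pos by simp
  have "sqrt (real m + 1) \<le> sqrt ?k" by simp
  then show "growth c \<ge> 0" unfolding growth_def using f0 by (intro mult_nonneg_nonneg) auto
  have "survival c * (4 * real b) / dmax = 4 * real b / dmax * (sqrt (real m + 1) * (1 / sqrt ?k))"
    by (simp add: survival_def real_sqrt_divide mult_ac)
  also have "\<dots> \<le> 4 * real b / dmax * (sqrt (real m + 1) * (3 * (sqrt (?k + 1) - sqrt ?k)))"
    using sqrt_increment(1)[OF k] pos by (intro mult_left_mono) auto
  also have "\<dots> = growth (Suc c) - growth c" unfolding e by simp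
  finally show "survival c * (4 * real b) / dmax \<le> growth (Suc c) - growth c" .
  have "sqrt (real m + 1) * (sqrt (?k + 1) - sqrt ?k) \<le> sqrt ?k * (sqrt (?k + 1) - sqrt ?k)"
    by (intro mult_right_mono) auto
  also have "\<dots> \<le> 1" by (rule sqrt_increment(2)[OF k])
  finally show "growth (Suc c) \<le> growth c + 12 * real b / dmax"
    using mult_left_mono[OF _ f0, of _ 1] e by fastforce
qed

lemma end_cost_nonneg: "real m * fix_cost / real T2 \<ge> 0"
  using fix_cost_pos by simp

lemma risk_trivial:
  assumes "x \<ge> 0" "sl \<le> slack0"
  shows "risk c 0 x \<ge> 1" "risk c sl x \<ge> 0"
proof -
  have "risk c sl x \<ge> scale * (real slack0 - real sl)" for sl
    unfolding risk_def using pos(3,7,8) survival_bounds(1)[of c] growth_bounds(1)[of c] end_cost_nonneg assms(1)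
    by (simp add: distrib_left)
  note * = this
  show "risk c 0 x \<ge> 1" using *[of 0] pos(10) by simp
  have "scale * (real slack0 - real sl) \<ge> 0" using pos(8) assms(2) by simp
  then show "risk c sl x \<ge> 0" using *[of sl] by linarith
qed

text \<open>For \<open>b \<le> a\<close> PhantomBreaker never holds more edges than attempts were
  made. During the picks this leaves free edges at every vertex and bounds the time of a
  repair.\<close>

lemma card_breaker_le:
  assumes "legal_play h"
  shows "card (B h) \<le> length (maker_view h)"
proof -
  have "card (B h) \<le> b * (length (maker_view h) div a)" using assms by (simp add: legal_play_def)
  also have "\<dots> \<le> a * (length (maker_view h) div a)" using slow by simp
  also have "\<dots> \<le> length (maker_view h)" by simp
  finally show ?thesis .
qed

text \<open>One end of degree above \<open>dmax\<close> makes \<open>wdeg / dmax\<close> exceed 1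
  and the bound trivial; otherwise the remaining time is short enough for
  \<open>sparse\<close>.\<close>

lemma stage1_end:
  assumes "stage1 T h 0 sl ys Ms"
  shows "lose T h (start_fix ys Ms) \<le> risk 0 sl (wdeg (B h) Ms)"
proof -
  have lp: "legal_play h" and v: "valid n h ys Ms" and T: "T = T2 + sl" and sl: "sl \<le> slack0"
    and t: "length (maker_view h) + sl = n - m + slack0" and k: "card Ms \<le> m"
    using assms by (auto simp: stage1_def)
  have ge: "risk 0 sl (wdeg (B h) Ms) \<ge> wdeg (B h) Ms / dmax + real m * fix_cost / real T2"
    unfolding risk_def using pos(8) sl growth_bounds(1)[of 0] survival_bounds(3) by simp
  show ?thesis
  proof (cases "\<forall>e\<in>Ms. \<forall>x\<in>e. real (deg (B h) x) \<le> dmax")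
    case True
    have "16 * b * T \<le> 16 * b * (T2 + m div 2)" using sl unfolding T slack0_def by simp
    then have bT: "16 * b * T \<le> n" using T2_le by linarith
    then have "16 * (real b * real T) \<le> real n" by (metis mult.assoc of_nat_le_iff of_nat_mult of_nat_numeral)
    then have bT': "real b * real T \<le> real n / 16" by simp
    have "sparse T h Ms" unfolding sparse_def
    proof (intro conjI ballI)
      have "card (B h) \<le> 2 * n" using card_breaker_le[OF lp] t m_le unfolding slack0_def by linarith
      moreover have "b * T \<le> n" using bT by linarith
      moreover have "4 * n \<le> 4 * b * n" using b_pos by simp
      ultimately show "card (B h) + b * T \<le> 4 * b * n" by linarith
      fix e x assume "e \<in> Ms" "x \<in> e"
      then show "real (deg (B h) x) + real b * real T \<le> real n / 8"
        using True bT' unfolding dmax_def by fastforce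
    qed
    then have "lose T h (start_fix ys Ms) \<le> real (card Ms) * fix_cost / real T"
      using T T2_pos by (intro start_stage[OF large v lp]) auto
    also have "\<dots> \<le> real m * fix_cost / real T2"
      using k T T2_pos fix_cost_pos by (intro frac_le mult_right_mono mult_nonneg_nonneg) auto
    also have "\<dots> \<le> risk 0 sl (wdeg (B h) Ms)" using ge pos(3) by (smt (verit) divide_nonneg_pos wdeg_nonneg)
    finally show ?thesis .
  next
    case False
    then obtain e x where ex: "e \<in> Ms" "x \<in> e" "real (deg (B h) x) > dmax" by force
    then have "wdeg (B h) Ms > dmax"
      using wdeg_ge_deg[OF valid_finite[OF v] ex(1) valid_card2(3)[OF v n3 ex(1)] ex(2), of "B h"] by linarith
    then have "wdeg (B h) Ms / dmax > 1" using pos(3) by simp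
    then show ?thesis using ge end_cost_nonneg lose_le_1[of T h "start_fix ys Ms"] by linarith
  qed
qed

section \<open>Induction through the random picks\<close>

definition pick_claim :: "nat \<Rightarrow> bool" where
  "pick_claim T \<longleftrightarrow> (\<forall>h c sl ys Ms. stage1 T h c sl ys Ms \<longrightarrow>
     lose T h (resume c ys Ms) \<le> risk c sl (wdeg (B h) Ms))"

text \<open>The degree of \<open>last zs\<close> is left out: this end is going to be replaced, so a
  failed pick removes it from the balance just like a successful one. Hence blocking an end of high
  degree does not help to preserve it.\<close>

definition pend_claim :: "nat \<Rightarrow> bool" where
  "pend_claim T \<longleftrightarrow> (\<forall>h c sl zs Ms. stage1 T h c sl zs Ms \<and> c > 0 \<and> {last zs, hd zs} \<in> Ms \<longrightarrow>
     lose T h (Pend c zs Ms) \<le>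
       risk c sl (wdeg (B h) Ms - real (deg (B h) (last zs))) + scale * pend_cost)"

lemma wdeg_minus_deg:
  assumes "valid n h zs Ms" "e \<in> Ms" "x \<in> e"
  shows "wdeg C Ms - real (deg C x) \<ge> 0"
  using wdeg_ge_deg[OF valid_finite[OF assms(1)] assms(2) valid_card2(3)[OF assms(1) n3 assms(2)] assms(3)] by simp

lemma next_wdeg_minus_deg:
  assumes "legal_play h" "valid n h zs Ms"
  shows "wdeg (B (attempt a \<tau> e h)) Ms - real (deg (B (attempt a \<tau> e h)) x)
    \<le> wdeg (B h) Ms - real (deg (B h) x) + 4 * real b"
proof -
  have "real (deg (B h) x) \<le> real (deg (B (attempt a \<tau> e h)) x)"
    using deg_mono[OF legal_play_finite[OF next_play(1)[OF assms(1)]] next_play(2)[OF assms(1)]] by simp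
  then show ?thesis using next_play_wdeg(2)[OF assms(1,2), of e] by linarith
qed

lemma risk_mono: "x \<le> y \<Longrightarrow> risk c sl x \<le> risk c sl y"
  unfolding risk_def using survival_bounds(1)[of c] pos(3)
  by (intro add_mono divide_right_mono mult_left_mono order_refl) auto

lemma pend_step:
  assumes IH: "pick_claim T" "pend_claim T"
  shows "pend_claim (Suc T)"
  unfolding pend_claim_def
proof (intro allI impI, elim conjE)
  fix h c sl zs Ms
  assume st: "stage1 (Suc T) h c sl zs Ms" and c: "c > 0" and cM: "{last zs, hd zs} \<in> Ms"
  define x where "x = wdeg (B h) Ms - real (deg (B h) (last zs))"
  have lp: "legal_play h" and v: "valid n h zs Ms" and T: "Suc T = T2 + c + sl" and sl: "sl \<le> slack0"
    and t: "length (maker_view h) + c + sl = n - m + slack0" and k: "card Ms \<le> m + c" "m + c + sl \<le> card Ms + slack0"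
    using st by (auto simp: stage1_def)
  have x0: "x \<ge> 0" unfolding x_def by (rule wdeg_minus_deg[OF v cM]) simp
  show "lose (Suc T) h (Pend c zs Ms) \<le> risk c sl x + scale * pend_cost"
  proof (cases "sl = 0")
    case True
    then show ?thesis using risk_trivial(1)[OF x0, of 0 c] pos(6,8) lose_le_1[of "Suc T" h "Pend c zs Ms"]
      by (smt (verit) mult_nonneg_nonneg zero_le)
  next
    case False
    let ?N = "real (n - 2)"
    let ?I = "{..<n - 2}"
    let ?e = "\<lambda>j. clip n {last zs, zs ! j}"
    let ?bad = "\<lambda>j. {last zs, zs ! j} \<in> B h"
    let ?s = "survival c / dmax"
    let ?G = "\<lambda>j. risk c (sl - 1) (x + 4 * real b) + ?s * real (deg (B h) (zs ! Suc j))
       + (if ?bad j then scale * pend_cost else 0)"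
    have s0: "?s \<ge> 0" using survival_bounds(1)[of c] pos(3) by simp
    have rs: "risk c (sl - 1) (x + 4 * real b + y) = risk c (sl - 1) (x + 4 * real b) + ?s * y" for y
      unfolding risk_def by (simp add: algebra_simps add_divide_distrib)
    have n6: "n \<ge> 100" using large by (simp add: large_board_def)
    show ?thesis
    proof (rule lose_average[where e = ?e and f = "attempt_flip n c c zs Ms" and I = ?I and g = ?G])
      show "hamilton_step n width (Pend c zs Ms) = map_pmf (\<lambda>j. (?e j, attempt_flip n c c zs Ms j)) (pmf_of_set ?I)"
        by simp
      have "0 \<in> ?I" using n6 by simp
      then show "?I \<noteq> {}" by blast
      fix j assume j: "j \<in> ?I"
      then have jn: "Suc j < n" "j < n - 1" by auto
      have e: "?e j = {last zs, zs ! j}"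
        using jn valid_nth(1)[OF v] valid_nth(2)[OF v, of "n - 1" j] valid_nth(3)[OF v]
        by (intro clip_eq) auto
      let ?h = "attempt a \<tau> (?e j) h"
      have st': "stage1 T ?h c (sl - 1) ys' Ms'"
        if "valid n ?h ys' Ms'" "card Ms' \<le> card Ms" "card Ms \<le> Suc (card Ms')" for ys' Ms'
        unfolding stage1_def using that next_play(1,4)[OF lp, of "?e j"] T sl t k False by auto
      show "lose T ?h (attempt_flip n c c zs Ms j (?e j \<notin> B h)) \<le> ?G j"
      proof (cases "?bad j")
        case True
        have "stage1 T ?h c (sl - 1) zs Ms"
          by (rule st') (auto intro: valid_mono[OF v next_play(5)[OF lp]])
        then have "lose T ?h (Pend c zs Ms) \<le>
          risk c (sl - 1) (wdeg (B ?h) Ms - real (deg (B ?h) (last zs))) + scale * pend_cost"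
          using IH(2) c cM unfolding pend_claim_def by blast
        also have "\<dots> \<le> risk c (sl - 1) (x + 4 * real b) + scale * pend_cost"
          using next_wdeg_minus_deg[OF lp v, of "?e j" "last zs"] unfolding x_def
          by (intro add_right_mono risk_mono) auto
        also have "\<dots> \<le> ?G j"
          using True mult_nonneg_nonneg[OF s0, of "real (deg (B h) (zs ! Suc j))"] by simp
        finally show ?thesis using True e by (simp add: attempt_flip_def)
      next
        case False
        have own: "{last zs, zs ! j} \<in> maker_elems ?h" using next_play(6)[OF lp, of "?e j"] False e by simp
        note fm = flip_missing[OF v n3 cM jn(1) next_play(5)[OF lp] own]
        have le: "wdeg (B h) (flip_missing zs j Ms) \<le> x + real (deg (B h) (zs ! Suc j))"
        proof (cases "{zs ! j, zs ! Suc j} \<in> Ms")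
          case True
          then show ?thesis using fm(5)[OF True, of "\<lambda>x. real (deg (B h) x)"] by (simp add: wdeg_def x_def)
        next
          case False
          then show ?thesis using fm(6)[OF False, of "\<lambda>x. real (deg (B h) x)"] by (simp add: wdeg_def x_def)
        qed
        have "stage1 T ?h c (sl - 1) (two_opt j zs) (flip_missing zs j Ms)"
          by (rule st'[OF fm(1,3,4)])
        then have "lose T ?h (resume c (two_opt j zs) (flip_missing zs j Ms)) \<le>
          risk c (sl - 1) (wdeg (B ?h) (flip_missing zs j Ms))"
          using IH(1) unfolding pick_claim_def by blast
        also have "\<dots> \<le> risk c (sl - 1) (x + 4 * real b + real (deg (B h) (zs ! Suc j)))"
          using le next_play_wdeg(2)[OF lp fm(1), of "?e j"] by (intro risk_mono) linarith
        also have "\<dots> \<le> ?G j" unfolding rs using False by simp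
        finally show ?thesis using False e by (simp add: attempt_flip_def)
      qed
    next
      \<comment> \<open>Both \<open>c\<close> and \<open>sl\<close> are positive, so fewer than
        \<open>n - m + slack0\<close> attempts have been made.\<close>
      have cB: "card (B h) + m - slack0 + 1 \<le> n" using card_breaker_le[OF lp] t c False m_le
        unfolding slack0_def by linarith
      \<comment> \<open>The new end is uniform over \<open>n - 2\<close> vertices, so its mean
        degree is at most 3; this is the 3 in \<open>scale\<close>.\<close>
      have sdeg: "(\<Sum>j\<in>?I. real (deg (B h) (zs ! Suc j))) \<le> 3 * ?N"
      proof -
        have "(\<Sum>j\<in>?I. deg (B h) (zs ! Suc j)) \<le> 2 * card (B h)"
        proof (rule sum_deg_inj)
          show "inj_on (\<lambda>j. zs ! Suc j) ?I" using valid_nth(2)[OF v] by (auto simp: inj_on_def)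
          show "(\<lambda>j. zs ! Suc j) ` ?I \<subseteq> {..<n}" using valid_nth(1)[OF v] by auto
        qed (use lp in \<open>simp add: legal_play_def\<close>)
        also have "\<dots> \<le> 3 * (n - 2)" using cB n6 m16 unfolding slack0_def by linarith
        finally have "real (\<Sum>j\<in>?I. deg (B h) (zs ! Suc j)) \<le> real (3 * (n - 2))" by (simp only: of_nat_le_iff)
        then show ?thesis by simp
      qed
      have blocked: "real (card {j \<in> ?I. ?bad j}) \<le> ?N - real m / 4"
      proof -
        have "card {j \<in> ?I. ?bad j} \<le> deg (B h) (last zs)"
          by (intro card_blocked_le_deg legal_play_finite[OF lp] inj_on_subset[OF valid_nth(5)[OF v]]) auto
        also have "\<dots> \<le> card (B h)" by (rule deg_le_card[OF legal_play_finite[OF lp]])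
        finally have "card {j \<in> ?I. ?bad j} + (m - slack0 - 1) \<le> n - 2"
          using cB n6 m16 unfolding slack0_def by linarith
        moreover have "real (m - slack0 - 1) \<ge> real m / 4" using m16 unfolding slack0_def by linarith
        ultimately show ?thesis by linarith
      qed
      have pb: "pend_cost * real (card {j \<in> ?I. ?bad j}) \<le> ?N * pend_cost - 2 * ?N"
      proof -
        have "pend_cost * real (card {j \<in> ?I. ?bad j}) \<le> pend_cost * (?N - real m / 4)"
          using blocked pos(6) by (rule mult_left_mono)
        also have "\<dots> = ?N * pend_cost - 2 * real n" using pos(2) by (simp add: pend_cost_def field_simps)
        finally show ?thesis by simp
      qed
      have rr: "risk c (sl - 1) (x + 4 * real b) = risk c sl x + scale + ?s * (4 * real b)"
        using False unfolding risk_def by (simp add: algebra_simps add_divide_distrib)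
      have "(\<Sum>j\<in>?I. ?G j) = ?N * risk c (sl - 1) (x + 4 * real b)
          + ?s * (\<Sum>j\<in>?I. real (deg (B h) (zs ! Suc j))) + scale * (pend_cost * real (card {j \<in> ?I. ?bad j}))"
        by (simp add: sum.distrib sum_if_card sum_distrib_left algebra_simps)
      also have "\<dots> \<le> ?N * risk c (sl - 1) (x + 4 * real b) + ?s * (3 * ?N) + scale * (?N * pend_cost - 2 * ?N)"
        using sdeg pb s0 pos(8) by (intro add_mono mult_left_mono order_refl) auto
      also have "\<dots> = ?N * (risk c sl x + scale * pend_cost) + ?N * (?s * (4 * real b + 3) - scale)"
        unfolding rr by (simp add: algebra_simps)
      also have "\<dots> \<le> ?N * (risk c sl x + scale * pend_cost)"
      proof -
        have "?s * (4 * real b + 3) \<le> (12 * real b + 3) / dmax"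
        proof -
          have "survival c * (4 * real b + 3) \<le> 1 * (12 * real b + 3)"
            using survival_bounds(1,2)[of c] by (intro mult_mono) auto
          then show ?thesis using pos(3) by (simp add: divide_right_mono)
        qed
        then have "?s * (4 * real b + 3) - scale \<le> 0" using pos(11) by linarith
        then have "?N * (?s * (4 * real b + 3) - scale) \<le> 0" by (intro mult_nonneg_nonpos) auto
        then show ?thesis by linarith
      qed
      finally show "(\<Sum>j\<in>?I. ?G j) \<le> real (card ?I) * (risk c sl x + scale * pend_cost)" by simp
    qed auto
  qed
qed

lemma pick_step:
  assumes IH: "pick_claim T" "pend_claim T"
  shows "pick_claim (Suc T)"
  unfolding pick_claim_def
proof (intro allI impI)
  fix h c sl ys Ms
  assume st: "stage1 (Suc T) h c sl ys Ms"
  define D where "D = wdeg (B h) Ms"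
  have lp: "legal_play h" and v: "valid n h ys Ms" and T: "Suc T = T2 + c + sl" and sl: "sl \<le> slack0"
    and t: "length (maker_view h) + c + sl = n - m + slack0" and k: "card Ms \<le> m + c" "m + c + sl \<le> card Ms + slack0"
    using st by (auto simp: stage1_def)
  show "lose (Suc T) h (resume c ys Ms) \<le> risk c sl (wdeg (B h) Ms)"
  proof (cases c)
    case 0
    then show ?thesis using stage1_end st by (simp add: resume_def)
  next
    case (Suc c')
    let ?k = "real (card Ms)"
    let ?I = "pick_choices ys Ms"
    let ?z = "\<lambda>i. cut_at ys (fst (fst i)) (snd (fst i))"
    let ?u = "\<lambda>i. fst (fst i)"
    let ?e = "\<lambda>i. clip n {?u i, ?z i ! snd i}"
    let ?bad = "\<lambda>i. {?u i, ?z i ! snd i} \<in> B h"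
    let ?pen = "scale * (2 + pend_cost + pick_cost)"
    let ?s = "survival c' / dmax"
    \<comment> \<open>Only the degree of the tail is credited; that of \<open>zs ! j\<close>, which
      ceases to be an end too, is given away.\<close>
    let ?G = "\<lambda>i. risk c' sl (D + 4 * real b) - ?s * real (deg (B h) (?u i)) + (if ?bad i then ?pen else 0)"
    have kk: "?k \<ge> real m / 2 + 1" using k(2) Suc pos(12) by linarith
    have s0: "?s \<ge> 0" using survival_bounds(1)[of c'] pos(3) by simp
    have rs: "risk c' sl (D - y + 4 * real b) = risk c' sl (D + 4 * real b) - ?s * y" for y
      unfolding risk_def by (simp add: algebra_simps add_divide_distrib diff_divide_distrib)
    note pc = pick_choices_facts[OF v n3]
    have cI: "real (card ?I) = 2 * ?k * (?k - 1)"
      unfolding pc(2) using kk pos(2) by (simp add: of_nat_diff)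
    have cI_pos: "real (card ?I) > 0" unfolding cI using kk pos(2) by (intro mult_pos_pos) auto
    show ?thesis unfolding D_def[symmetric]
    proof (rule lose_average[where e = ?e and f = "\<lambda>i. attempt_flip n c (c - 1) (?z i) Ms (snd i)" and I = ?I and g = ?G])
      show "hamilton_step n width (resume c ys Ms) =
        map_pmf (\<lambda>i. (?e i, attempt_flip n c (c - 1) (?z i) Ms (snd i))) (pmf_of_set ?I)"
        using Suc by (simp add: resume_def)
      show "finite ?I" by (rule pc(1))
      show "?I \<noteq> {}" using cI_pos by auto
      fix i assume i: "i \<in> ?I"
      define zs where "zs = ?z i"
      define j where "j = snd i"
      have p: "fst i \<in> arcs Ms" and j: "j \<in> missing_pos zs Ms" using i by (auto simp: pick_choices_def zs_def j_def)
      note vz = valid_cut_at[OF v n3 p, folded zs_def]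
      have len: "length zs = n" by (rule valid_length[OF vz(1)])
      have jn: "Suc j < n" "{zs ! j, zs ! Suc j} \<in> Ms" using j len by (auto simp: missing_pos_def)
      have cM: "{last zs, hd zs} \<in> Ms" using vz by simp
      have u: "?u i = last zs" using vz by simp
      have e: "?e i = {last zs, zs ! j}" unfolding zs_def[symmetric] unfolding u j_def[symmetric]
        using jn valid_nth(1)[OF vz(1)] valid_nth(2)[OF vz(1), of "n - 1" j] valid_nth(3)[OF vz(1)]
        by (intro clip_eq) auto
      let ?h = "attempt a \<tau> (?e i) h"
      have Gi: "?G i = risk c' sl (D + 4 * real b) - ?s * real (deg (B h) (last zs))
          + (if {last zs, zs ! j} \<in> B h then ?pen else 0)"
        unfolding zs_def[symmetric] unfolding u j_def[symmetric] by (rule refl)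
      have "lose T ?h (attempt_flip n c (c - 1) zs Ms j (?e i \<notin> B h)) \<le> ?G i"
      proof (cases "{last zs, zs ! j} \<in> B h")
        case False
        have own: "{last zs, zs ! j} \<in> maker_elems ?h" using next_play(6)[OF lp, of "?e i"] False e by simp
        note fm = flip_missing[OF vz(1) n3 cM jn(1) next_play(5)[OF lp] own]
        have cpos: "card Ms > 0" using kk pos(2) by linarith
        have "stage1 T ?h c' sl (two_opt j zs) (flip_missing zs j Ms)"
          unfolding stage1_def using fm(1) fm(2)[OF jn(2)] next_play(1,4)[OF lp, of "?e i"] T sl t k Suc cpos by auto
        then have "lose T ?h (resume c' (two_opt j zs) (flip_missing zs j Ms)) \<le>
          risk c' sl (wdeg (B ?h) (flip_missing zs j Ms))"
          using IH(1) unfolding pick_claim_def by blast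
        also have "\<dots> \<le> risk c' sl (D - real (deg (B h) (last zs)) + 4 * real b)"
        proof (rule risk_mono)
          have "wdeg (B h) (flip_missing zs j Ms) \<le> D - real (deg (B h) (last zs))"
            using fm(5)[OF jn(2), of "\<lambda>x. real (deg (B h) x)"] by (simp add: wdeg_def D_def)
          then show "wdeg (B ?h) (flip_missing zs j Ms) \<le> D - real (deg (B h) (last zs)) + 4 * real b"
            using next_play_wdeg(2)[OF lp fm(1), of "?e i"] by linarith
        qed
        also have "\<dots> = ?G i" unfolding Gi rs using False by simp
        finally show "lose T ?h (attempt_flip n c (c - 1) zs Ms j (?e i \<notin> B h)) \<le> ?G i"
          using False e Suc by (simp add: attempt_flip_def)
      next
        case True
        define y where "y = D - real (deg (B h) (last zs)) + 4 * real b"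
        have y0: "y \<ge> 0"
          using wdeg_minus_deg[OF vz(1) cM, of "last zs" "B h"] by (simp add: y_def D_def)
        have G: "?G i = risk c' sl y + ?pen"
          unfolding Gi y_def rs using True by simp
        have pen0: "?pen \<ge> 0" using pos(6,7,8) by simp
        show "lose T ?h (attempt_flip n c (c - 1) zs Ms j (?e i \<notin> B h)) \<le> ?G i"
        proof (cases "sl = 0")
          case True
          then show ?thesis unfolding G using risk_trivial(1)[OF y0, of 0 c'] pen0
              lose_le_1[of T ?h "attempt_flip n c (c - 1) zs Ms j (?e i \<notin> B h)"] by simp
        next
          case sl1: False
          have "stage1 T ?h c (sl - 1) zs Ms"
            unfolding stage1_def using valid_mono[OF vz(1) next_play(5)[OF lp]]
              next_play(1,4)[OF lp, of "?e i"] T sl t k Suc sl1 by auto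
          then have "lose T ?h (Pend c zs Ms) \<le>
            risk c (sl - 1) (wdeg (B ?h) Ms - real (deg (B ?h) (last zs))) + scale * pend_cost"
            using IH(2) Suc cM unfolding pend_claim_def by blast
          also have "\<dots> \<le> risk c (sl - 1) y + scale * pend_cost"
            using next_wdeg_minus_deg[OF lp vz(1), of "?e i" "last zs"] unfolding y_def D_def
            by (intro add_right_mono risk_mono) auto
          also have "\<dots> \<le> risk c' sl y + ?pen"
          proof -
            have 1: "survival c * y / dmax \<le> survival c' * y / dmax"
              using survival_bounds(4)[of c'] y0 pos(3) Suc by (intro divide_right_mono mult_right_mono) auto
            \<comment> \<open>Of the two units for a failure, one pays for this return from
              \<open>c'\<close> to \<open>c\<close> in \<open>growth\<close>, the other for the
              attempt taken from the reserve.\<close>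
            have "12 * real b / dmax \<le> (12 * real b + 3) / dmax" using pos(3) by (intro divide_right_mono) auto
            then have 2: "growth c \<le> growth c' + scale"
              using growth_bounds(3)[of c'] pos(11) Suc by simp
            show ?thesis using 1 2 sl1 Suc unfolding risk_def by (simp add: algebra_simps)
          qed
          also have "\<dots> = ?G i" by (rule G[symmetric])
          finally show ?thesis using True e by (simp add: attempt_flip_def)
        qed
      qed
      then show "lose T ?h (attempt_flip n c (c - 1) (?z i) Ms (snd i) (?e i \<notin> B h)) \<le> ?G i"
        by (simp only: zs_def j_def)
    next
      have cB: "card (B h) \<le> n" using card_breaker_le[OF lp] t Suc m_le unfolding slack0_def by linarith
      have blocked: "real (card {i \<in> ?I. ?bad i}) \<le> real (card ?I) * fail_prob"
      proof -
        have "real (card {i \<in> ?I. ?bad i}) \<le> wdeg (B h) Ms"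
          by (rule card_pick_blocked[OF v n3 legal_play_finite[OF lp]])
        also have "\<dots> \<le> 4 * real (card (B h))"
          using lp by (intro wdeg_le_card[OF v n3]) (simp add: legal_play_def)
        also have "\<dots> \<le> 4 * real n" using cB by simp
        also have "\<dots> = 2 * (real m / 2) * (real m / 2) * fail_prob"
          using pos(2) by (simp add: fail_prob_def power2_eq_square)
        also have "\<dots> \<le> real (card ?I) * fail_prob"
          unfolding cI using kk pos(2,5) by (intro mult_right_mono mult_mono) auto
        finally show ?thesis .
      qed
      have sdeg: "(\<Sum>i\<in>?I. real (deg (B h) (?u i))) = (?k - 1) * D"
        unfolding pc(3)[of "\<lambda>x. real (deg (B h) x)"] D_def wdeg_def using kk pos(2) by (simp add: of_nat_diff)
      have "(\<Sum>i\<in>?I. ?G i) = real (card ?I) * risk c' sl (D + 4 * real b)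
          - ?s * (\<Sum>i\<in>?I. real (deg (B h) (?u i))) + ?pen * real (card {i \<in> ?I. ?bad i})"
        by (simp only: sum.distrib sum_subtractf sum_if_card[OF pc(1)] sum_distrib_left[symmetric] sum_constant mult.commute)
      also have "\<dots> \<le> real (card ?I) * risk c' sl (D + 4 * real b)
          - ?s * ((?k - 1) * D) + ?pen * (real (card ?I) * fail_prob)"
        unfolding sdeg using blocked pos(6,7,8) by (intro add_left_mono mult_left_mono) auto
      also have "(?k - 1) * D = real (card ?I) * (D / (2 * ?k))" unfolding cI using kk pos(2) by (simp add: field_simps)
      also have "real (card ?I) * risk c' sl (D + 4 * real b) - ?s * (real (card ?I) * (D / (2 * ?k)))
          + ?pen * (real (card ?I) * fail_prob) =
        real (card ?I) * (risk c' sl (D + 4 * real b) - ?s * (D / (2 * ?k)) + ?pen * fail_prob)"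
        by (simp add: algebra_simps)
      also have "\<dots> \<le> real (card ?I) * risk c sl D"
      proof (rule mult_left_mono)
        have D0: "D \<ge> 0" by (simp add: D_def)
        \<comment> \<open>The tail is uniform over \<open>2 * card Ms\<close> ends, and
          \<open>card Ms\<close> is at most \<open>m + c\<close>; so an end is picked at least as
          often as \<open>survival\<close> assumes.\<close>
        have A1: "survival c' * (1 - 1 / (2 * ?k)) \<le> survival c"
        proof -
          have kc: "?k \<le> real m + real c' + 1" using k(1) Suc by simp
          have "1 / (2 * (real m + real c' + 1)) \<le> 1 / (2 * ?k)"
            using kc kk pos(2) by (intro divide_left_mono) auto
          then have "survival c' * (1 - 1 / (2 * ?k)) \<le> survival c' * (1 - 1 / (2 * (real m + real c' + 1)))"
            using survival_bounds(1)[of c'] by (intro mult_left_mono) auto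
          also have "\<dots> \<le> survival c"
            unfolding survival_def using sqrt_survival[of "real m + real c' + 1" "real m + 1"] Suc
            by (simp add: add_ac)
          finally show ?thesis .
        qed
        have A: "survival c' * D / dmax - ?s * (D / (2 * ?k)) \<le> survival c * D / dmax"
        proof -
          have "survival c' * D / dmax - ?s * (D / (2 * ?k)) = survival c' * (1 - 1 / (2 * ?k)) * (D / dmax)"
            by (simp add: algebra_simps)
          also have "\<dots> \<le> survival c * (D / dmax)" using A1 D0 pos(3) by (intro mult_right_mono) auto
          finally show ?thesis by simp
        qed
        have Bb: "survival c' * (4 * real b) / dmax \<le> growth c - growth c'"
          using growth_bounds(2)[of c'] Suc by simp
        have C: "?pen * fail_prob \<le> scale * pick_cost"
        proof -
          have "fail_prob * pick_cost \<le> (1 / 2) * pick_cost" using pos(7,9) by (intro mult_right_mono) auto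
          then have "(2 + pend_cost + pick_cost) * fail_prob \<le> pick_cost"
            by (simp add: pick_cost_def algebra_simps)
          from mult_left_mono[OF this less_imp_le[OF pos(8)]] show ?thesis by (simp add: mult.assoc)
        qed
        show "risk c' sl (D + 4 * real b) - ?s * (D / (2 * ?k)) + ?pen * fail_prob \<le> risk c sl D"
          using A Bb C Suc unfolding risk_def by (simp add: algebra_simps add_divide_distrib)
      qed simp
      finally show "(\<Sum>i\<in>?I. ?G i) \<le> real (card ?I) * risk c sl D" .
    qed
  qed
qed

lemma stage1_claims: "pick_claim T \<and> pend_claim T"
proof (induction T)
  case 0
  show ?case using T2_pos by (auto simp: pick_claim_def pend_claim_def stage1_def)
next
  case (Suc T)
  then show ?case using pick_step pend_step by blast
qed

lemma initial_valid: "valid n [] [0..<n] (set (cycle_edges [0..<n]))"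
  by (auto simp: valid_def)

lemma slow_breaker_bound:
  "success_prob (hamilton_cycles n) a \<tau> (hamilton_step n width) {0, 1} (T2 + (n - m) + slack0) []
     (resume (n - m) [0..<n] (set (cycle_edges [0..<n])))
   \<ge> 1 - (scale * pick_cost * real n + 12 * real b / dmax * (sqrt (real m + 1) * sqrt (real n + 1))
      + real m * fix_cost / real T2)"
proof -
  let ?M = "set (cycle_edges [0..<n])"
  have "distinct (cycle_edges [0..<n])" using n3 by (intro distinct_cycle_edges) auto
  then have cM: "card ?M = n" using n3 by (simp add: distinct_card cycle_edges_def)
  have "stage1 (T2 + (n - m) + slack0) [] (n - m) slack0 [0..<n] ?M"
    unfolding stage1_def using initial_valid legal_play_Nil cM m_le by simp
  then have "lose (T2 + (n - m) + slack0) [] (resume (n - m) [0..<n] ?M) \<le> risk (n - m) slack0 (wdeg (B []) ?M)"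
    using stage1_claims unfolding pick_claim_def by blast
  also have "wdeg (B []) ?M = 0" by (simp add: wdeg_def deg_def breaker_elems_def)
  also have "risk (n - m) slack0 0 = scale * (pick_cost * real (n - m)) + growth (n - m) + real m * fix_cost / real T2"
    by (simp add: risk_def)
  also have "\<dots> \<le> scale * pick_cost * real n + 12 * real b / dmax * (sqrt (real m + 1) * sqrt (real n + 1))
      + real m * fix_cost / real T2"
  proof (intro add_mono order_refl)
    show "scale * (pick_cost * real (n - m)) \<le> scale * pick_cost * real n"
      using pos(7,8) by (simp add: mult.assoc mult_left_mono)
    have "sqrt (real m + real (n - m) + 1) - sqrt (real m + 1) \<le> sqrt (real n + 1)"
      using m_le by (simp add: of_nat_diff)
    then show "growth (n - m) \<le> 12 * real b / dmax * (sqrt (real m + 1) * sqrt (real n + 1))"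
      unfolding growth_def using pos(3) by (intro mult_left_mono) auto
  qed
  finally show ?thesis by (simp add: lose_def)
qed

end

section \<open>The case of a fast PhantomBreaker\<close>

definition hits :: "'a set set \<Rightarrow> 'a set \<Rightarrow> nat" where
  "hits Ms S = (\<Sum>e\<in>Ms. card (e \<inter> S))"

lemma real_hits:
  assumes "\<And>e. e \<in> Ms \<Longrightarrow> finite e"
  shows "real (hits Ms S) = (\<Sum>e\<in>Ms. \<Sum>x\<in>e. if x \<in> S then 1 else 0)"
  unfolding hits_def of_nat_sum
  by (intro sum.cong refl) (simp add: assms sum.If_cases Int_def)

lemma binomial_Suc_le: "real (i choose Suc k) \<le> real i * real (i choose k)"
proof (cases "k < i")
  case True
  have "Suc k * (i choose Suc k) = (i choose k) * (i - k)"
    using binomial_absorption[of k i] binomial_absorb_comp[of i k] True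
    by (metis binomial_absorb_comp binomial_absorption mult.commute)
  moreover have "(i choose Suc k) \<le> Suc k * (i choose Suc k)" by simp
  moreover have "(i choose k) * (i - k) \<le> (i choose k) * i" by simp
  ultimately have "(i choose Suc k) \<le> i * (i choose k)" by (metis le_trans mult.commute)
  then show ?thesis by (metis of_nat_le_iff of_nat_mult)
qed (simp add: binomial_eq_0)

text \<open>The picks are divided into windows of length \<open>r\<close>, so short that no degree
  grows by more than \<open>m / 8\<close> within one. \<open>K\<close> bounds the number of ends of
  degree at least \<open>m / 8\<close>, and \<open>\<gamma>\<close> the probability of a favourable
  window from below.\<close>

locale fast_breaker_game = hamilton_game +
  fixes m T2 r K :: nat and \<gamma> :: real
  assumes large: large_board and m_pos: "m > 0" and m_le: "4 * m \<le> n"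
    and T2_pos: "T2 > 0" and T2_le: "16 * b * T2 \<le> n" and fix_ok: "real m * fix_cost / real T2 \<le> 1 / 2"
    and r_le: "8 * b * r \<le> m" and K: "32 * b * n \<le> K * m"
    and \<gamma>_pos: "\<gamma> \<ge> 0"
    and \<rho>_nonneg: "1 - 2 * real b * real n / (real m)\<^sup>2 - 1 / (4 * real n) \<ge> 0"
    and \<gamma>_le: "\<And>N. N \<le> K \<Longrightarrow>
      \<gamma> \<le> (1 - 2 * real b * real n / (real m)\<^sup>2 - 1 / (4 * real n)) ^ r * real (r choose N) / (4 * real n) ^ N"
begin

definition \<rho> :: real where "\<rho> = 1 - 2 * real b * real n / (real m)\<^sup>2 - 1 / (4 * real n)"

text \<open>A lower bound for the probability that in a window of \<open>i\<close> picks none fails and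
  \<open>N\<close> dangerous ends get joined.\<close>

definition chance :: "nat \<Rightarrow> nat \<Rightarrow> real" where
  "chance i N = \<rho> ^ i * real (i choose N) / (4 * real n) ^ N"

lemma \<rho>_bounds: "0 \<le> \<rho>" "\<rho> \<le> 1"
proof -
  show "0 \<le> \<rho>" using \<rho>_nonneg by (simp add: \<rho>_def)
  have "0 \<le> 2 * real b * real n / (real m)\<^sup>2" "0 \<le> 1 / (4 * real n)" by simp_all
  then show "\<rho> \<le> 1" unfolding \<rho>_def by linarith
qed

lemma chance_nonneg: "chance i N \<ge> 0"
  unfolding chance_def using \<rho>_bounds by simp

lemma chance_Suc_le: "i \<le> 4 * n \<Longrightarrow> chance i (Suc N) \<le> chance i N"
proof -
  assume i: "i \<le> 4 * n"
  have "real (i choose Suc N) \<le> real i * real (i choose N)" by (rule binomial_Suc_le)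
  also have "\<dots> \<le> 4 * real n * real (i choose N)" using i by (intro mult_right_mono) auto
  finally have "real (i choose Suc N) / (4 * real n) \<le> real (i choose N)"
    using n3 by (simp add: divide_simps mult_ac)
  then have "\<rho> ^ i * (real (i choose Suc N) / (4 * real n)) / (4 * real n) ^ N \<le> \<rho> ^ i * real (i choose N) / (4 * real n) ^ N"
    using \<rho>_bounds by (intro divide_right_mono mult_left_mono) auto
  then show ?thesis by (simp add: chance_def)
qed

lemma chance_antimono: "i \<le> 4 * n \<Longrightarrow> N \<le> N' \<Longrightarrow> chance i N' \<le> chance i N"
  by (rule lift_Suc_antimono_le[where f = "chance i"]) (rule chance_Suc_le)

text \<open>Pascal's rule: a pick hits a dangerous end with probability at least 1 / (4 n) or
  succeeds otherwise. The subtraction of 1 / (4 n) in \<open>\<rho>\<close> keeps the two events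
  disjoint.\<close>

lemma chance_recursion:
  "chance (Suc i) 0 = \<rho> * chance i 0"
  "chance (Suc i) (Suc N) \<le> \<rho> * chance i (Suc N) + chance i N / (4 * real n)"
proof -
  show "chance (Suc i) 0 = \<rho> * chance i 0" by (simp add: chance_def)
  have "chance (Suc i) (Suc N) = \<rho> * chance i (Suc N) + \<rho> * (chance i N / (4 * real n))"
    by (simp add: chance_def add_divide_distrib algebra_simps)
  also have "\<rho> * (chance i N / (4 * real n)) \<le> 1 * (chance i N / (4 * real n))"
    using \<rho>_bounds chance_nonneg[of i N] by (intro mult_right_mono) auto
  finally show "chance (Suc i) (Suc N) \<le> \<rho> * chance i (Suc N) + chance i N / (4 * real n)" by simp
qed

text \<open>\<open>S\<close> is the set of vertices dangerous at the start. Their degrees stay at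
  most 3 m / 8, so at least half of the positions are free for such an end, and it is joined with
  probability at least 1 / (4 n). All other degrees stay at most m / 4; once no end in
  \<open>S\<close> is left, \<open>outer\<close> applies.\<close>

lemma window:
  assumes G: "0 \<le> G" "G \<le> 1" and w: "m + w + r \<le> n"
    and outer: "\<And>h ys Ms. legal_play h \<Longrightarrow> valid n h ys Ms \<Longrightarrow> card Ms = m + w \<Longrightarrow>
        length (maker_view h) + m + w = n \<Longrightarrow> (\<And>e x. e \<in> Ms \<Longrightarrow> x \<in> e \<Longrightarrow> 4 * deg (B h) x \<le> m) \<Longrightarrow>
        lose (T2 + w) h (resume w ys Ms) \<le> 1 - G"
  shows "i \<le> r \<Longrightarrow> legal_play h \<Longrightarrow> valid n h ys Ms \<Longrightarrow> card Ms = m + w + i \<Longrightarrow>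
    length (maker_view h) + m + w + i = n \<Longrightarrow>
    (\<And>e x. e \<in> Ms \<Longrightarrow> x \<in> e \<Longrightarrow>
       8 * (deg (B h) x + b * i) \<le> 3 * m \<and> (x \<notin> S \<longrightarrow> 4 * (deg (B h) x + b * i) \<le> m)) \<Longrightarrow>
    lose (T2 + w + i) h (resume (w + i) ys Ms) \<le> 1 - G * chance i (hits Ms S)"
proof (induction i arbitrary: h ys Ms)
  case 0
  note v = 0(3)
  show ?case
  proof (cases "hits Ms S = 0")
    case True
    have "e \<inter> S = {}" if "e \<in> Ms" for e
    proof -
      have "card (e \<inter> S) = 0" using True that valid_finite[OF v] unfolding hits_def by simp
      then show ?thesis using valid_card2(3)[OF v n3 that] by simp
    qed
    then have "4 * deg (B h) x \<le> m" if "e \<in> Ms" "x \<in> e" for e x using 0(6)[OF that] that by auto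
    then have "lose (T2 + w) h (resume w ys Ms) \<le> 1 - G" using 0 by (intro outer) auto
    then show ?thesis using True by (simp add: chance_def)
  next
    case False
    \<comment> \<open>A dangerous end is left over; \<open>0 choose N\<close> vanishes for positive
      \<open>N\<close>, so the bound is trivial.\<close>
    then show ?thesis using lose_le_1 by (simp add: chance_def binomial_eq_0)
  qed
next
  case (Suc i)
  note lp = Suc.prems(2) and v = Suc.prems(3) and cM = Suc.prems(4) and t = Suc.prems(5) and dg = Suc.prems(6)
  define N where "N = hits Ms S"
  let ?k = "real (card Ms)"
  let ?I = "pick_choices ys Ms"
  let ?z = "\<lambda>q. cut_at ys (fst (fst q)) (snd (fst q))"
  let ?u = "\<lambda>q. fst (fst q)"
  let ?e = "\<lambda>q. clip n {?u q, ?z q ! snd q}"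
  let ?bad = "\<lambda>q. {?u q, ?z q ! snd q} \<in> B h"
  let ?c = "w + Suc i"
  define A where "A = (\<lambda>N. G * chance i N)"
  have i4: "i \<le> 4 * n" using Suc.prems(1) w by linarith
  have A_anti: "N' \<le> N'' \<Longrightarrow> A N'' \<le> A N'" for N' N''
    unfolding A_def using chance_antimono[OF i4] G by (intro mult_left_mono) auto
  let ?G = "\<lambda>q. (1 - A N) + (if ?bad q then A N else 0) - (if \<not> ?bad q \<and> ?u q \<in> S then A (N - 1) - A N else 0)"
  have fin: "finite Ms" by (rule valid_finite[OF v])
  have finB: "finite (B h)" by (rule legal_play_finite[OF lp])
  have kn: "?k \<le> real n" "?k \<ge> real m + 1" using cM w Suc.prems(1) by auto
  have mp: "real m \<ge> 1" using m_pos by simp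
  note pc = pick_choices_facts[OF v n3]
  have cI: "real (card ?I) = 2 * ?k * (?k - 1)"
    unfolding pc(2) using kn mp by (simp add: of_nat_diff)
  have cI_pos: "real (card ?I) > 0" unfolding cI using kn mp by (intro mult_pos_pos) auto
  have "lose (Suc (T2 + w + i)) h (resume (w + Suc i) ys Ms) \<le> 1 - G * chance (Suc i) N"
  proof (rule lose_average[where e = ?e and f = "\<lambda>q. attempt_flip n ?c (?c - 1) (?z q) Ms (snd q)" and I = ?I and g = ?G])
    show "hamilton_step n width (resume (w + Suc i) ys Ms) =
        map_pmf (\<lambda>q. (?e q, attempt_flip n ?c (?c - 1) (?z q) Ms (snd q))) (pmf_of_set ?I)"
      by (simp add: resume_def)
    show "finite ?I" by (rule pc(1))
    show "?I \<noteq> {}" using cI_pos by auto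
    fix q assume q: "q \<in> ?I"
    define zs where "zs = ?z q"
    define j where "j = snd q"
    have p: "fst q \<in> arcs Ms" and j: "j \<in> missing_pos zs Ms" using q by (auto simp: pick_choices_def zs_def j_def)
    note vz = valid_cut_at[OF v n3 p, folded zs_def]
    have len: "length zs = n" by (rule valid_length[OF vz(1)])
    have jn: "Suc j < n" "{zs ! j, zs ! Suc j} \<in> Ms" using j len by (auto simp: missing_pos_def)
    have cMs: "{last zs, hd zs} \<in> Ms" using vz by simp
    have u: "?u q = last zs" using vz by simp
    have e: "?e q = {last zs, zs ! j}" unfolding zs_def[symmetric] unfolding u j_def[symmetric]
      using jn valid_nth(1)[OF vz(1)] valid_nth(2)[OF vz(1), of "n - 1" j] valid_nth(3)[OF vz(1)]
      by (intro clip_eq) auto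
    let ?h = "attempt a \<tau> (?e q) h"
    let ?bd = "{last zs, zs ! j} \<in> B h"
    have Gq: "?G q = (1 - A N) + (if ?bd then A N else 0) - (if \<not> ?bd \<and> last zs \<in> S then A (N - 1) - A N else 0)"
      unfolding zs_def[symmetric] unfolding u j_def[symmetric] by (rule refl)
    have "lose (T2 + w + i) ?h (attempt_flip n ?c (?c - 1) zs Ms j (?e q \<notin> B h)) \<le> ?G q"
    proof (cases ?bd)
      case True
      then show ?thesis unfolding Gq using lose_le_1 by simp
    next
      case False
      have own: "{last zs, zs ! j} \<in> maker_elems ?h" using next_play(6)[OF lp, of "?e q"] False e by simp
      note fm = flip_missing[OF vz(1) n3 cMs jn(1) next_play(5)[OF lp] own]
      let ?M = "flip_missing zs j Ms"
      have IH: "lose (T2 + w + i) ?h (resume (w + i) (two_opt j zs) ?M) \<le> 1 - G * chance i (hits ?M S)"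
      proof (rule Suc.IH)
        show "i \<le> r" using Suc.prems(1) by simp
        show "legal_play ?h" by (rule next_play(1)[OF lp])
        show "valid n ?h (two_opt j zs) ?M" by (rule fm(1))
        show "card ?M = m + w + i" using fm(2)[OF jn(2)] cM by simp
        show "length (maker_view ?h) + m + w + i = n" using next_play(4)[OF lp, of "?e q"] t by simp
        fix e' x assume ex: "e' \<in> ?M" "x \<in> e'"
        then obtain e'' where ex': "e'' \<in> Ms" "x \<in> e''"
          using cMs jn(2) unfolding flip_missing_def by blast
        show "8 * (deg (B ?h) x + b * i) \<le> 3 * m \<and> (x \<notin> S \<longrightarrow> 4 * (deg (B ?h) x + b * i) \<le> m)"
          using dg[OF ex'] next_play_deg[OF lp, of "?e q" x] by (auto simp: algebra_simps)
      qed
      have "real (hits ?M S) = real (hits Ms S) - (if last zs \<in> S then 1 else 0) - (if zs ! j \<in> S then 1 else 0)"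
        using fm(5)[OF jn(2), of "\<lambda>x. if x \<in> S then 1 else 0"]
          real_hits[of Ms S] real_hits[of ?M S] valid_card2(3)[OF v n3] valid_card2(3)[OF fm(1) n3] by simp
      then have hN: "hits ?M S \<le> N" "last zs \<in> S \<Longrightarrow> hits ?M S \<le> N - 1"
        unfolding N_def by (auto split: if_splits)
      have "1 - G * chance i (hits ?M S) \<le> ?G q"
        unfolding Gq using False A_anti[OF hN(1)] A_anti[OF hN(2)] by (auto simp: A_def)
      then show ?thesis using IH False e by (simp add: attempt_flip_def)
    qed
    then show "lose (T2 + w + i) ?h (attempt_flip n ?c (?c - 1) (?z q) Ms (snd q) (?e q \<notin> B h)) \<le> ?G q"
      by (simp only: zs_def j_def)
  next
    let ?P = "2 * real b * real n / (real m)\<^sup>2"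
    have cB: "card (B h) \<le> b * n"
    proof -
      have "card (B h) \<le> b * (length (maker_view h) div a)" using lp by (simp add: legal_play_def)
      also have "\<dots> \<le> b * n" using t by (intro mult_le_mono2 order_trans[OF div_le_dividend]) simp
      finally show ?thesis .
    qed
    have blocked: "real (card {q \<in> ?I. ?bad q}) \<le> real (card ?I) * ?P"
    proof -
      have "real (card {q \<in> ?I. ?bad q}) \<le> wdeg (B h) Ms" by (rule card_pick_blocked[OF v n3 finB])
      also have "\<dots> \<le> 4 * real (card (B h))" using lp by (intro wdeg_le_card[OF v n3]) (simp add: legal_play_def)
      also have "\<dots> \<le> 4 * (real b * real n)" using cB by (simp flip: of_nat_mult)
      also have "\<dots> = 2 * real m * real m * ?P" using mp by (simp add: power2_eq_square)
      also have "\<dots> \<le> real (card ?I) * ?P"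
        unfolding cI using kn mp by (intro mult_right_mono mult_mono) auto
      finally show ?thesis .
    qed
    have hit: "real (card {q \<in> ?I. \<not> ?bad q \<and> ?u q \<in> S}) \<ge> real (card ?I) / (4 * real n)" if "N > 0"
    proof -
      have "\<exists>e\<in>Ms. e \<inter> S \<noteq> {}"
      proof (rule ccontr)
        assume "\<not> (\<exists>e\<in>Ms. e \<inter> S \<noteq> {})"
        then have "hits Ms S = 0" unfolding hits_def by (intro sum.neutral) auto
        then show False using \<open>N > 0\<close> by (simp add: N_def)
      qed
      then obtain e u where eu: "e \<in> Ms" "u \<in> e" "u \<in> S" by blast
      obtain x y where "e = {x, y}" using valid_card2(2)[OF v n3 eu(1)] by (auto simp: card_2_iff)
      then obtain hh where p: "(u, hh) \<in> arcs Ms" using eu unfolding arcs_def by (auto simp: insert_commute)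
      define zs where "zs = cut_at ys u hh"
      note vz = valid_cut_at[OF v n3 p, simplified, folded zs_def]
      have len: "length zs = n" by (rule valid_length[OF vz(1)])
      let ?J = "missing_pos zs Ms"
      have cJ: "card ?J = card Ms - 1" using card_missing_pos[OF vz(1) n3] vz by simp
      have "card {j \<in> ?J. {u, zs ! j} \<in> B h} \<le> deg (B h) u"
        using len by (intro card_blocked_le_deg finB inj_on_subset[OF valid_nth(5)[OF vz(1)]]) (auto simp: missing_pos_def)
      moreover have "card ?J = card {j \<in> ?J. {u, zs ! j} \<in> B h} + card {j \<in> ?J. {u, zs ! j} \<notin> B h}"
        by (rule card_filter_split) simp
      moreover have "8 * deg (B h) u \<le> 3 * m" using dg[OF eu(1,2)] by simp
      ultimately have "2 * card {j \<in> ?J. {u, zs ! j} \<notin> B h} \<ge> card Ms - 1" using cJ cM by linarith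
      moreover have "card {j \<in> ?J. {u, zs ! j} \<notin> B h} = card ((\<lambda>j. ((u, hh), j)) ` {j \<in> ?J. {u, zs ! j} \<notin> B h})"
        by (rule card_image[symmetric]) (auto simp: inj_on_def)
      moreover have "\<dots> \<le> card {q \<in> ?I. \<not> ?bad q \<and> ?u q \<in> S}"
        using p eu pc(1) by (intro card_mono) (auto simp: pick_choices_def zs_def)
      ultimately have "2 * card {q \<in> ?I. \<not> ?bad q \<and> ?u q \<in> S} \<ge> card Ms - 1" by linarith
      then have "2 * real (card {q \<in> ?I. \<not> ?bad q \<and> ?u q \<in> S}) \<ge> ?k - 1" by linarith
      then have "(?k - 1) / 2 \<le> real (card {q \<in> ?I. \<not> ?bad q \<and> ?u q \<in> S})" by simp
      moreover have "real (card ?I) / (4 * real n) \<le> (?k - 1) / 2"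
      proof -
        have "?k * (?k - 1) \<le> real n * (?k - 1)" using kn mp by (intro mult_right_mono) auto
        then show ?thesis unfolding cI using n3 by (simp add: field_simps)
      qed
      ultimately show ?thesis by (rule order_trans[rotated])
    qed
    have Adiff: "A (N - 1) - A N \<ge> 0" using A_anti[of "N - 1" N] by simp
    have A0: "A N \<ge> 0" unfolding A_def using G chance_nonneg by simp
    let ?D = "if N > 0 then real (card ?I) / (4 * real n) else 0"
    have "(\<Sum>q\<in>?I. ?G q) = real (card ?I) * (1 - A N) + A N * real (card {q \<in> ?I. ?bad q})
        - (A (N - 1) - A N) * real (card {q \<in> ?I. \<not> ?bad q \<and> ?u q \<in> S})"
      by (simp only: sum.distrib sum_subtractf sum_if_card[OF pc(1)] sum_constant left_diff_distrib mult.commute mult_1_right)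
    also have "\<dots> \<le> real (card ?I) * (1 - A N) + A N * (real (card ?I) * ?P) - (A (N - 1) - A N) * ?D"
      using blocked hit Adiff A0 by (intro add_mono diff_mono mult_left_mono order_refl) auto
    also have "\<dots> \<le> real (card ?I) * (1 - G * chance (Suc i) N)"
    proof (cases N)
      case 0
      have "\<rho> * A 0 \<le> (1 - ?P) * A 0"
        using A0 unfolding 0 \<rho>_def by (intro mult_right_mono) auto
      then have "1 - A 0 + A 0 * ?P \<le> 1 - G * chance (Suc i) 0"
        unfolding chance_recursion A_def by (simp add: algebra_simps)
      from mult_left_mono[OF this less_imp_le[OF cI_pos]] show ?thesis using 0 by (simp add: algebra_simps)
    next
      case (Suc N')
      have "G * chance (Suc i) N \<le> G * (\<rho> * chance i N + chance i N' / (4 * real n))"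
        using chance_recursion(2)[of i N'] G Suc by (intro mult_left_mono) auto
      also have "\<dots> = \<rho> * A N + A (N - 1) / (4 * real n)" using Suc by (simp add: A_def algebra_simps)
      also have "\<dots> = A N - A N * ?P + (A (N - 1) - A N) / (4 * real n)"
        by (simp add: \<rho>_def algebra_simps diff_divide_distrib)
      finally have "1 - A N + A N * ?P - (A (N - 1) - A N) / (4 * real n) \<le> 1 - G * chance (Suc i) N" by linarith
      from mult_left_mono[OF this less_imp_le[OF cI_pos]] show ?thesis using Suc by (simp add: algebra_simps)
    qed
    finally show "(\<Sum>q\<in>?I. ?G q) \<le> real (card ?I) * (1 - G * chance (Suc i) N)" .
  qed
  then show ?case by (simp add: N_def)
qed

lemma \<gamma>_le_1: "\<gamma> \<le> 1"
proof -
  have "\<gamma> \<le> \<rho> ^ r" using \<gamma>_le[of 0] by (simp add: \<rho>_def)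
  also have "\<dots> \<le> 1" using \<rho>_bounds by (simp add: power_le_one)
  finally show ?thesis .
qed

text \<open>Ends of degree below m / 8 reach at most m / 4 within a window, and a favourable window
  joins all others; so the degree bound is restored at the price of a factor
  \<open>\<gamma>\<close>. The final 1 / 2 is the closing phase.\<close>

lemma windows:
  "m + q * r \<le> n \<Longrightarrow> legal_play h \<Longrightarrow> valid n h ys Ms \<Longrightarrow> card Ms = m + q * r \<Longrightarrow>
    length (maker_view h) + m + q * r = n \<Longrightarrow> (\<And>e x. e \<in> Ms \<Longrightarrow> x \<in> e \<Longrightarrow> 4 * deg (B h) x \<le> m) \<Longrightarrow>
    lose (T2 + q * r) h (resume (q * r) ys Ms) \<le> 1 - \<gamma> ^ q / 2"
proof (induction q arbitrary: h ys Ms)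
  case 0
  have bT: "real b * real T2 \<le> real n / 16"
  proof -
    have "real (16 * b * T2) \<le> real n" using T2_le by (simp only: of_nat_le_iff)
    then show ?thesis by simp
  qed
  have "sparse T2 h Ms" unfolding sparse_def
  proof (intro conjI ballI)
    have "card (B h) \<le> b * (length (maker_view h) div a)" using 0 by (simp add: legal_play_def)
    also have "\<dots> \<le> b * n" using 0 by (intro mult_le_mono2 order_trans[OF div_le_dividend]) simp
    finally have "card (B h) \<le> b * n" .
    moreover have "b * T2 \<le> n" using T2_le by linarith
    moreover have "n \<le> b * n" using b_pos by simp
    ultimately show "card (B h) + b * T2 \<le> 4 * b * n" by linarith
    fix e x assume "e \<in> Ms" "x \<in> e"
    then have "4 * deg (B h) x \<le> m" by (rule 0)
    then have "real (deg (B h) x) \<le> real n / 16" using m_le by linarith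
    then show "real (deg (B h) x) + real b * real T2 \<le> real n / 8" using bT by linarith
  qed
  then have "lose T2 h (start_fix ys Ms) \<le> real (card Ms) * fix_cost / real T2"
    using start_stage[OF large 0(3,2)] T2_pos by blast
  also have "\<dots> \<le> 1 / 2" using fix_ok 0 by simp
  finally show ?case by (simp add: resume_def)
next
  case (Suc q)
  note lp = Suc.prems(2) and v = Suc.prems(3)
  let ?S = "{x. m \<le> 8 * deg (B h) x}"
  have eq: "m + Suc q * r = m + q * r + r" by simp
  have G: "0 \<le> \<gamma> ^ q / 2" "\<gamma> ^ q / 2 \<le> 1"
  proof -
    have "\<gamma> ^ q \<le> 1" using \<gamma>_pos \<gamma>_le_1 by (rule power_le_one)
    then show "\<gamma> ^ q / 2 \<le> 1" by simp
    show "0 \<le> \<gamma> ^ q / 2" using \<gamma>_pos by simp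
  qed
  have w: "lose (T2 + q * r + r) h (resume (q * r + r) ys Ms) \<le> 1 - \<gamma> ^ q / 2 * chance r (hits Ms ?S)"
  proof (rule window[OF G])
    show "m + q * r + r \<le> n" using Suc.prems(1) by simp
    show "lose (T2 + q * r) h' (resume (q * r) ys' Ms') \<le> 1 - \<gamma> ^ q / 2"
      if "legal_play h'" "valid n h' ys' Ms'" "card Ms' = m + q * r"
        "length (maker_view h') + m + q * r = n" "\<And>e x. e \<in> Ms' \<Longrightarrow> x \<in> e \<Longrightarrow> 4 * deg (B h') x \<le> m" for h' ys' Ms'
      by (rule Suc.IH) (use that in auto)
    show "card Ms = m + q * r + r" "length (maker_view h) + m + q * r + r = n" using Suc.prems by auto
    fix e x assume ex: "e \<in> Ms" "x \<in> e"
    have "4 * deg (B h) x \<le> m" by (rule Suc.prems(6)[OF ex])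
    then show "8 * (deg (B h) x + b * r) \<le> 3 * m \<and> (x \<notin> ?S \<longrightarrow> 4 * (deg (B h) x + b * r) \<le> m)"
      using r_le by auto
  qed (use lp v in auto)
  \<comment> \<open>Each dangerous end contributes at least m / 8 to \<open>wdeg\<close>, which is
    at most 4 b n; so there are at most \<open>K\<close> of them.\<close>
  have "real m * real (hits Ms ?S) \<le> 8 * wdeg (B h) Ms"
  proof -
    have "real m * real (hits Ms ?S) = (\<Sum>e\<in>Ms. \<Sum>x\<in>e. real m * (if x \<in> ?S then 1 else 0))"
      using real_hits[of Ms ?S] valid_card2(3)[OF v n3] by (simp add: sum_distrib_left)
    also have "\<dots> \<le> (\<Sum>e\<in>Ms. \<Sum>x\<in>e. 8 * real (deg (B h) x))"
      by (intro sum_mono) auto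
    finally show ?thesis by (simp add: wdeg_def sum_distrib_left)
  qed
  also have "\<dots> \<le> 8 * (4 * real (card (B h)))"
    using lp by (intro mult_left_mono wdeg_le_card[OF v n3]) (auto simp: legal_play_def)
  also have "\<dots> \<le> real (32 * b * n)"
  proof -
    have "card (B h) \<le> b * (length (maker_view h) div a)" using lp by (simp add: legal_play_def)
    also have "\<dots> \<le> b * n" using Suc.prems(5) by (intro mult_le_mono2 order_trans[OF div_le_dividend]) simp
    finally show ?thesis by (simp flip: of_nat_mult)
  qed
  also have "\<dots> \<le> real (K * m)" using K by (simp only: of_nat_le_iff)
  finally have "real (hits Ms ?S) \<le> real K" using m_pos by simp
  then have "\<gamma> \<le> chance r (hits Ms ?S)" using \<gamma>_le[of "hits Ms ?S"] by (simp add: chance_def \<rho>_def)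
  then have "\<gamma> ^ q / 2 * \<gamma> \<le> \<gamma> ^ q / 2 * chance r (hits Ms ?S)" using G by (intro mult_left_mono)
  then show ?case using w by (simp add: add_ac mult_ac)
qed

lemma fast_breaker_bound:
  assumes "n = m + q * r"
  shows "success_prob (hamilton_cycles n) a \<tau> (hamilton_step n width) {0, 1} (T2 + q * r) []
     (resume (q * r) [0..<n] (set (cycle_edges [0..<n]))) \<ge> \<gamma> ^ q / 2"
proof -
  let ?M = "set (cycle_edges [0..<n])"
  have "distinct (cycle_edges [0..<n])" using n3 by (intro distinct_cycle_edges) auto
  then have cM: "card ?M = n" using n3 by (simp add: distinct_card cycle_edges_def)
  have "lose (T2 + q * r) [] (resume (q * r) [0..<n] ?M) \<le> 1 - \<gamma> ^ q / 2"
    using cM assms legal_play_Nil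
    by (intro windows) (auto simp: valid_def deg_def breaker_elems_def)
  then show ?thesis by (simp add: lose_def)
qed

end

section \<open>Choice of the parameters\<close>

text \<open>The error of \<open>slow_breaker_bound\<close> with \<open>dmax = n / 16\<close> and the
  estimates \<open>slack0 \<ge> m / 4\<close> and \<open>T2 \<ge> n / (64 * b)\<close>
  inserted.\<close>

definition slow_error :: "nat \<Rightarrow> nat \<Rightarrow> nat \<Rightarrow> real" where
  "slow_error b n m = (4 / real m + 16 * (12 * real b + 3) / real n) *
       (2 * (8 * real n / (real m)\<^sup>2) * (2 + 8 * real n / real m)) * real n
     + 192 * real b / real n * (sqrt (real m + 1) * sqrt (real n + 1))
     + 64 * real b * hamilton_game.fix_cost b * real m / real n"

lemma maker_achieves_slow:
  assumes "a > 0" "b > 0" "b \<le> a" "n \<ge> 400 * hamilton_game.width b * b + 100"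
    "m \<ge> 16" "16 * n \<le> m * m" "32 * b * m \<le> n" and n64: "n \<ge> 64 * b"
  shows "maker_achieves (complete_edges n) (hamilton_cycles n) a b (1 - slow_error b n m)"
proof -
  define T2 where "T2 = n div (32 * b)"
  let ?w = "hamilton_game.width b"
  let ?s = "resume (n - m) [0..<n] (set (cycle_edges [0..<n]))"
  have T2_lower: "real T2 \<ge> real n / (64 * real b)"
  proof -
    have "2 * (n div (32 * b)) * (32 * b) \<ge> n"
    proof -
      have "n mod (32 * b) < 32 * b" using assms(2) by simp
      moreover have "n div (32 * b) * (32 * b) + n mod (32 * b) = n" by (rule div_mult_mod_eq)
      moreover have "n div (32 * b) \<ge> 1" using n64 assms(2) by (simp add: div_greater_zero_iff Suc_le_eq)
      then have "32 * b \<le> n div (32 * b) * (32 * b)" by simp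
      ultimately show ?thesis by linarith
    qed
    then have "real n \<le> real (2 * T2 * (32 * b))" unfolding T2_def by (simp only: of_nat_le_iff)
    then show ?thesis using assms(2) by (simp add: field_simps)
  qed
  show ?thesis
  proof (rule maker_achievesI)
    show "a > 0" by fact
    show "{0, 1} \<in> complete_edges n" using assms(4) by (auto simp: complete_edges_def)
    show "(e, f) \<in> set_pmf (hamilton_step n ?w st) \<Longrightarrow> e \<in> complete_edges n" for st e f
      using hamilton_step_legal[of n] assms(4) by fastforce
    fix \<tau> assume \<tau>: "legal_breaker (complete_edges n) b \<tau>"
    interpret hamilton_game n a b \<tau>
      by unfold_locales (use assms \<tau> in auto)
    have T2: "16 * b * (T2 + m div 2) \<le> n"
    proof -
      have "32 * b * T2 \<le> n" unfolding T2_def by simp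
      then have "32 * (b * T2) \<le> n" by (simp only: mult.assoc)
      moreover have "b * (2 * (m div 2)) \<le> b * m" by (intro mult_le_mono2) simp
      moreover have "32 * (b * m) \<le> n" using assms(7) by (simp only: mult.assoc)
      ultimately have "16 * (b * T2) + 16 * (b * (m div 2)) \<le> n" by linarith
      then show ?thesis by (simp add: distrib_left mult.assoc)
    qed
    have T2_pos: "T2 > 0" using n64 assms(2) by (simp add: T2_def div_greater_zero_iff)
    have m_le: "m \<le> n" using assms(2,7) by (metis le_trans mult.commute mult_le_mono2 nat_mult_1_right One_nat_def Suc_leI nat_0_less_mult_iff zero_less_numeral)
    interpret slow_breaker_game n a b \<tau> m T2
      by unfold_locales (use assms m_le T2 T2_pos in \<open>auto simp: large_board_def\<close>)
    have "1 - slow_error b n m \<le> 1 - (scale * pick_cost * real n + 12 * real b / dmax * (sqrt (real m + 1) * sqrt (real n + 1))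
      + real m * fix_cost / real T2)"
    proof -
      have "real slack0 \<ge> real m / 4" using assms(5) unfolding slack0_def by linarith
      then have "1 / real slack0 \<le> 1 / (real m / 4)" using pos(2) by (intro divide_left_mono) auto
      then have "scale \<le> 4 / real m + 16 * (12 * real b + 3) / real n"
        unfolding scale_def dmax_def by simp
      then have 1: "scale * pick_cost * real n \<le> (4 / real m + 16 * (12 * real b + 3) / real n) *
         (2 * (8 * real n / (real m)\<^sup>2) * (2 + 8 * real n / real m)) * real n"
        unfolding pick_cost_def fail_prob_def pend_cost_def by (intro mult_right_mono) auto
      have "real m * fix_cost / real T2 \<le> real m * fix_cost / (real n / (64 * real b))"
        using T2_lower fix_cost_pos pos(1) b_pos by (intro frac_le) auto
      then have 2: "real m * fix_cost / real T2 \<le> 64 * real b * fix_cost * real m / real n" by (simp add: mult_ac)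
      show ?thesis using 1 2 unfolding slow_error_def dmax_def by simp
    qed
    also have "\<dots> \<le> success_prob (hamilton_cycles n) a \<tau> (hamilton_step n width) {0, 1} (T2 + (n - m) + m div 2) [] ?s"
      using slow_breaker_bound by (simp add: slack0_def)
    finally show "1 - slow_error b n m \<le>
      success_prob (hamilton_cycles n) a \<tau> (hamilton_step n ?w) {0, 1} (T2 + (n - m) + m div 2) [] ?s" .
  qed
qed

lemma one_minus_ge_exp:
  fixes x :: real
  assumes "0 \<le> x" "x \<le> 1 / 2"
  shows "exp (- 2 * x) \<le> 1 - x"
proof -
  have "2 * x\<^sup>2 \<le> x" using mult_left_mono[OF assms(2,1)] by (simp add: power2_eq_square)
  then have "- 2 * x \<le> ln (1 - x)" using ln_one_minus_pos_lower_bound[OF assms] by linarith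
  then have "exp (- 2 * x) \<le> exp (ln (1 - x))" by simp
  then show ?thesis using assms by simp
qed

lemma maker_achieves_fast:
  assumes "a > 0" "b > 0"
  shows "\<exists>c::real. c > 0 \<and> (\<exists>n0. \<forall>n\<ge>n0. maker_achieves (complete_edges n) (hamilton_cycles n) a b c)"
proof -
  let ?w = "hamilton_game.width b"
  let ?F = "hamilton_game.fix_cost b"
  \<comment> \<open>\<open>M\<close> is n / m up to a factor 2. Its size makes the closing phase
    fail with probability at most 1 / 2.\<close>
  define M where "M = nat \<lceil>128 * real b * ?F\<rceil> + 8"
  \<comment> \<open>\<open>Q\<close> windows of length \<open>n div Q\<close> would use up almost
    all picks. Leaving out \<open>8 * b\<close> of them makes m at least \<open>8 * b * r\<close>,
    as the windows require.\<close>
  define Q where "Q = 8 * b * M"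
  define q where "q = Q - 8 * b"
  define K where "K = 32 * b * M"
  \<comment> \<open>From \<open>n \<le> M * m\<close> it follows that \<open>\<rho>\<close> is at
    least \<open>1 - X / n\<close>.\<close>
  define X where "X = 2 * real b * (real M)\<^sup>2 + 1"
  \<comment> \<open>The exponential bounds the power of \<open>\<rho>\<close>. The other factor
    comes from \<open>r choose N\<close> being at least (r / N)^N, with r at least n / (2 Q) and N
    at most K.\<close>
  define \<gamma> where "\<gamma> = exp (- 2 * X) * (1 / (8 * real Q * real K)) ^ K"
  define n0 where "n0 = 400 * ?w * b + 100 + 64 * b + M * Q + 2 * Q * K + 2 * Q + nat \<lceil>2 * X\<rceil>"
  have M: "M \<ge> 8" "real M \<ge> 128 * real b * ?F" unfolding M_def by (simp, linarith)
  have Q: "Q > 0" "K > 0" "8 * b \<le> Q" using M assms by (auto simp: Q_def K_def)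
  have QM: "real Q = 8 * real b * real M" by (simp add: Q_def)
  have \<gamma>_pos: "\<gamma> > 0" unfolding \<gamma>_def using Q by (intro mult_pos_pos zero_less_power divide_pos_pos) auto
  have "maker_achieves (complete_edges n) (hamilton_cycles n) a b (\<gamma> ^ q / 2)" if n: "n \<ge> n0" for n
  proof -
    define r where "r = n div Q"
    define m where "m = n - q * r"
    define T2 where "T2 = n div (16 * b)"
    have nb: "n \<ge> 400 * ?w * b + 100" "n \<ge> 64 * b" "n \<ge> M * Q" "n \<ge> 2 * Q * K" "n \<ge> 2 * Q" "n \<ge> nat \<lceil>2 * X\<rceil>"
      using n unfolding n0_def by linarith+
    have npos: "real n > 0" using nb(1) by simp
    have nX: "real n \<ge> 2 * X" using nb(6) by linarith
    have rQ: "r * Q \<le> n" "n < r * Q + Q" unfolding r_def using Q(1)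
      by (simp, metis div_mult_mod_eq mod_less_divisor nat_add_left_cancel_less)
    have qr: "q * r + 8 * b * r = Q * r" using Q(3) by (simp add: q_def flip: distrib_right)
    have m_eq: "n = m + q * r" using rQ(1) qr unfolding m_def by (simp add: mult.commute)
    have r_le: "8 * b * r \<le> m" using m_eq qr rQ(1) by (simp add: mult.commute)
    have r_lower: "real r \<ge> real n / (2 * real Q)"
    proof -
      have "n \<le> 2 * (r * Q)" using rQ(2) nb(5) by linarith
      then have "real n \<le> real (2 * (r * Q))" by (simp only: of_nat_le_iff)
      then show ?thesis using Q(1) by (simp add: field_simps)
    qed
    have m_lower: "n \<le> M * m"
    proof -
      have "Q * m + q * (Q * r) = Q * n" using arg_cong[OF m_eq, of "\<lambda>x. Q * x"] by (simp add: algebra_simps)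
      moreover have "q * (Q * r) \<le> q * n" using rQ(1) by (intro mult_le_mono2) (simp add: mult.commute)
      moreover have "q * n + 8 * b * n = Q * n" using Q(3) by (simp add: q_def flip: distrib_right)
      ultimately have "8 * b * n \<le> Q * m" by linarith
      then have "8 * b * n \<le> 8 * b * (M * m)" by (simp add: Q_def mult_ac)
      then show ?thesis using assms(2) by simp
    qed
    have m_upper: "M * m \<le> 2 * n"
    proof -
      have "q * (n + 1) \<le> q * (r * Q + Q)" using rQ(2) by (intro mult_le_mono2) simp
      then have "q * n \<le> Q * (q * r) + q * Q" by (simp add: algebra_simps)
      moreover have "Q * n = Q * m + Q * (q * r)" using arg_cong[OF m_eq, of "\<lambda>x. Q * x"] by (simp add: distrib_left)
      moreover have "q * n + 8 * b * n = Q * n" using Q(3) by (simp add: q_def flip: distrib_right)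
      moreover have "q * Q \<le> Q * Q" unfolding q_def by simp
      moreover have "Q * Q \<le> 8 * b * n" using nb(3) mult_le_mono2[of "M * Q" n "8 * b"] by (simp add: Q_def mult_ac)
      ultimately have "Q * m \<le> 8 * b * n + 8 * b * n" by linarith
      then have "8 * b * (M * m) \<le> 8 * b * (2 * n)" by (simp add: Q_def mult_ac)
      then show ?thesis using assms(2) by simp
    qed
    have m_pos: "m > 0" using m_lower npos by (cases m) auto
    have mreal: "real n \<le> real M * real m" "real M * real m \<le> 2 * real n"
      using m_lower m_upper by (metis of_nat_le_iff of_nat_mult, metis of_nat_le_iff of_nat_mult of_nat_numeral)
    have T2_lower: "real T2 \<ge> real n / (32 * real b)"
    proof -
      have "n mod (16 * b) < 16 * b" using assms(2) by simp
      moreover have "n div (16 * b) * (16 * b) + n mod (16 * b) = n" by (rule div_mult_mod_eq)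
      moreover have "n div (16 * b) \<ge> 1" using nb(2) assms(2) by (simp add: div_greater_zero_iff Suc_le_eq)
      then have "16 * b \<le> n div (16 * b) * (16 * b)" by simp
      ultimately have "n \<le> 2 * T2 * (16 * b)" unfolding T2_def by linarith
      then have "real n \<le> real (2 * T2 * (16 * b))" by (simp only: of_nat_le_iff)
      then show ?thesis using assms(2) by (simp add: field_simps)
    qed
    have T2_pos: "T2 > 0" using T2_lower npos assms(2) by (cases "T2 = 0") (auto simp: divide_le_0_iff)
    define \<rho> where "\<rho> = 1 - 2 * real b * real n / (real m)\<^sup>2 - 1 / (4 * real n)"
    have \<rho>: "\<rho> \<ge> 1 - X / real n"
    proof -
      have "real n * real n \<le> (real M * real m) * (real M * real m)" using mreal(1) by (intro mult_mono) auto
      then have "(real n)\<^sup>2 \<le> (real M)\<^sup>2 * (real m)\<^sup>2" by (simp add: power2_eq_square mult_ac)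
      then have "(real n)\<^sup>2 / (real m)\<^sup>2 \<le> (real M)\<^sup>2" using m_pos by (simp add: divide_le_eq)
      then have "2 * real b / real n * ((real n)\<^sup>2 / (real m)\<^sup>2) \<le> 2 * real b / real n * (real M)\<^sup>2"
        by (intro mult_left_mono) auto
      then have "2 * real b * real n / (real m)\<^sup>2 \<le> 2 * real b * (real M)\<^sup>2 / real n"
        using npos by (simp add: power2_eq_square)
      moreover have "1 / (4 * real n) \<le> 1 / real n" using npos by (intro divide_left_mono) auto
      ultimately show ?thesis unfolding \<rho>_def X_def by (simp add: add_divide_distrib)
    qed
    have X0: "X \<ge> 0" unfolding X_def by simp
    have Xn: "0 \<le> X / real n" "X / real n \<le> 1 / 2" using nX npos X0 by (auto simp: field_simps)
    have "0 \<le> 2 * real b * real n / (real m)\<^sup>2" "0 \<le> 1 / (4 * real n)" by simp_all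
    then have \<rho>0: "0 \<le> \<rho>" "\<rho> \<le> 1" using \<rho> Xn unfolding \<rho>_def by linarith+
    have \<rho>_pow: "exp (- 2 * X) \<le> \<rho> ^ r"
    proof -
      have "r \<le> n" unfolding r_def by simp
      have "exp (- 2 * X) = exp (- 2 * (X / real n)) ^ n"
        using npos by (simp add: exp_of_nat_mult[symmetric])
      also have "\<dots> \<le> \<rho> ^ n"
        using one_minus_ge_exp[OF Xn] \<rho> by (intro power_mono) auto
      also have "\<dots> \<le> \<rho> ^ r" using \<rho>0 \<open>r \<le> n\<close> by (intro power_decreasing) auto
      finally show ?thesis .
    qed
    have Kr: "K \<le> r"
    proof -
      have "2 * real Q * real K \<le> real n" using nb(4) by (metis of_nat_le_iff of_nat_mult of_nat_numeral)
      then have "real K \<le> real n / (2 * real Q)" using Q(1) by (simp add: field_simps)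
      then show ?thesis using r_lower by linarith
    qed
    have \<gamma>_le: "\<gamma> \<le> \<rho> ^ r * real (r choose N) / (4 * real n) ^ N" if N: "N \<le> K" for N
    proof -
      let ?x = "1 / (8 * real Q * real K)"
      have "?x ^ K \<le> ?x ^ N"
      proof (rule power_decreasing[OF N])
        have "1 \<le> Q * K" using Q by simp
        then have "1 \<le> real (Q * K)" by (metis of_nat_1 of_nat_le_iff)
        then show "?x \<le> 1" by (simp add: divide_le_eq_1 mult.assoc)
      qed simp
      also have "\<dots> \<le> (real r / real N / (4 * real n)) ^ N"
      proof (cases "N = 0")
        case False
        have "?x \<le> real r / real N / (4 * real n)"
        proof -
          have "?x = real n / (2 * real Q) / real K / (4 * real n)" using npos by simp
          also have "\<dots> \<le> real r / real N / (4 * real n)"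
            using r_lower N False npos by (intro divide_right_mono frac_le) auto
          finally show ?thesis .
        qed
        then show ?thesis by (intro power_mono) auto
      qed simp
      also have "\<dots> = (real r / real N) ^ N / (4 * real n) ^ N" by (rule power_divide)
      also have "\<dots> \<le> real (r choose N) / (4 * real n) ^ N"
        using binomial_ge_n_over_k_pow_k[of N r, where 'a = real] N Kr by (intro divide_right_mono) auto
      finally have "?x ^ K \<le> real (r choose N) / (4 * real n) ^ N" .
      then have "\<gamma> \<le> \<rho> ^ r * (real (r choose N) / (4 * real n) ^ N)"
        unfolding \<gamma>_def using \<rho>_pow \<rho>0 by (intro mult_mono) auto
      then show ?thesis by simp
    qed
    show ?thesis
    proof (rule maker_achievesI)
      show "a > 0" by fact
      show "{0, 1} \<in> complete_edges n" using nb(1) by (auto simp: complete_edges_def)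
      show "(e, f) \<in> set_pmf (hamilton_step n ?w st) \<Longrightarrow> e \<in> complete_edges n" for st e f
        using hamilton_step_legal[of n] nb(1) by fastforce
      fix \<tau> assume \<tau>: "legal_breaker (complete_edges n) b \<tau>"
      interpret hamilton_game n a b \<tau>
        by unfold_locales (use assms \<tau> nb(1) in auto)
      have fix_ok: "real m * fix_cost / real T2 \<le> 1 / 2"
      proof -
        have Mp: "real M > 0" using M(1) by simp
        have "real m * fix_cost / real T2 \<le> (2 * real n / real M) * fix_cost / (real n / (32 * real b))"
          using mreal(2) T2_lower fix_cost_pos npos b_pos Mp
          by (intro frac_le mult_right_mono mult_nonneg_nonneg) (auto simp: field_simps)
        also have "\<dots> = 64 * real b * fix_cost / real M" using npos by simp
        also have "\<dots> \<le> 1 / 2" using M(2) Mp by (simp add: divide_simps)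
        finally show ?thesis .
      qed
      interpret fast_breaker_game n a b \<tau> m T2 r K \<gamma>
      proof unfold_locales
        show large_board using nb(1) by (simp add: large_board_def)
        have "8 * m \<le> M * m" using M(1) by simp
        then show "4 * m \<le> n" using m_upper by linarith
        show "16 * b * T2 \<le> n" by (simp add: T2_def)
        show "32 * b * n \<le> K * m" using mult_le_mono2[OF m_lower, of "32 * b"] by (simp add: K_def mult_ac)
        show "0 \<le> 1 - 2 * real b * real n / (real m)\<^sup>2 - 1 / (4 * real n)" using \<rho>0(1) by (simp add: \<rho>_def)
        show "\<gamma> \<le> (1 - 2 * real b * real n / (real m)\<^sup>2 - 1 / (4 * real n)) ^ r * real (r choose N) / (4 * real n) ^ N"
          if "N \<le> K" for N using \<gamma>_le[OF that] by (simp add: \<rho>_def)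
      qed (use m_pos T2_pos fix_ok r_le \<gamma>_pos in auto)
      show "\<gamma> ^ q / 2 \<le> success_prob (hamilton_cycles n) a \<tau> (hamilton_step n ?w) {0, 1} (T2 + q * r) []
          (resume (q * r) [0..<n] (set (cycle_edges [0..<n])))"
        by (rule fast_breaker_bound[OF m_eq])
    qed
  qed
  moreover have "\<gamma> ^ q / 2 > 0" using \<gamma>_pos by simp
  ultimately show ?thesis by blast
qed

theorem theorem6:
  fixes a b :: nat
  assumes "a > 0" and "b > 0"
  shows "(b > a \<longrightarrow>
            (\<exists>c::real. c > 0 \<and> (\<exists>n0. \<forall>n\<ge>n0.
               maker_achieves (complete_edges n) (hamilton_cycles n) a b c))) \<and>
         (b \<le> a \<longrightarrow>
            (\<exists>p::nat \<Rightarrow> real. p \<longlonglongrightarrow> 1 \<and> (\<exists>n0. \<forall>n\<ge>n0.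
               maker_achieves (complete_edges n) (hamilton_cycles n) a b (p n))))"
proof (intro conjI impI)
  show "\<exists>c::real. c > 0 \<and> (\<exists>n0. \<forall>n\<ge>n0. maker_achieves (complete_edges n) (hamilton_cycles n) a b c)"
    by (rule maker_achieves_fast[OF assms])
next
  assume ba: "b \<le> a"
  \<comment> \<open>Any exponent strictly between 3/4 and 1 works: the error terms are of order n^3
    / m^4, n^2 / m^3, sqrt (m / n) and m / n.\<close>
  define m where "m = (\<lambda>n::nat. nat \<lceil>real n powr (9/10)\<rceil>)"
  define w where "w = hamilton_game.width b"
  define F where "F = hamilton_game.fix_cost b"
  show "\<exists>p::nat \<Rightarrow> real. p \<longlonglongrightarrow> 1 \<and> (\<exists>n0. \<forall>n\<ge>n0. maker_achieves (complete_edges n) (hamilton_cycles n) a b (p n))"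
  proof (intro exI[of _ "\<lambda>n. 1 - slow_error b n (m n)"] conjI)
    have 1: "(\<lambda>n. 4 / real (m n) * (2 * (8 * real n / (real (m n))\<^sup>2) * (2 + 8 * real n / real (m n))) * real n) \<longlonglongrightarrow> 0"
      unfolding m_def by real_asymp
    have 2: "(\<lambda>n. 1 / real n * (2 * (8 * real n / (real (m n))\<^sup>2) * (2 + 8 * real n / real (m n))) * real n) \<longlonglongrightarrow> 0"
      unfolding m_def by real_asymp
    have 3: "(\<lambda>n. 1 / real n * (sqrt (real (m n) + 1) * sqrt (real n + 1))) \<longlonglongrightarrow> 0"
      unfolding m_def by real_asymp
    have 4: "(\<lambda>n. real (m n) / real n) \<longlonglongrightarrow> 0"
      unfolding m_def by real_asymp
    have "(\<lambda>n. 4 / real (m n) * (2 * (8 * real n / (real (m n))\<^sup>2) * (2 + 8 * real n / real (m n))) * real n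
      + 16 * (12 * real b + 3) * (1 / real n * (2 * (8 * real n / (real (m n))\<^sup>2) * (2 + 8 * real n / real (m n))) * real n)
      + 192 * real b * (1 / real n * (sqrt (real (m n) + 1) * sqrt (real n + 1)))
      + 64 * real b * F * (real (m n) / real n)) \<longlonglongrightarrow>
      0 + 16 * (12 * real b + 3) * 0 + 192 * real b * 0 + 64 * real b * F * 0"
      by (intro tendsto_add tendsto_mult_left 1 2 3 4)
    moreover have "(\<lambda>n. 4 / real (m n) * (2 * (8 * real n / (real (m n))\<^sup>2) * (2 + 8 * real n / real (m n))) * real n
      + 16 * (12 * real b + 3) * (1 / real n * (2 * (8 * real n / (real (m n))\<^sup>2) * (2 + 8 * real n / real (m n))) * real n)
      + 192 * real b * (1 / real n * (sqrt (real (m n) + 1) * sqrt (real n + 1)))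
      + 64 * real b * F * (real (m n) / real n)) = (\<lambda>n. slow_error b n (m n))"
    proof (intro ext)
      fix n
      have e: "(u + A / x) * Y * x = u * Y * x + A * (1 / x * Y * x)" for u A x Y :: real
        by (simp add: algebra_simps)
      show "4 / real (m n) * (2 * (8 * real n / (real (m n))\<^sup>2) * (2 + 8 * real n / real (m n))) * real n
        + 16 * (12 * real b + 3) * (1 / real n * (2 * (8 * real n / (real (m n))\<^sup>2) * (2 + 8 * real n / real (m n))) * real n)
        + 192 * real b * (1 / real n * (sqrt (real (m n) + 1) * sqrt (real n + 1)))
        + 64 * real b * F * (real (m n) / real n) = slow_error b n (m n)"
        unfolding slow_error_def F_def e by (simp only: times_divide_eq_right times_divide_eq_left mult_1_right)
    qed
    ultimately have "(\<lambda>n. slow_error b n (m n)) \<longlonglongrightarrow> 0" by simp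
    from tendsto_diff[OF tendsto_const[of 1] this] show "(\<lambda>n. 1 - slow_error b n (m n)) \<longlonglongrightarrow> 1" by simp
    have "eventually (\<lambda>n. real (m n) \<ge> 16) at_top"
      "eventually (\<lambda>n. 16 * real n \<le> real (m n) * real (m n)) at_top"
      unfolding m_def by real_asymp+
    moreover have "eventually (\<lambda>n. real (m n) / real n < 1 / (32 * real b)) at_top"
      using 4 assms(2) by (intro order_tendstoD(2)[OF 4]) simp
    moreover have "eventually (\<lambda>n. n \<ge> 400 * w * b + 100 + 64 * b) at_top" by (rule eventually_ge_at_top)
    ultimately have "eventually (\<lambda>n. maker_achieves (complete_edges n) (hamilton_cycles n) a b (1 - slow_error b n (m n))) at_top"
    proof eventually_elim
      case (elim n)
      show ?case
      proof (rule maker_achieves_slow[OF assms ba])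
        show "400 * hamilton_game.width b * b + 100 \<le> n" "64 * b \<le> n" using elim(4) by (simp_all add: w_def)
        show "16 \<le> m n" using elim(1) by simp
        show "16 * n \<le> m n * m n" using elim(2) by (simp flip: of_nat_mult)
        have "real (32 * b * m n) \<le> real n"
          using elim(3,4) assms(2) by (simp add: field_simps)
        then show "32 * b * m n \<le> n" by (simp only: of_nat_le_iff)
      qed
    qed
    then show "\<exists>n0. \<forall>n\<ge>n0. maker_achieves (complete_edges n) (hamilton_cycles n) a b (1 - slow_error b n (m n))"
      by (simp add: eventually_at_top_linorder)
  qed
qed

end
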